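(* Let $\lambda$ be a parameter with $1\le\lambda\le n$ and let $(F,\mathcal{L})$ be a $\lambda$-good face-laminar pair. Then there exist a weight function $w\in\mathcal{W}^{\log_2 n+1}$ and a laminar family $\mathcal{L}'\supseteq\mathcal{L}$ such that $(\mathrm{Min}(F,w),\mathcal{L}')$ is a $2\lambda$-good face-laminar pair.
   Context: $G=(V,E)$ is a fixed undirected simple graph with $n$ vertices ($n$ sufficiently large; $\log_2 n$ assumed integral, otherwise read as $\lceil\log_2 n\rceil$). For $S\subseteq V$, $\delta(S)$ denotes the edges with exactly one endpoint in $S$, $E(S)$ the edges with both endpoints in $S$; for $x\in\mathbb{R}^E$, $x(\delta(S))=\sum_{e\in\delta(S)}x_e$. $\mathrm{PM}$ is the perfect matching polytope $\{x\in\mathbb{R}^E: x(\delta(v))=1\ \forall v\in V,\ x(\delta(S))\ge1\ \forall S\subseteq V \text{ with }|S|\text{ odd},\ x\ge0\}$ (the convex hull of indicator vectors of perfect matchings). A face is a nonempty subset of $\mathrm{PM}$ obtained by setting some of these inequalities to equality; a perfect matching $M$ is in $F$ if its indicator vector is in $F$. For a face $F$: $\mathrm{supp}(F)=\{e\in E:\exists x\in F,\ x_e>0\}$; $\mathrm{tight}(F)=\{S\subseteq V: |S| \text{ odd},\ x(\delta(S))=1\ \forall x\in F\}$. For $w:E\to\mathbb{R}$, $\mathrm{Min}(F,w)=\arg\min\{\langle w,x\rangle:x\in F\}$. Weight functions: fix a numbering $E=\{e_1,\dots,e_{|E|}\}$; for integer $t\ge7$, $\mathcal W(t)=\{w_k:k=2,\dots,t\}$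 with $w_k(e_j)=(4n^2+1)^j\bmod k$; $\mathcal W=\mathcal W(n^{20})$; for $w:E\to\mathbb{Z}$, $w'\in\mathcal W$, $w\circ w'=n^{21}w+w'$; $\mathcal W^k$ is the set of all $(\cdots(w_1\circ w_2)\circ\cdots)\circ w_k$ with $w_i\in\mathcal W$. Two sets $S,T\subseteq V$ cross if $S\cap T$, $S\setminus T$, $T\setminus S$ are all nonempty; a family is laminar if no two members cross; a maximal laminar subset of a family $\mathcal S$ is a laminar $\mathcal L\subseteq\mathcal S$ to which no set of $\mathcal S\setminus\mathcal L$ can be added keeping laminarity. All laminar families considered contain all singletons $\{v\}$, $v\in V$. A face-laminar pair $(F,\mathcal L)$ is a face $F$ and a laminar family $\mathcal L\subseteq\mathrm{tight}(F)$. For a face $F$ and $S\in\mathrm{tight}(F)$, $S$ is $F$-contractible if for every $e\in\delta(S)$ there are no two perfect matchings in $F$ which both contain $e$ and differ on $E(S)$. For a face-laminar pair $(F,\mathcal L)$ and $1\le\mu\le 2n$, the $(F,\mathcal L,\mu)$-contraction of $G$ is the node-weighted multigraph whose nodes are the maximal sets of cardinality at most $\mu$ in $\mathcal L$ (these partition $V$), each with node-weight equal to its cardinality, and whose edges are the edges $e\in\mathrm{supp}(F)\setminus\bigcup_{T\in\mathcal L,|T|>\mu}\delta(T)$ not lying inside a single node, each joining the nodes containing its endpoints. A cyclic walk $C=(e_0,\dots,e_{k-1})$ of even length $k\ge 2$ (in a graph or multigraph) has alternating indicator vector $\chi_C=\sum_{i=0}^{k-1}(-1)^i\mathbf 1_{e_i}$;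 $C$ is an alternating circuit if $\chi_C\neq0$. In a node-weighted multigraph, the node-weight of $C$ is the sum of node-weights of the visited vertices counted with multiplicity (i.e. $\sum_{i}$ of the node-weight of the tail of $e_i$). A face-laminar pair $(F,\mathcal L)$ is $\mu$-good ($1\le\mu\le2n$) if $\mathcal L$ is a maximal laminar subset of $\mathrm{tight}(F)$ and (i) each $S\in\mathcal L$ with $|S|\le\mu$ is $F$-contractible, and (ii) the $(F,\mathcal L,\mu)$-contraction of $G$ contains no alternating circuit of node-weight at most $\mu$. *)

theory Defs
  imports Complex_Main "HOL-Library.Indicator_Function"
begin

text \<open>Edges are two-element sets of vertices. A vector in $\mathbb{R}^E$ is a function on all
  sets that vanishes outside \<open>E\<close>.\<close>

definition simple_graph :: "'a set \<Rightarrow> 'a set set \<Rightarrow> bool" where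
  "simple_graph V E \<longleftrightarrow> finite V \<and> (\<forall>e\<in>E. e \<subseteq> V \<and> card e = 2)"

definition cut :: "'a set set \<Rightarrow> 'a set \<Rightarrow> 'a set set" where
  "cut E S = {e \<in> E. card (e \<inter> S) = 1}"

definition edges_within :: "'a set set \<Rightarrow> 'a set \<Rightarrow> 'a set set" where
  "edges_within E S = {e \<in> E. e \<subseteq> S}"

subsection \<open>The perfect matching polytope and its faces\<close>

definition odd_sets :: "'a set \<Rightarrow> 'a set set" where
  "odd_sets V = {S. S \<subseteq> V \<and> odd (card S)}"

definition pm_polytope :: "'a set \<Rightarrow> 'a set set \<Rightarrow> ('a set \<Rightarrow> real) set" where
  "pm_polytope V E = {x. (\<forall>e. e \<notin> E \<longrightarrow> x e = 0)
      \<and> (\<forall>v\<in>V. sum x (cut E {v}) = 1)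
      \<and> (\<forall>S\<in>odd_sets V. sum x (cut E S) \<ge> 1)
      \<and> (\<forall>e\<in>E. x e \<ge> 0)}"

definition pm_face :: "'a set \<Rightarrow> 'a set set \<Rightarrow> ('a set \<Rightarrow> real) set \<Rightarrow> bool" where
  "pm_face V E F \<longleftrightarrow> F \<noteq> {} \<and>
     (\<exists>A \<subseteq> odd_sets V. \<exists>B \<subseteq> E.
        F = {x \<in> pm_polytope V E. (\<forall>S\<in>A. sum x (cut E S) = 1) \<and> (\<forall>e\<in>B. x e = 0)})"

definition perfect_matching :: "'a set \<Rightarrow> 'a set set \<Rightarrow> 'a set set \<Rightarrow> bool" where
  "perfect_matching V E M \<longleftrightarrow> M \<subseteq> E \<and> (\<forall>v\<in>V. \<exists>!e. e \<in> M \<and> v \<in> e)"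

definition matchings_in_face ::
  "'a set \<Rightarrow> 'a set set \<Rightarrow> ('a set \<Rightarrow> real) set \<Rightarrow> 'a set set set" where
  "matchings_in_face V E F = {M. perfect_matching V E M \<and> indicator M \<in> F}"

definition face_supp :: "'a set set \<Rightarrow> ('a set \<Rightarrow> real) set \<Rightarrow> 'a set set" where
  "face_supp E F = {e \<in> E. \<exists>x\<in>F. x e > 0}"

definition face_tight ::
  "'a set \<Rightarrow> 'a set set \<Rightarrow> ('a set \<Rightarrow> real) set \<Rightarrow> 'a set set" where
  "face_tight V E F = {S \<in> odd_sets V. \<forall>x\<in>F. sum x (cut E S) = 1}"

definition face_Min ::
  "'a set set \<Rightarrow> ('a set \<Rightarrow> real) set \<Rightarrow> ('a set \<Rightarrow> real) \<Rightarrow> ('a set \<Rightarrow> real) set" where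
  "face_Min E F w = {x. is_arg_min (\<lambda>x. \<Sum>e\<in>E. w e * x e) (\<lambda>x. x \<in> F) x}"

subsection \<open>Weight functions\<close>

text \<open>Here \<open>num\<close> is the numbering of the edges by $1, \dots, |E|$, and \<open>n\<close> the number of
  vertices. Values of weight functions outside \<open>E\<close> are irrelevant.\<close>

definition weights_upto :: "nat \<Rightarrow> ('a set \<Rightarrow> nat) \<Rightarrow> nat \<Rightarrow> ('a set \<Rightarrow> int) set" where
  "weights_upto n num t = (\<lambda>k e. int ((4 * n\<^sup>2 + 1) ^ num e mod k)) ` {2..t}"

definition weights :: "nat \<Rightarrow> ('a set \<Rightarrow> nat) \<Rightarrow> ('a set \<Rightarrow> int) set" where
  "weights n num = weights_upto n num (n ^ 20)"

definition weight_comp ::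
  "nat \<Rightarrow> ('a set \<Rightarrow> int) \<Rightarrow> ('a set \<Rightarrow> int) \<Rightarrow> 'a set \<Rightarrow> int" where
  "weight_comp n w w' = (\<lambda>e. int n ^ 21 * w e + w' e)"

definition weights_pow :: "nat \<Rightarrow> ('a set \<Rightarrow> nat) \<Rightarrow> nat \<Rightarrow> ('a set \<Rightarrow> int) set" where
  "weights_pow n num k = {foldl (weight_comp n) w ws | w ws.
      w \<in> weights n num \<and> set ws \<subseteq> weights n num \<and> Suc (length ws) = k}"

subsection \<open>Laminar families\<close>

definition crossing :: "'a set \<Rightarrow> 'a set \<Rightarrow> bool" where
  "crossing S T \<longleftrightarrow> S \<inter> T \<noteq> {} \<and> S - T \<noteq> {} \<and> T - S \<noteq> {}"

definition laminar :: "'a set set \<Rightarrow> bool" where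
  "laminar L \<longleftrightarrow> (\<forall>S\<in>L. \<forall>T\<in>L. \<not> crossing S T)"

definition maximal_laminar_subset :: "'a set set \<Rightarrow> 'a set set \<Rightarrow> bool" where
  "maximal_laminar_subset \<S> L \<longleftrightarrow>
     L \<subseteq> \<S> \<and> laminar L \<and> (\<forall>S \<in> \<S> - L. \<not> laminar (insert S L))"

definition face_laminar_pair ::
  "'a set \<Rightarrow> 'a set set \<Rightarrow> ('a set \<Rightarrow> real) set \<Rightarrow> 'a set set \<Rightarrow> bool" where
  "face_laminar_pair V E F L \<longleftrightarrow>
     pm_face V E F \<and> laminar L \<and> (\<forall>v\<in>V. {v} \<in> L) \<and> L \<subseteq> face_tight V E F"

definition contractible ::
  "'a set \<Rightarrow> 'a set set \<Rightarrow> ('a set \<Rightarrow> real) set \<Rightarrow> 'a set \<Rightarrow> bool" where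
  "contractible V E F S \<longleftrightarrow> S \<in> face_tight V E F \<and>
     (\<forall>e \<in> cut E S. \<not> (\<exists>M \<in> matchings_in_face V E F. \<exists>N \<in> matchings_in_face V E F.
        e \<in> M \<and> e \<in> N \<and> M \<inter> edges_within E S \<noteq> N \<inter> edges_within E S))"

subsection \<open>Node-weighted multigraphs and alternating circuits\<close>

record ('n, 'e) nw_multigraph =
  mg_nodes :: "'n set"
  mg_edges :: "'e set"
  mg_ends :: "'e \<Rightarrow> 'n set"
  mg_weight :: "'n \<Rightarrow> nat"

text \<open>A cyclic walk is given by its edges \<open>es\<close> together with its visited nodes \<open>vs\<close>, where
  \<open>vs ! i\<close> is the tail of \<open>es ! i\<close>; nodes and edges may repeat.\<close>

definition cyclic_walk :: "('n, 'e) nw_multigraph \<Rightarrow> 'n list \<Rightarrow> 'e list \<Rightarrow> bool" where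
  "cyclic_walk H vs es \<longleftrightarrow> length vs = length es \<and> set vs \<subseteq> mg_nodes H \<and> set es \<subseteq> mg_edges H \<and>
     (\<forall>i < length es. mg_ends H (es ! i) = {vs ! i, vs ! (Suc i mod length es)})"

definition alt_indicator :: "'e list \<Rightarrow> 'e \<Rightarrow> real" where
  "alt_indicator es = (\<lambda>e. \<Sum>i < length es. (-1) ^ i * indicator {es ! i} e)"

definition alternating_circuit ::
  "('n, 'e) nw_multigraph \<Rightarrow> 'n list \<Rightarrow> 'e list \<Rightarrow> bool" where
  "alternating_circuit H vs es \<longleftrightarrow>
     cyclic_walk H vs es \<and> even (length es) \<and> length es \<ge> 2 \<and> alt_indicator es \<noteq> (\<lambda>_. 0)"

definition walk_node_weight :: "('n, 'e) nw_multigraph \<Rightarrow> 'n list \<Rightarrow> nat" where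
  "walk_node_weight H vs = (\<Sum>v\<leftarrow>vs. mg_weight H v)"

subsection \<open>Contractions and good face-laminar pairs\<close>

definition contraction_nodes :: "'a set set \<Rightarrow> real \<Rightarrow> 'a set set" where
  "contraction_nodes L \<mu> =
     {S \<in> L. real (card S) \<le> \<mu> \<and> (\<forall>T\<in>L. real (card T) \<le> \<mu> \<longrightarrow> \<not> S \<subset> T)}"

definition contraction ::
  "'a set set \<Rightarrow> ('a set \<Rightarrow> real) set \<Rightarrow> 'a set set \<Rightarrow> real \<Rightarrow> ('a set, 'a set) nw_multigraph" where
  "contraction E F L \<mu> =
     \<lparr> mg_nodes = contraction_nodes L \<mu>,
       mg_edges = {e \<in> face_supp E F - (\<Union>T \<in> {T \<in> L. real (card T) > \<mu>}. cut E T).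
                     \<not> (\<exists>S \<in> contraction_nodes L \<mu>. e \<subseteq> S)},
       mg_ends = (\<lambda>e. {S \<in> contraction_nodes L \<mu>. e \<inter> S \<noteq> {}}),
       mg_weight = card \<rparr>"

definition good_pair ::
  "'a set \<Rightarrow> 'a set set \<Rightarrow> real \<Rightarrow> ('a set \<Rightarrow> real) set \<Rightarrow> 'a set set \<Rightarrow> bool" where
  "good_pair V E \<mu> F L \<longleftrightarrow>
     1 \<le> \<mu> \<and> \<mu> \<le> 2 * real (card V) \<and>
     face_laminar_pair V E F L \<and>
     maximal_laminar_subset (face_tight V E F) L \<and>
     (\<forall>S\<in>L. real (card S) \<le> \<mu> \<longrightarrow> contractible V E F S) \<and>
     \<not> (\<exists>vs es. alternating_circuit (contraction E F L \<mu>) vs es \<and>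
                 real (walk_node_weight (contraction E F L \<mu>) vs) \<le> \<mu>)"

end

theory Submission
  imports Defs
begin

text \<open>
  By Edmonds' theorem a face of the perfect matching polytope is determined by its perfect
  matchings. A vector that vanishes off the support of a face and has zero sum on the cut of every
  tight set (\<open>face_dir\<close>) is orthogonal to every weight function that is constant on the face. Hence
  minimising a weight function with nonzero product with finitely many given integer vectors
  removes all of them from the direction space, and one weight function modulo a small number does
  this for polynomially many vectors.

  An alternating circuit of the contraction lifts to such a vector by adding, at each visited node,
  the difference of the two matchings of the node forced by contractibility. If there is no
  circuit of node-weight at most \<open>l\<close>, a circuit of node-weight at most \<open>2 * l\<close> is determined by
  at most seven of its edges, so there are only polynomially many vectors. One round thus removes
  the circuits of the \<open>l\<close>-contraction. The sets of \<open>L\<close> of cardinality in \<open>(l, 2 * l]\<close> inside a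
  given one form a chain; after the first round a matching between consecutive members is
  determined by its two boundary edges, and each further round doubles the length of the intervals
  of the chain for which this holds, so that logarithmically many rounds make all these sets
  contractible. The last round removes the circuits of the \<open>2 * l\<close>-contraction. Sets that become
  tight only then are handled by expanding circuits of the final contraction to circuits of the
  contraction by the old family, with the same lift.
\<close>

section \<open>Perfect matchings in fractional perfect matchings\<close>

text \<open>The alternating vector of a circuit in the contraction is in general not a direction of
  the face; it has to be completed inside the visited nodes. Contractibility makes the completion
  independent of the matchings chosen for it, and the completion is linear in the alternating
  vector, so circuits need to be counted only up to that vector. Everything then turns on membership
  in a direction space: after the last round a short circuit for the new pair would give the same
  vector as an old circuit, and this vector would be both inside and outside that space. The
  constants: each of the seven recorded edges carries a direction and a parity, and the resulting
  number of vectors is at most \<open>n ^ 16\<close>. Their base \<open>4 * n ^ 2 + 1\<close>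
  expansions have about \<open>n ^ 3\<close> bits, so the product of all of them has about
  \<open>n ^ 19\<close> bits, too few to be divisible by all moduli up to \<open>n ^ 20\<close>. The
  chains consist of sets of odd cardinality at least 3 and so have fewer than \<open>n / 2\<close>
  members; this saves one doubling, which leaves room for the first and the last round within
  \<open>log_2 n + 1\<close> weight functions.\<close>

definition mcut :: "'e set \<Rightarrow> ('e \<Rightarrow> 'v set) \<Rightarrow> 'v set \<Rightarrow> 'e set" where
  "mcut E en S = {e \<in> E. card (en e \<inter> S) = 1}"

text \<open>Merging a set, as in the induction behind \<open>edmonds\<close>, creates parallel
  edges. Edges are therefore abstract, and merging changes only their end point map.\<close>

definition multigraph :: "'v set \<Rightarrow> 'e set \<Rightarrow> ('e \<Rightarrow> 'v set) \<Rightarrow> bool" where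
  "multigraph V E en \<longleftrightarrow> finite V \<and> finite E \<and> (\<forall>e\<in>E. en e \<subseteq> V \<and> card (en e) = 2)"

definition frac_pm :: "'v set \<Rightarrow> 'e set \<Rightarrow> ('e \<Rightarrow> 'v set) \<Rightarrow> ('e \<Rightarrow> real) \<Rightarrow> bool" where
  "frac_pm V E en x \<longleftrightarrow> (\<forall>v\<in>V. sum x (mcut E en {v}) = 1) \<and>
     (\<forall>S\<subseteq>V. odd (card S) \<longrightarrow> 1 \<le> sum x (mcut E en S)) \<and> (\<forall>e\<in>E. 0 \<le> x e)"

text \<open>For a fractional perfect matching \<open>x\<close> the singletons are tight, so a
  conforming set is a perfect matching whose indicator lies in the smallest face containing
  \<open>x\<close>.\<close>

definition conform :: "'v set \<Rightarrow> 'e set \<Rightarrow> ('e \<Rightarrow> 'v set) \<Rightarrow> ('e \<Rightarrow> real) \<Rightarrow> 'e set \<Rightarrow> bool" where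
  "conform V E en x N \<longleftrightarrow> N \<subseteq> {e \<in> E. 0 < x e} \<and>
     (\<forall>S\<subseteq>V. odd (card S) \<longrightarrow> sum x (mcut E en S) = 1 \<longrightarrow> card (N \<inter> mcut E en S) = 1)"

section \<open>Cut sums and uncrossing of tight odd sets\<close>

lemma finite_mcut [simp]: "finite E \<Longrightarrow> finite (mcut E en S)"
  by (simp add: mcut_def)

lemma sum_mcut:
  "finite E \<Longrightarrow> sum x (mcut E en S) = (\<Sum>e\<in>E. if card (en e \<inter> S) = 1 then x e else 0)"
  by (simp add: mcut_def sum.inter_filter)

lemma card_eq_2E:
  assumes "card D = 2" obtains a b where "D = {a, b}" "a \<noteq> b"
  using assms by (auto simp: card_2_iff)

lemma card_pair_Int: "a \<noteq> b \<Longrightarrow> card ({a, b} \<inter> S) = of_bool (a \<in> S) + of_bool (b \<in> S)"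
  by (cases "a \<in> S"; cases "b \<in> S") (auto simp: Int_insert_left)

lemma sum_mcut_uncross_Int:
  fixes x :: "'e \<Rightarrow> real"
  assumes "finite E" "\<forall>e\<in>E. card (en e) = 2"
  shows "sum x (mcut E en S) + sum x (mcut E en T) =
    sum x (mcut E en (S \<inter> T)) + sum x (mcut E en (S \<union> T)) +
    2 * sum x {e\<in>E. en e \<inter> (S - T) \<noteq> {} \<and> en e \<inter> (T - S) \<noteq> {}}"
proof -
  have "(if card (en e \<inter> S) = 1 then x e else 0) + (if card (en e \<inter> T) = 1 then x e else 0) =
    (if card (en e \<inter> (S \<inter> T)) = 1 then x e else 0) + (if card (en e \<inter> (S \<union> T)) = 1 then x e else 0) +
    2 * (if en e \<inter> (S - T) \<noteq> {} \<and> en e \<inter> (T - S) \<noteq> {} then x e else 0)" if e: "e \<in> E" for e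
  proof -
    obtain a b where ab: "en e = {a, b}" "a \<noteq> b"
      using bspec[OF assms(2) e] by (rule card_eq_2E)
    show ?thesis
      unfolding ab(1) card_pair_Int[OF ab(2)]
      by (cases "a \<in> S"; cases "a \<in> T"; cases "b \<in> S"; cases "b \<in> T") auto
  qed
  then show ?thesis
    using assms(1) by (simp add: sum_mcut sum.inter_filter sum.distrib[symmetric] sum_distrib_left
        cong: sum.cong)
qed

lemma sum_mcut_uncross_Diff:
  fixes x :: "'e \<Rightarrow> real"
  assumes "finite E" "\<forall>e\<in>E. card (en e) = 2"
  shows "sum x (mcut E en S) + sum x (mcut E en T) =
    sum x (mcut E en (S - T)) + sum x (mcut E en (T - S)) +
    2 * sum x {e\<in>E. en e \<inter> (S \<inter> T) \<noteq> {} \<and> en e - (S \<union> T) \<noteq> {}}"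
proof -
  have "(if card (en e \<inter> S) = 1 then x e else 0) + (if card (en e \<inter> T) = 1 then x e else 0) =
    (if card (en e \<inter> (S - T)) = 1 then x e else 0) + (if card (en e \<inter> (T - S)) = 1 then x e else 0) +
    2 * (if en e \<inter> (S \<inter> T) \<noteq> {} \<and> en e - (S \<union> T) \<noteq> {} then x e else 0)" if e: "e \<in> E" for e
  proof -
    obtain a b where ab: "en e = {a, b}" "a \<noteq> b"
      using bspec[OF assms(2) e] by (rule card_eq_2E)
    show ?thesis
      unfolding ab(1) card_pair_Int[OF ab(2)]
      by (cases "a \<in> S"; cases "a \<in> T"; cases "b \<in> S"; cases "b \<in> T") auto
  qed
  then show ?thesis
    using assms(1) by (simp add: sum_mcut sum.inter_filter sum.distrib[symmetric] sum_distrib_left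
        cong: sum.cong)
qed

lemma sum_degrees:
  fixes x :: "'e \<Rightarrow> real"
  assumes "finite E" "\<forall>e\<in>E. card (en e) = 2" "finite D"
  shows "(\<Sum>v\<in>D. sum x (mcut E en {v})) = sum x (mcut E en D) + 2 * sum x {e\<in>E. en e \<subseteq> D}"
proof -
  have eq: "(\<Sum>v\<in>D. if card (en e \<inter> {v}) = 1 then x e else 0) =
    (if card (en e \<inter> D) = 1 then x e else 0) + 2 * (if en e \<subseteq> D then x e else 0)" if e: "e \<in> E" for e
  proof -
    obtain a b where ab: "en e = {a, b}" "a \<noteq> b"
      using bspec[OF assms(2) e] by (rule card_eq_2E)
    have "(\<Sum>v\<in>D. if card (en e \<inter> {v}) = 1 then x e else 0) =
      (\<Sum>v\<in>D. (if v = a then x e else 0) + (if v = b then x e else 0))"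
      unfolding ab(1) card_pair_Int[OF ab(2)] using ab(2) by (intro sum.cong) auto
    also have "\<dots> = (if a \<in> D then x e else 0) + (if b \<in> D then x e else 0)"
      using assms(3) by (simp add: sum.distrib)
    finally show ?thesis
      unfolding ab(1) card_pair_Int[OF ab(2)] by auto
  qed
  have "(\<Sum>v\<in>D. sum x (mcut E en {v})) = (\<Sum>e\<in>E. \<Sum>v\<in>D. if card (en e \<inter> {v}) = 1 then x e else 0)"
    using assms(1) by (simp only: sum_mcut) (rule sum.swap)
  also have "\<dots> = (\<Sum>e\<in>E. (if card (en e \<inter> D) = 1 then x e else 0) + 2 * (if en e \<subseteq> D then x e else 0))"
    using eq by (intro sum.cong) auto
  finally show ?thesis
    using assms(1) by (simp add: sum_mcut sum.inter_filter sum.distrib sum_distrib_left)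
qed

lemma card_Int_mcut: "finite E \<Longrightarrow> real (card (N \<inter> mcut E en S)) = sum (indicator N) (mcut E en S)"
  by (simp add: indicator_def of_bool_def sum.If_cases Int_commute)

lemma odd_Int_or_Diff:
  assumes "finite S" "finite T" "odd (card S)" "odd (card T)"
  shows "odd (card (S \<inter> T)) \<and> odd (card (S \<union> T)) \<or> odd (card (S - T)) \<and> odd (card (T - S))"
proof -
  have "card (S \<union> T) + card (S \<inter> T) = card S + card T"
    using assms card_Un_Int by metis
  moreover have "card (S - T) + card (S \<inter> T) = card S"
    using assms by (metis card_Diff_subset_Int card_mono diff_add finite_Int inf_le1)
  moreover have "card (T - S) + card (S \<inter> T) = card T"
    using assms by (metis card_Diff_subset_Int card_mono diff_add finite_Int inf_le1 inf_commute)
  ultimately show ?thesis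
    using assms(3,4) by presburger
qed

text \<open>By parity one of the two pairs consists of odd sets. Its cut sums are at least 1 and add
  up to at most 2, so both are 1 and the error term of the uncrossing identity vanishes for
  \<open>x\<close>, hence for every \<open>z\<close> that vanishes where \<open>x\<close> does. The
  general \<open>z\<close> allows the identity to be applied to indicators of edge sets and to
  directions of a face.\<close>

lemma uncross:
  fixes x :: "'e \<Rightarrow> real"
  assumes G: "multigraph V E en" and x: "frac_pm V E en x"
    and S: "S \<subseteq> V" "odd (card S)" "sum x (mcut E en S) = 1"
    and T: "T \<subseteq> V" "odd (card T)" "sum x (mcut E en T) = 1"
  obtains A B where "(A = S \<inter> T \<and> B = S \<union> T) \<or> (A = S - T \<and> B = T - S)"
    "odd (card A)" "odd (card B)" "sum x (mcut E en A) = 1" "sum x (mcut E en B) = 1"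
    "\<And>z :: 'e \<Rightarrow> real. (\<forall>e\<in>E. x e = 0 \<longrightarrow> z e = 0) \<Longrightarrow>
      sum z (mcut E en S) + sum z (mcut E en T) = sum z (mcut E en A) + sum z (mcut E en B)"
proof -
  have fin: "finite V" "finite E" "\<forall>e\<in>E. card (en e) = 2"
    using G by (auto simp: multigraph_def)
  note result = that
  have main: thesis if AB: "(A = S \<inter> T \<and> B = S \<union> T) \<or> (A = S - T \<and> B = T - S)"
    and odd: "odd (card A)" "odd (card B)"
    and id: "\<And>z :: 'e \<Rightarrow> real. sum z (mcut E en S) + sum z (mcut E en T) =
      sum z (mcut E en A) + sum z (mcut E en B) + 2 * sum z W" and W: "W \<subseteq> E" for A B W
  proof -
    have sub: "A \<subseteq> V" "B \<subseteq> V" using AB S T by auto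
    have nn: "\<And>e. e \<in> W \<Longrightarrow> 0 \<le> x e" using x W by (auto simp: frac_pm_def)
    have fW: "finite W" using W fin finite_subset by blast
    have ge: "1 \<le> sum x (mcut E en A)" "1 \<le> sum x (mcut E en B)" "0 \<le> sum x W"
      using x sub odd nn by (auto simp: frac_pm_def intro: sum_nonneg)
    then have eq: "sum x (mcut E en A) = 1" "sum x (mcut E en B) = 1" "sum x W = 0"
      using id[of x] S T by linarith+
    have "\<forall>e\<in>W. x e = 0" using eq(3) nn fW by (simp add: sum_nonneg_eq_0_iff)
    then have "sum z W = 0" if "\<forall>e\<in>E. x e = 0 \<longrightarrow> z e = 0" for z :: "'e \<Rightarrow> real"
      using that W by (intro sum.neutral) auto
    then show thesis using result[OF AB odd eq(1,2)] id by simp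
  qed
  have "finite S" "finite T" using S T fin finite_subset by auto
  from odd_Int_or_Diff[OF this S(2) T(2)] show thesis
  proof (elim disjE conjE)
    assume "odd (card (S \<inter> T))" "odd (card (S \<union> T))"
    then show thesis using main[OF _ _ _ sum_mcut_uncross_Int[OF fin(2,3)]] by blast
  next
    assume "odd (card (S - T))" "odd (card (T - S))"
    then show thesis using main[OF _ _ _ sum_mcut_uncross_Diff[OF fin(2,3)]] by blast
  qed
qed

text \<open>The set \<open>S\<close> is contracted to its representative \<open>s\<close>; edges inside \<open>S\<close> are dropped.\<close>

definition merge :: "'v set \<Rightarrow> 'v \<Rightarrow> 'v \<Rightarrow> 'v" where
  "merge S s v = (if v \<in> S then s else v)"

section \<open>Contracting a tight set and gluing the two sides\<close>

lemma merge_edge: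
  assumes "card D = 2" "\<not> D \<subseteq> S" "s \<in> S"
  shows "card (merge S s ` D) = 2"
    and "T \<inter> S = {} \<Longrightarrow> card (merge S s ` D \<inter> T) = card (D \<inter> T)"
    and "T \<inter> S = {} \<Longrightarrow> card (merge S s ` D \<inter> insert s T) = card (D \<inter> (S \<union> T))"
proof -
  obtain a b where ab: "D = {a, b}" "a \<noteq> b"
    using assms(1) by (rule card_eq_2E)
  have im: "merge S s ` D = {merge S s a, merge S s b}" and ne: "merge S s a \<noteq> merge S s b"
    using ab assms by (auto simp: merge_def)
  show "card (merge S s ` D) = 2" using im ne by simp
  show "T \<inter> S = {} \<Longrightarrow> card (merge S s ` D \<inter> T) = card (D \<inter> T)"
    unfolding im card_pair_Int[OF ne] unfolding ab(1) card_pair_Int[OF ab(2)]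
    using assms(3) by (auto simp: merge_def)
  show "T \<inter> S = {} \<Longrightarrow> card (merge S s ` D \<inter> insert s T) = card (D \<inter> (S \<union> T))"
    unfolding im card_pair_Int[OF ne] unfolding ab(1) card_pair_Int[OF ab(2)]
    using assms(3) by (auto simp: merge_def)
qed

lemma mcut_merge:
  assumes G: "multigraph V E en" and s: "s \<in> S" and T: "T \<inter> S = {}"
  shows "mcut {e\<in>E. \<not> en e \<subseteq> S} (\<lambda>e. merge S s ` en e) T = mcut E en T"
    and "mcut {e\<in>E. \<not> en e \<subseteq> S} (\<lambda>e. merge S s ` en e) (insert s T) = mcut E en (S \<union> T)"
proof -
  have c: "\<And>e. e \<in> E \<Longrightarrow> card (en e) = 2" using G by (auto simp: multigraph_def)
  have in1: "card (en e \<inter> T) \<noteq> 1" if "en e \<subseteq> S" for e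
  proof -
    have "en e \<inter> T = {}" using that T by auto
    then show ?thesis by simp
  qed
  have in2: "card (en e \<inter> (S \<union> T)) \<noteq> 1" if "en e \<subseteq> S" "e \<in> E" for e
  proof -
    have "en e \<inter> (S \<union> T) = en e" using that by auto
    then show ?thesis using c[OF that(2)] by simp
  qed
  show "mcut {e\<in>E. \<not> en e \<subseteq> S} (\<lambda>e. merge S s ` en e) T = mcut E en T"
  proof (intro set_eqI)
    fix e show "e \<in> mcut {e\<in>E. \<not> en e \<subseteq> S} (\<lambda>e. merge S s ` en e) T \<longleftrightarrow> e \<in> mcut E en T"
      using merge_edge(2)[OF c _ s T, of e] in1[of e]
      by (cases "e \<in> E"; cases "en e \<subseteq> S") (simp_all add: mcut_def)
  qed
  show "mcut {e\<in>E. \<not> en e \<subseteq> S} (\<lambda>e. merge S s ` en e) (insert s T) = mcut E en (S \<union> T)"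
  proof (intro set_eqI)
    fix e show "e \<in> mcut {e\<in>E. \<not> en e \<subseteq> S} (\<lambda>e. merge S s ` en e) (insert s T)
        \<longleftrightarrow> e \<in> mcut E en (S \<union> T)"
      using merge_edge(3)[OF c _ s T, of e] in2[of e]
      by (cases "e \<in> E"; cases "en e \<subseteq> S") (simp_all add: mcut_def)
  qed
qed

lemma multigraph_merge:
  assumes G: "multigraph V E en" and s: "s \<in> S" and S: "S \<subseteq> V"
  shows "multigraph (insert s (V - S)) {e\<in>E. \<not> en e \<subseteq> S} (\<lambda>e. merge S s ` en e)"
  using G merge_edge(1)[OF _ _ s] s by (auto simp: multigraph_def merge_def)

text \<open>An odd set of the merged graph stands for a subset of \<open>V\<close> that avoids
  \<open>S\<close> or contains it. Since \<open>S\<close> is odd, replacing \<open>s\<close> by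
  \<open>S\<close> preserves parity.\<close>

lemma frac_pm_merge:
  assumes G: "multigraph V E en" and s: "s \<in> S" and S: "S \<subseteq> V" "odd (card S)"
    and x: "frac_pm V E en x" and t: "sum x (mcut E en S) = 1"
  shows "frac_pm (insert s (V - S)) {e\<in>E. \<not> en e \<subseteq> S} (\<lambda>e. merge S s ` en e) x"
  unfolding frac_pm_def
proof (intro conjI ballI allI impI)
  fix v assume v: "v \<in> insert s (V - S)"
  show "sum x (mcut {e\<in>E. \<not> en e \<subseteq> S} (\<lambda>e. merge S s ` en e) {v}) = 1"
  proof (cases "v = s")
    case True
    then show ?thesis using mcut_merge(2)[OF G s, of "{}"] t by simp
  next
    case False
    then show ?thesis using mcut_merge(1)[OF G s, of "{v}"] v x by (auto simp: frac_pm_def)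
  qed
next
  fix T assume T: "T \<subseteq> insert s (V - S)" "odd (card T)"
  have fV: "finite V" "finite S" "finite T"
    using G S T(1) finite_subset[of S V] finite_subset[of T "insert s (V - S)"]
    by (auto simp: multigraph_def)
  show "1 \<le> sum x (mcut {e\<in>E. \<not> en e \<subseteq> S} (\<lambda>e. merge S s ` en e) T)"
  proof (cases "s \<in> T")
    case True
    define R where "R = T - {s}"
    have R: "T = insert s R" "R \<inter> S = {}" "R \<subseteq> V" "s \<notin> R" using T(1) True s by (auto simp: R_def)
    have "card (S \<union> R) = card S + card R"
      using R fV by (intro card_Un_disjoint) auto
    moreover have "card T = Suc (card R)" using R fV by (metis card_insert_disjoint finite_insert)
    ultimately have "odd (card (S \<union> R))" using S(2) T(2) by presburger
    then show ?thesis using mcut_merge(2)[OF G s R(2)] x R S by (simp add: frac_pm_def)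
  next
    case False
    then have "T \<inter> S = {}" "T \<subseteq> V" using T(1) s by auto
    then show ?thesis using mcut_merge(1)[OF G s] x T by (simp add: frac_pm_def)
  qed
next
  fix e assume "e \<in> {e\<in>E. \<not> en e \<subseteq> S}"
  then show "0 \<le> x e" using x by (simp add: frac_pm_def)
qed

lemma conform_merge:
  assumes G: "multigraph V E en" and s: "s \<in> S" and S: "S \<subseteq> V" "odd (card S)"
    and N: "conform (insert s (V - S)) {e\<in>E. \<not> en e \<subseteq> S} (\<lambda>e. merge S s ` en e) x N"
    and T: "T \<subseteq> V" "odd (card T)" "sum x (mcut E en T) = 1" "T \<inter> S = {} \<or> S \<subseteq> T"
  shows "card (N \<inter> mcut E en T) = 1"
proof -
  let ?cut = "mcut {e\<in>E. \<not> en e \<subseteq> S} (\<lambda>e. merge S s ` en e)"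
  have N': "card (N \<inter> ?cut R) = 1" if "R \<subseteq> insert s (V - S)" "odd (card R)" "sum x (?cut R) = 1" for R
    using N that by (simp add: conform_def)
  show ?thesis
  proof (cases "T \<inter> S = {}")
    case True
    then show ?thesis using N'[of T] T mcut_merge(1)[OF G s True] by fastforce
  next
    case False
    define R where "R = T - S"
    have R: "T = S \<union> R" "R \<inter> S = {}" "R \<subseteq> V - S" using T False by (auto simp: R_def)
    have fV: "finite S" "finite R" using G S R(3) finite_subset[of S V] finite_subset[of R "V - S"]
      by (auto simp: multigraph_def)
    have "card T = card S + card R" using R fV by (metis card_Un_disjoint inf_commute)
    moreover have "card (insert s R) = Suc (card R)" using fV s R by (intro card_insert_disjoint) auto
    ultimately have "odd (card (insert s R))" using S(2) T(2) by presburger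
    moreover have "insert s R \<subseteq> insert s (V - S)" using R(3) by blast
    ultimately show ?thesis
      using N'[of "insert s R"] T(3) unfolding mcut_merge(2)[OF G s R(2)] R(1)[symmetric] by blast
  qed
qed

text \<open>\<open>N1\<close> conforms after \<open>S\<close> is contracted and \<open>N2\<close>
  after its complement is contracted; they share the single edge \<open>f\<close> across the cut. A
  tight set inside \<open>S\<close> is seen by \<open>N2\<close>, one that avoids or contains
  \<open>S\<close> by \<open>N1\<close>. Any other tight set \<open>T\<close> is uncrossed with
  \<open>S\<close> into one set of each kind, and since the cuts of \<open>S\<close>,
  \<open>A\<close> and \<open>B\<close> contain one edge each, so does that of
  \<open>T\<close>.\<close>

lemma conform_glue:
  fixes x :: "'e \<Rightarrow> real"
  assumes G: "multigraph V E en" and x: "frac_pm V E en x"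
    and S: "S \<subseteq> V" "odd (card S)" "odd (card (V - S))" "sum x (mcut E en S) = 1"
    and s: "s \<in> S" and r: "r \<in> V - S"
    and N1: "conform (insert s (V - S)) {e\<in>E. \<not> en e \<subseteq> S} (\<lambda>e. merge S s ` en e) x N1"
    and N2: "conform (insert r (V - (V - S))) {e\<in>E. \<not> en e \<subseteq> V - S} (\<lambda>e. merge (V - S) r ` en e) x N2"
    and f: "f \<in> N1" "f \<in> N2" "f \<in> mcut E en S"
  shows "conform V E en x (N1 \<union> N2)"
proof -
  have fin: "finite V" "finite E" "\<And>e. e \<in> E \<Longrightarrow> card (en e) = 2" "\<And>e. e \<in> E \<Longrightarrow> en e \<subseteq> V"
    using G by (auto simp: multigraph_def)
  have SS: "V - S \<subseteq> V" by auto
  have cutS: "e \<in> mcut E en S" if e: "e \<in> E" "\<not> en e \<subseteq> S" "\<not> en e \<subseteq> V - S" for e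
  proof -
    obtain a b where ab: "en e = {a, b}" "a \<noteq> b"
      using fin(3)[OF e(1)] by (rule card_eq_2E)
    show ?thesis using e fin(4)[OF e(1)] unfolding mcut_def mem_Collect_eq ab(1) card_pair_Int[OF ab(2)] by auto
  qed
  have u1: "N1 \<inter> mcut E en S = {f}"
  proof -
    have "card (N1 \<inter> mcut E en S) = 1" using conform_merge[OF G s S(1,2) N1 S(1,2,4)] by simp
    then obtain g where "N1 \<inter> mcut E en S = {g}" by (rule card_1_singletonE)
    then show ?thesis using f by auto
  qed
  have u2: "N2 \<inter> mcut E en S = {f}"
  proof -
    have "card (N2 \<inter> mcut E en S) = 1" using conform_merge[OF G r SS S(3) N2 S(1,2,4)] by simp
    then obtain g where "N2 \<inter> mcut E en S = {g}" by (rule card_1_singletonE)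
    then show ?thesis using f by auto
  qed
  have sub1: "N1 \<subseteq> {e\<in>E. \<not> en e \<subseteq> S}" "N1 \<subseteq> {e\<in>E. 0 < x e}" using N1 by (auto simp: conform_def)
  have sub2: "N2 \<subseteq> {e\<in>E. \<not> en e \<subseteq> V - S}" "N2 \<subseteq> {e\<in>E. 0 < x e}" using N2 by (auto simp: conform_def)
  have c1: "card ((N1 \<union> N2) \<inter> mcut E en T) = 1"
    if T: "T \<subseteq> V" "odd (card T)" "sum x (mcut E en T) = 1" "T \<inter> S = {} \<or> S \<subseteq> T" for T
  proof -
    have "e \<in> N1" if e: "e \<in> N2" "e \<in> mcut E en T" for e
    proof -
      have "\<not> en e \<subseteq> S"
      proof
        assume "en e \<subseteq> S"
        then have "en e \<inter> T = {} \<or> en e \<inter> T = en e" using T(4) by auto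
        then show False using e(2) fin(3) by (auto simp: mcut_def)
      qed
      then have "e \<in> mcut E en S" using cutS[of e] e sub2(1) by blast
      then show ?thesis using u2 e f by auto
    qed
    then have "(N1 \<union> N2) \<inter> mcut E en T = N1 \<inter> mcut E en T" by auto
    then show ?thesis using conform_merge[OF G s S(1,2) N1 T] by simp
  qed
  have c2: "card ((N1 \<union> N2) \<inter> mcut E en T) = 1"
    if T: "T \<subseteq> S" "odd (card T)" "sum x (mcut E en T) = 1" for T
  proof -
    have "e \<in> N2" if e: "e \<in> N1" "e \<in> mcut E en T" for e
    proof -
      have "\<not> en e \<subseteq> V - S"
      proof
        assume "en e \<subseteq> V - S"
        then have "en e \<inter> T = {}" using T by auto
        then show False using e(2) fin(3) by (auto simp: mcut_def)
      qed
      then have "e \<in> mcut E en S" using cutS[of e] e sub1(1) by blast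
      then show ?thesis using u1 e f by auto
    qed
    then have "(N1 \<union> N2) \<inter> mcut E en T = N2 \<inter> mcut E en T" by auto
    then show ?thesis using conform_merge[OF G r SS S(3) N2, of T] T S by auto
  qed
  have "card ((N1 \<union> N2) \<inter> mcut E en T) = 1"
    if T: "T \<subseteq> V" "odd (card T)" "sum x (mcut E en T) = 1" for T
  proof -
    obtain A B where AB: "(A = S \<inter> T \<and> B = S \<union> T) \<or> (A = S - T \<and> B = T - S)"
      "odd (card A)" "odd (card B)" "sum x (mcut E en A) = 1" "sum x (mcut E en B) = 1"
      and id: "\<And>z :: 'e \<Rightarrow> real. (\<forall>e\<in>E. x e = 0 \<longrightarrow> z e = 0) \<Longrightarrow>
      sum z (mcut E en S) + sum z (mcut E en T) = sum z (mcut E en A) + sum z (mcut E en B)"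
      by (rule uncross[OF G x S(1,2,4) T]) blast
    have A: "card ((N1 \<union> N2) \<inter> mcut E en A) = 1" using AB by (intro c2) auto
    have B: "card ((N1 \<union> N2) \<inter> mcut E en B) = 1" using AB S T by (intro c1) auto
    have S1: "card ((N1 \<union> N2) \<inter> mcut E en S) = 1" using S by (intro c2) auto
    have "\<forall>e\<in>E. x e = 0 \<longrightarrow> indicator (N1 \<union> N2) e = (0::real)"
      using sub1 sub2 by (auto simp: indicator_def)
    from id[OF this] have "real (card ((N1 \<union> N2) \<inter> mcut E en S)) + real (card ((N1 \<union> N2) \<inter> mcut E en T)) =
       real (card ((N1 \<union> N2) \<inter> mcut E en A)) + real (card ((N1 \<union> N2) \<inter> mcut E en B))"
      by (simp only: card_Int_mcut[OF fin(2)])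
    then show ?thesis using A B S1 by linarith
  qed
  then show ?thesis using sub1 sub2 by (auto simp: conform_def)
qed

section \<open>Kernel vectors and maximal steps\<close>

lemma homogeneous_system_nontrivial:
  fixes a :: "'i \<Rightarrow> 'j \<Rightarrow> real"
  assumes "finite I" "finite J" "card I < card J"
  shows "\<exists>y. (\<exists>j\<in>J. y j \<noteq> 0) \<and> (\<forall>i\<in>I. (\<Sum>j\<in>J. a i j * y j) = 0)"
  using assms
proof (induction I arbitrary: a J rule: finite_induct)
  case empty
  then have "J \<noteq> {}" by auto
  then show ?case by (intro exI[of _ "\<lambda>_. 1"]) auto
next
  case (insert i I)
  show ?case
  proof (cases "\<forall>j\<in>J. a i j = 0")
    case True
    have "card I < card J" using insert by simp
    from insert.IH[OF insert.prems(1) this, of a] True show ?thesis by auto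
  next
    case False
    then obtain k where k: "k \<in> J" "a i k \<noteq> 0" by auto
    define J' where "J' = J - {k}"
    have J': "finite J'" "k \<notin> J'" "J = insert k J'" using insert.prems k by (auto simp: J'_def)
    then have "card I < card J'" using insert by simp
    \<comment> \<open>The remaining rows after the unknown \<open>k\<close> has been eliminated with
      the pivot in row \<open>i\<close>.\<close>
    from insert.IH[OF J'(1) this, of "\<lambda>r j. a r j - a r k * a i j / a i k"]
    obtain y where y: "\<exists>j\<in>J'. y j \<noteq> 0"
      "\<And>r. r \<in> I \<Longrightarrow> (\<Sum>j\<in>J'. (a r j - a r k * a i j / a i k) * y j) = 0" by auto
    define c where "c = - (\<Sum>j\<in>J'. a i j * y j) / a i k"
    define z where "z = y(k := c)"
    have zs: "(\<Sum>j\<in>J. a r j * z j) = a r k * c + (\<Sum>j\<in>J'. a r j * y j)" for r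
    proof -
      have "(\<Sum>j\<in>J'. a r j * z j) = (\<Sum>j\<in>J'. a r j * y j)"
        using J' by (intro sum.cong) (auto simp: z_def)
      then show ?thesis using J' by (simp add: z_def)
    qed
    have "(\<Sum>j\<in>J. a i j * z j) = 0" unfolding zs c_def using k by simp
    moreover have "(\<Sum>j\<in>J. a r j * z j) = 0" if r: "r \<in> I" for r
    proof -
      have "(\<Sum>j\<in>J'. (a r j - a r k * a i j / a i k) * y j) =
        (\<Sum>j\<in>J'. a r j * y j) - (a r k / a i k) * (\<Sum>j\<in>J'. a i j * y j)"
        by (simp add: sum_subtractf left_diff_distrib sum_distrib_left mult.assoc)
      then show ?thesis unfolding zs c_def using y(2)[OF r] by simp
    qed
    moreover have "\<exists>j\<in>J. z j \<noteq> 0" using y(1) J' by (auto simp: z_def)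
    ultimately show ?thesis by (intro exI[of _ z]) auto
  qed
qed

text \<open>The ratio test: \<open>a\<close> holds the slacks of the constraints and
  \<open>b\<close> their rates of change along the chosen direction.\<close>

lemma maximal_step:
  fixes a b :: "'i \<Rightarrow> real"
  assumes "finite I" "\<And>i. i \<in> I \<Longrightarrow> 0 \<le> a i" "\<And>i. i \<in> I \<Longrightarrow> a i = 0 \<Longrightarrow> 0 \<le> b i"
    and "\<exists>i\<in>I. b i < 0"
  obtains t where "0 < t" "\<And>i. i \<in> I \<Longrightarrow> 0 \<le> a i + t * b i" "\<exists>i\<in>I. 0 < a i \<and> a i + t * b i = 0"
proof -
  define J where "J = {i\<in>I. b i < 0}"
  define t where "t = Min ((\<lambda>i. a i / (- b i)) ` J)"
  have J: "finite J" "J \<noteq> {}" using assms by (auto simp: J_def)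
  have "t \<in> (\<lambda>i. a i / (- b i)) ` J" unfolding t_def using J by (intro Min_in) auto
  then obtain i0 where i0: "i0 \<in> J" "t = a i0 / (- b i0)" by auto
  have apos: "0 < a i" if "i \<in> J" for i
    using that assms(2)[of i] assms(3)[of i] by (force simp: J_def)
  have b0: "b i0 < 0" using i0 by (simp add: J_def)
  have tpos: "0 < t" unfolding i0(2) using apos[OF i0(1)] b0 by (intro divide_pos_pos) auto
  have "0 \<le> a i + t * b i" if i: "i \<in> I" for i
  proof (cases "b i < 0")
    case True
    then have "i \<in> J" using i by (simp add: J_def)
    then have "t \<le> a i / (- b i)" unfolding t_def using J by (intro Min_le) auto
    moreover have "0 < - b i" using True by simp
    ultimately have "t * (- b i) \<le> a i" by (simp only: pos_le_divide_eq)
    then show ?thesis by simp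
  next
    case False
    then show ?thesis using assms(2)[OF i] tpos by simp
  qed
  moreover have "0 < a i0 \<and> a i0 + t * b i0 = 0"
    using apos[OF i0(1)] b0 by (simp add: i0(2))
  moreover have "i0 \<in> I" using i0 by (simp add: J_def)
  ultimately show thesis using that[OF tpos] by blast
qed


section \<open>Conforming matchings through a given edge\<close>

lemma mcut_Compl:
  assumes "multigraph V E en"
  shows "mcut E en (V - S) = mcut E en S"
proof (intro set_eqI)
  fix e
  show "e \<in> mcut E en (V - S) \<longleftrightarrow> e \<in> mcut E en S"
  proof (cases "e \<in> E")
    case True
    then have "card (en e) = 2" "en e \<subseteq> V" using assms by (auto simp: multigraph_def)
    from this(1) obtain a b where ab: "en e = {a, b}" "a \<noteq> b" by (rule card_eq_2E)
    then have V: "a \<in> V" "b \<in> V" using \<open>en e \<subseteq> V\<close> by auto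
    show ?thesis using V unfolding mcut_def mem_Collect_eq ab(1) card_pair_Int[OF ab(2)] by auto
  qed (simp add: mcut_def)
qed

lemma mem_mcut_singleton:
  assumes "multigraph V E en" "e \<in> E"
  shows "e \<in> mcut E en {v} \<longleftrightarrow> v \<in> en e"
proof -
  have "card (en e) = 2" using assms by (auto simp: multigraph_def)
  then obtain a b where ab: "en e = {a, b}" "a \<noteq> b" by (rule card_eq_2E)
  show ?thesis using assms(2) ab(2) unfolding mcut_def mem_Collect_eq ab(1) card_pair_Int[OF ab(2)] by auto
qed

lemma frac_pm_even:
  assumes G: "multigraph V E en" and x: "frac_pm V E en x"
  shows "even (card V)"
proof (rule ccontr)
  assume "odd (card V)"
  then have "1 \<le> sum x (mcut E en V)" using x by (simp add: frac_pm_def)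
  moreover have "mcut E en V = {}" using mcut_Compl[OF G, of "{}"] by (simp add: mcut_def)
  ultimately show False by simp
qed

text \<open>As \<open>card V\<close> is even, an odd set outside the range from 3 to
  \<open>card V - 3\<close> is a singleton or the complement of one.\<close>

lemma trivial_cut:
  assumes G: "multigraph V E en" and x: "frac_pm V E en x"
    and S: "S \<subseteq> V" "odd (card S)" "\<not> (3 \<le> card S \<and> card S + 3 \<le> card V)"
  obtains v where "v \<in> V" "mcut E en S = mcut E en {v}"
proof (cases "card S = 1")
  case True
  then obtain v where "S = {v}" by (auto simp: card_1_singleton_iff)
  then show thesis using that S by auto
next
  case False
  have fin: "finite V" "finite S" using G S finite_subset by (auto simp: multigraph_def)
  have le: "card S \<le> card V" using fin S by (simp add: card_mono)
  have "card (V - S) = card V - card S" using fin S by (simp add: card_Diff_subset)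
  moreover have "card S \<noteq> 2" "card S \<noteq> 0" using S(2) by (auto intro: ccontr)
  ultimately have "card (V - S) = 1" using False S(2,3) frac_pm_even[OF G x] le by presburger
  then obtain v where "V - S = {v}" by (auto simp: card_1_singleton_iff)
  then show thesis using that[of v] mcut_Compl[OF G, of S] by auto
qed

text \<open>All odd cuts are trivial here, so any perfect matching of the support conforms. With
  four vertices, comparing the degree sums of \<open>en e\<close> and of its complement shows that
  both carry the same inner weight; hence some positive edge \<open>f\<close> is disjoint from
  \<open>e\<close>.\<close>

lemma conform_two_or_four:
  assumes G: "multigraph V E en" and x: "frac_pm V E en x" and e: "e \<in> E" "0 < x e"
    and V: "card V \<le> 4"
  shows "\<exists>N. conform V E en x N \<and> e \<in> N"
proof -
  have fin: "finite V" "finite E" "\<forall>e\<in>E. card (en e) = 2" "\<And>e. e \<in> E \<Longrightarrow> en e \<subseteq> V"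
    using G by (auto simp: multigraph_def)
  have conf: "conform V E en x N"
    if N: "N \<subseteq> {e\<in>E. 0 < x e}" "\<And>v. v \<in> V \<Longrightarrow> card (N \<inter> mcut E en {v}) = 1" for N
    unfolding conform_def
  proof (intro conjI allI impI)
    fix S assume S: "S \<subseteq> V" "odd (card S)"
    have "\<not> (3 \<le> card S \<and> card S + 3 \<le> card V)" using V by auto
    then obtain v where "v \<in> V" "mcut E en S = mcut E en {v}" using trivial_cut[OF G x S] by blast
    then show "card (N \<inter> mcut E en S) = 1" using N by simp
  qed (use N in auto)
  have ce: "card (en e) = 2" "en e \<subseteq> V" using fin e by auto
  then have "card (V - en e) = card V - 2" using fin(1) finite_subset by (subst card_Diff_subset) auto
  moreover have "2 \<le> card V" using ce card_mono[OF fin(1) ce(2)] by simp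
  ultimately have "card (V - en e) = 0 \<or> card (V - en e) = 2"
    using V frac_pm_even[OF G x] by presburger
  then show ?thesis
  proof
    assume "card (V - en e) = 0"
    then have "V = en e" using fin ce by auto
    moreover have "{e} \<inter> mcut E en {v} = {e}" if "v \<in> en e" for v
      using mem_mcut_singleton[OF G e(1)] that by auto
    ultimately have "conform V E en x {e}" using e by (intro conf) auto
    then show ?thesis by auto
  next
    assume c2: "card (V - en e) = 2"
    have deg: "(\<Sum>v\<in>D. sum x (mcut E en {v})) = card D" if "D \<subseteq> V" for D
      using x that by (simp add: frac_pm_def subset_iff)
    have fD: "finite (en e)" "finite (V - en e)" using fin ce finite_subset by auto
    have "2 * sum x {g\<in>E. en g \<subseteq> en e} = 2 * sum x {g\<in>E. en g \<subseteq> V - en e}"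
      using sum_degrees[OF fin(2,3) fD(1), of x] sum_degrees[OF fin(2,3) fD(2), of x]
        deg[of "en e"] deg[of "V - en e"] ce c2 mcut_Compl[OF G, of "en e"] by auto
    moreover have "x e \<le> sum x {g\<in>E. en g \<subseteq> en e}"
      using x e fin by (intro member_le_sum) (auto simp: frac_pm_def)
    ultimately have "sum x {g\<in>E. en g \<subseteq> V - en e} > 0" using e by linarith
    then obtain f where f: "f \<in> E" "en f \<subseteq> V - en e" "0 < x f"
      by (metis (mono_tags, lifting) mem_Collect_eq not_le sum_nonpos)
    have "en f = V - en e" using f c2 fin fD by (intro card_subset_eq) auto
    then have dj: "V = en e \<union> en f" "en e \<inter> en f = {}" using ce by auto
    have "card ({e, f} \<inter> mcut E en {v}) = 1" if v: "v \<in> V" for v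
    proof -
      have "{e, f} \<inter> mcut E en {v} = (if v \<in> en e then {e} else {f})"
        using v dj mem_mcut_singleton[OF G e(1)] mem_mcut_singleton[OF G f(1)] by auto
      then show ?thesis by simp
    qed
    then have "conform V E en x {e, f}" using e f by (intro conf) auto
    then show ?thesis by auto
  qed
qed

lemma conform_integral:
  assumes G: "multigraph V E en" and x: "frac_pm V E en x" and int: "\<And>e. e \<in> E \<Longrightarrow> x e = 0 \<or> x e = 1"
  shows "conform V E en x {e\<in>E. x e = 1}"
proof -
  have *: "real (card ({e\<in>E. x e = 1} \<inter> mcut E en S)) = sum x (mcut E en S)" for S
  proof -
    have "finite E" using G by (simp add: multigraph_def)
    moreover have "sum (indicator {e\<in>E. x e = 1}) (mcut E en S) = sum x (mcut E en S)"
    proof (intro sum.cong)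
      fix e assume "e \<in> mcut E en S"
      then show "indicator {e\<in>E. x e = 1} e = x e" using int[of e] by (auto simp: mcut_def)
    qed simp
    ultimately show ?thesis by (simp add: card_Int_mcut)
  qed
  have "card ({e\<in>E. x e = 1} \<inter> mcut E en S) = 1" if "sum x (mcut E en S) = 1" for S
    using that *[of S] by simp
  then show ?thesis unfolding conform_def by auto
qed

text \<open>Without a kernel vector there are at most as many fractional edges as vertices on them. Then all
  degrees are 2 and all values are 1/2, and the vertices of a path of length 2 form a tight set.\<close>

lemma kernel_or_nontrivial_tight:
  fixes x :: "'e \<Rightarrow> real"
  assumes G: "multigraph V E en" and x: "frac_pm V E en x"
    and E': "E' = {e\<in>E. 0 < x e \<and> x e < 1}" "E' \<noteq> {}"
    and noker: "\<And>y :: 'e \<Rightarrow> real. (\<forall>e. e \<notin> E' \<longrightarrow> y e = 0) \<Longrightarrow>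
      (\<forall>v\<in>V. sum y (mcut E en {v}) = 0) \<Longrightarrow> \<forall>e. y e = 0"
  shows "\<exists>S\<subseteq>V. card S = 3 \<and> sum x (mcut E en S) = 1"
proof -
  have fin: "finite V" "finite E" "\<forall>e\<in>E. card (en e) = 2" "\<And>e. e \<in> E \<Longrightarrow> en e \<subseteq> V"
    using G by (auto simp: multigraph_def)
  have sub: "E' \<subseteq> E" "finite E'" using E' fin by auto
  have G': "multigraph V E' en" using G sub by (auto simp: multigraph_def)
  have mc: "mcut E' en S = E' \<inter> mcut E en S" for S using sub by (auto simp: mcut_def)
  define V' where "V' = {v\<in>V. \<exists>e\<in>E'. v \<in> en e}"
  have V': "V' \<subseteq> V" "finite V'" using fin by (auto simp: V'_def)
  have ksum: "sum y (mcut E en S) = sum y (mcut E' en S)" if "\<forall>e. e \<notin> E' \<longrightarrow> y e = 0" for y :: "'e \<Rightarrow> real" and S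
    using that sub fin by (intro sum.mono_neutral_right) (auto simp: mcut_def)
  have out: "mcut E' en {v} = {}" if "v \<in> V - V'" for v
    using that mem_mcut_singleton[OF G'] by (auto simp: V'_def mcut_def)
  have cle: "card E' \<le> card V'"
  proof (rule ccontr)
    assume "\<not> ?thesis"
    then have "card V' < card E'" by simp
    from homogeneous_system_nontrivial[OF V'(2) sub(2) this, of "\<lambda>v e. if e \<in> mcut E en {v} then 1 else 0"]
    obtain y :: "'e \<Rightarrow> real" where y: "\<exists>e\<in>E'. y e \<noteq> 0"
      "\<And>v. v \<in> V' \<Longrightarrow> (\<Sum>e\<in>E'. (if e \<in> mcut E en {v} then 1 else 0) * y e) = 0" by blast
    define z where "z e = (if e \<in> E' then y e else 0)" for e
    have zz: "\<forall>e. e \<notin> E' \<longrightarrow> z e = 0" by (simp add: z_def)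
    have "sum z (mcut E en {v}) = 0" if v: "v \<in> V" for v
    proof (cases "v \<in> V'")
      case True
      have "sum z (mcut E' en {v}) = (\<Sum>e\<in>E'. if e \<in> mcut E en {v} then z e else 0)"
        unfolding mc using sub by (simp add: sum.inter_restrict)
      also have "\<dots> = (\<Sum>e\<in>E'. (if e \<in> mcut E en {v} then 1 else 0) * y e)"
        by (intro sum.cong) (auto simp: z_def)
      finally show ?thesis using y(2)[OF True] ksum[OF zz] by simp
    qed (use v out ksum[OF zz] in simp)
    then have "\<forall>e. z e = 0" using noker[OF zz] by blast
    then show False using y(1) by (metis z_def)
  qed
  have xsum: "sum x (mcut E' en {v}) = 1" if v: "v \<in> V'" for v
  proof -
    obtain f where f: "f \<in> E'" "v \<in> en f" using v by (auto simp: V'_def)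
    have fm: "f \<in> mcut E en {v}" using mem_mcut_singleton[OF G] f sub by auto
    have one: "sum x (mcut E en {v}) = 1" using x v by (auto simp: frac_pm_def V'_def)
    have nn: "\<And>e. e \<in> mcut E en {v} \<Longrightarrow> 0 \<le> x e" using x by (auto simp: frac_pm_def mcut_def)
    have "x e = 0" if e: "e \<in> mcut E en {v}" "e \<notin> E'" for e
    proof (rule ccontr)
      assume "x e \<noteq> 0"
      then have "1 \<le> x e" using e nn[OF e(1)] by (auto simp: E' mcut_def)
      moreover have "sum x {e, f} \<le> sum x (mcut E en {v})"
        using e fm nn fin by (intro sum_mono2) auto
      moreover have "e \<noteq> f" using e f by auto
      ultimately show False using f one by (auto simp: E')
    qed
    then have "sum x (mcut E en {v}) = sum x (mcut E' en {v})"
      using fin by (intro sum.mono_neutral_right) (auto simp: mcut_def sub subsetD[OF sub(1)])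
    then show ?thesis using one by simp
  qed
  have deg2: "2 \<le> card (mcut E' en {v})" if v: "v \<in> V'" for v
  proof (rule ccontr)
    assume a: "\<not> ?thesis"
    have "card (mcut E' en {v}) \<noteq> 0" using xsum[OF v] sub by (auto simp: card_eq_0_iff)
    with a have "card (mcut E' en {v}) = 1" by linarith
    then obtain g where g: "mcut E' en {v} = {g}" by (auto simp: card_1_singleton_iff)
    then have "g \<in> E'" by (auto simp: mcut_def)
    then show False using xsum[OF v] g by (auto simp: E')
  qed
  have hs: "(\<Sum>v\<in>V'. real (card (mcut E' en {v}))) = 2 * real (card E')"
  proof -
    have "(\<Sum>v\<in>V'. sum (\<lambda>_. 1::real) (mcut E' en {v})) =
      sum (\<lambda>_. 1) (mcut E' en V') + 2 * sum (\<lambda>_. 1::real) {e\<in>E'. en e \<subseteq> V'}"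
      using sub fin V' by (intro sum_degrees) auto
    moreover have s: "en e \<subseteq> V'" if "e \<in> E'" for e using that fin sub by (auto simp: V'_def)
    moreover have "mcut E' en V' = {}"
    proof -
      have "card (en e \<inter> V') = 2" if "e \<in> E'" for e
        using s[OF that] that fin sub by (metis Int_absorb2 subsetD)
      then show ?thesis by (auto simp: mcut_def)
    qed
    moreover have "{e\<in>E'. en e \<subseteq> V'} = E'" using s by auto
    ultimately show ?thesis by simp
  qed
  have "(\<Sum>v\<in>V'. real (card (mcut E' en {v})) - 2) \<le> 0"
    using hs cle by (simp add: sum_subtractf)
  moreover have nn: "\<And>v. v \<in> V' \<Longrightarrow> 0 \<le> real (card (mcut E' en {v})) - 2" using deg2 by force
  ultimately have "(\<Sum>v\<in>V'. real (card (mcut E' en {v})) - 2) = 0"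
    by (meson antisym sum_nonneg)
  then have c2: "card (mcut E' en {v}) = 2" if "v \<in> V'" for v
    using nn that V' by (subst (asm) sum_nonneg_eq_0_iff) auto
  have half: "x e = 1 / 2" if e: "e \<in> E'" for e
  proof -
    \<comment> \<open>All degrees being 2, the difference of \<open>x\<close> and the constant 1/2
      on the fractional edges is a kernel vector.\<close>
    define y where "y e = (if e \<in> E' then x e - 1 / 2 else 0)" for e
    have yz: "\<forall>e. e \<notin> E' \<longrightarrow> y e = 0" by (simp add: y_def)
    have "sum y (mcut E en {v}) = 0" if v: "v \<in> V" for v
    proof (cases "v \<in> V'")
      case True
      have "sum y (mcut E' en {v}) = (\<Sum>e\<in>mcut E' en {v}. x e - 1 / 2)"
        by (intro sum.cong) (auto simp: y_def mcut_def)
      then show ?thesis using c2[OF True] xsum[OF True] ksum[OF yz] by (simp add: sum_subtractf)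
    qed (use v out ksum[OF yz] in simp)
    then have "y e = 0" using noker[OF yz] by blast
    then show ?thesis using e by (simp add: y_def)
  qed
  obtain f v where f: "f \<in> E'" "v \<in> en f" using E'(2) fin sub
    by (metis card_2_iff' all_not_in_conv subsetD)
  then have v: "v \<in> V'" using fin sub by (auto simp: V'_def)
  obtain e1 e2 where ee: "mcut E' en {v} = {e1, e2}" "e1 \<noteq> e2" using c2[OF v] by (rule card_eq_2E)
  have e12: "e1 \<in> E'" "e2 \<in> E'" "v \<in> en e1" "v \<in> en e2"
    using ee mem_mcut_singleton[OF G'] by (auto simp: mcut_def)
  have ends: "\<exists>u. en e = {v, u} \<and> u \<noteq> v" if "e \<in> E'" "v \<in> en e" for e
  proof -
    have "card (en e) = 2" using that fin sub by auto
    then obtain a b where "en e = {a, b}" "a \<noteq> b" by (rule card_eq_2E)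
    then show ?thesis using that by auto
  qed
  obtain u where u: "en e1 = {v, u}" "u \<noteq> v" using ends e12 by blast
  obtain w where w: "en e2 = {v, w}" "w \<noteq> v" using ends e12 by blast
  have "u \<noteq> w"
  proof
    assume uw: "u = w"
    \<comment> \<open>Two parallel edges with opposite signs would form a kernel vector.\<close>
    define y :: "'e \<Rightarrow> real" where "y e = (if e = e1 then 1 else if e = e2 then -1 else 0)" for e
    have yz: "\<forall>e. e \<notin> E' \<longrightarrow> y e = 0" using e12 by (auto simp: y_def)
    have "sum y (mcut E en {r}) = 0" if r: "r \<in> V" for r
    proof -
      have iff: "e1 \<in> mcut E' en {r} \<longleftrightarrow> e2 \<in> mcut E' en {r}"
        using mem_mcut_singleton[OF G'] e12 u w uw by simp
      have "sum y (mcut E' en {r}) = sum y (mcut E' en {r} \<inter> {e1, e2})"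
        using sub by (intro sum.mono_neutral_right) (auto simp: y_def)
      also have "mcut E' en {r} \<inter> {e1, e2} = {} \<or> mcut E' en {r} \<inter> {e1, e2} = {e1, e2}"
        using iff by auto
      then have "sum y (mcut E' en {r} \<inter> {e1, e2}) = 0" using ee(2) by (auto simp: y_def)
      finally show ?thesis using ksum[OF yz] by simp
    qed
    then have "y e1 = 0" using noker[OF yz] by blast
    then show False by (simp add: y_def)
  qed
  \<comment> \<open>The degree sum over the path is 3, and its two edges contribute 1 twice to that
    sum, so at most 1 is left for the cut.\<close>
  define S where "S = {u, v, w}"
  have S: "S \<subseteq> V" "card S = 3" "finite S"
    using u w \<open>u \<noteq> w\<close> fin(4)[OF subsetD[OF sub(1) e12(1)]] fin(4)[OF subsetD[OF sub(1) e12(2)]]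
    by (auto simp: S_def)
  have "(\<Sum>v\<in>S. sum x (mcut E en {v})) = 3" using x S by (simp add: frac_pm_def subset_iff)
  moreover have "sum x {e1, e2} \<le> sum x {e\<in>E. en e \<subseteq> S}"
    using x fin sub e12 u w by (intro sum_mono2) (auto simp: S_def frac_pm_def)
  moreover have "sum x {e1, e2} = 1" using ee(2) half[OF e12(1)] half[OF e12(2)] by simp
  ultimately have "sum x (mcut E en S) \<le> 1" using sum_degrees[OF fin(2,3) S(3), of x] by linarith
  moreover have "1 \<le> sum x (mcut E en S)" using x S by (simp add: frac_pm_def)
  ultimately show ?thesis using S by (intro exI[of _ S]) auto
qed

text \<open>The outer induction is on the number of vertices: a nontrivial tight set is contracted
  from either side and the two matchings are glued along a common cut edge. The inner induction is
  on the size of the support: without such a set, \<open>x\<close> is moved along a kernel vector on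
  its fractional edges until an edge vanishes or a nontrivial set becomes tight.\<close>

theorem edmonds:
  fixes V :: "'v set" and x :: "'e \<Rightarrow> real"
  assumes "multigraph V E en" "frac_pm V E en x" "e \<in> E" "0 < x e"
  shows "\<exists>N. conform V E en x N \<and> e \<in> N"
  using assms
proof (induction "card V" arbitrary: V E en x e rule: less_induct)
  case (less V E en x e)
  note G = less.prems(1)
  have fin: "finite V" "finite E" "\<And>e. e \<in> E \<Longrightarrow> card (en e) = 2" "\<And>e. e \<in> E \<Longrightarrow> en e \<subseteq> V"
    using G by (auto simp: multigraph_def)
  have glue: "\<exists>N. conform V E en x N \<and> e \<in> N"
    if x: "frac_pm V E en x" and e: "e \<in> E" "0 < x e"
      and S: "S \<subseteq> V" "odd (card S)" "3 \<le> card S" "card S + 3 \<le> card V" "sum x (mcut E en S) = 1"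
    for x :: "'e \<Rightarrow> real" and e S
  proof -
    have fS: "finite S" "card (V - S) = card V - card S"
      using S(1) fin(1) finite_subset[of S V] by (auto simp: card_Diff_subset)
    have S': "V - S \<subseteq> V" "odd (card (V - S))" "sum x (mcut E en (V - S)) = 1"
      using S fS frac_pm_even[OF G x] mcut_Compl[OF G, of S] by auto
    obtain s where s: "s \<in> S" using S by fastforce
    have "V - S \<noteq> {}" using S fS by auto
    then obtain r where r: "r \<in> V - S" by blast
    have c1: "card (insert s (V - S)) < card V" using s fS S fin by (subst card_insert_disjoint) auto
    have "V - (V - S) = S" using S by auto
    then have c2: "card (insert r (V - (V - S))) < card V" using r fS S fin by (subst card_insert_disjoint) auto
    note IH1 = less.hyps[OF c1 multigraph_merge[OF G s S(1)] frac_pm_merge[OF G s S(1,2) x S(5)]]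
    note IH2 = less.hyps[OF c2 multigraph_merge[OF G r S'(1)] frac_pm_merge[OF G r S'(1,2) x S'(3)]]
    have cutin: "\<not> en f \<subseteq> S \<and> \<not> en f \<subseteq> V - S \<and> f \<in> E" if "f \<in> mcut E en S" for f
    proof -
      have f: "f \<in> E" "card (en f \<inter> S) = 1" using that by (auto simp: mcut_def)
      from fin(3)[OF f(1)] obtain a b where ab: "en f = {a, b}" "a \<noteq> b" by (rule card_eq_2E)
      show ?thesis using f unfolding ab(1) card_pair_Int[OF ab(2)]
        by (auto simp: of_bool_def split: if_splits)
    qed
    have side1: "\<exists>N f. conform (insert s (V - S)) {e\<in>E. \<not> en e \<subseteq> S} (\<lambda>e. merge S s ` en e) x N \<and>
       g \<in> N \<and> f \<in> N \<and> f \<in> mcut E en S \<and> 0 < x f" if g: "g \<in> E" "0 < x g" "\<not> en g \<subseteq> S" for g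
    proof -
      obtain N where N: "conform (insert s (V - S)) {e\<in>E. \<not> en e \<subseteq> S} (\<lambda>e. merge S s ` en e) x N" "g \<in> N"
        using IH1[of g] g by auto
      have "card (N \<inter> mcut E en S) = 1" using conform_merge[OF G s S(1,2) N(1) S(1,2,5)] by auto
      then obtain f where "N \<inter> mcut E en S = {f}" by (auto simp: card_1_singleton_iff)
      then have "f \<in> N" "f \<in> mcut E en S" by auto
      then show ?thesis using N by (intro exI[of _ N] exI[of _ f]) (auto simp: conform_def)
    qed
    have side2: "\<exists>N f. conform (insert r (V - (V - S))) {e\<in>E. \<not> en e \<subseteq> V - S} (\<lambda>e. merge (V - S) r ` en e) x N \<and>
       g \<in> N \<and> f \<in> N \<and> f \<in> mcut E en S \<and> 0 < x f" if g: "g \<in> E" "0 < x g" "\<not> en g \<subseteq> V - S" for g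
    proof -
      obtain N where N: "conform (insert r (V - (V - S))) {e\<in>E. \<not> en e \<subseteq> V - S} (\<lambda>e. merge (V - S) r ` en e) x N" "g \<in> N"
        using IH2[of g] g by auto
      have "card (N \<inter> mcut E en S) = 1" using conform_merge[OF G r S'(1,2) N(1) S(1,2,5)] by auto
      then obtain f where "N \<inter> mcut E en S = {f}" by (auto simp: card_1_singleton_iff)
      then have "f \<in> N" "f \<in> mcut E en S" by auto
      then show ?thesis using N by (intro exI[of _ N] exI[of _ f]) (auto simp: conform_def)
    qed
    show ?thesis
    proof (cases "en e \<subseteq> S")
      case False
      from side1[OF e this] obtain N1 f where N1: "conform (insert s (V - S)) {e\<in>E. \<not> en e \<subseteq> S} (\<lambda>e. merge S s ` en e) x N1"
        "e \<in> N1" "f \<in> N1" "f \<in> mcut E en S" "0 < x f" by blast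
      from side2[of f] cutin[OF N1(4)] N1(5) obtain N2 where
        N2: "conform (insert r (V - (V - S))) {e\<in>E. \<not> en e \<subseteq> V - S} (\<lambda>e. merge (V - S) r ` en e) x N2" "f \<in> N2" by blast
      show ?thesis using conform_glue[OF G x S(1,2) S'(2) S(5) s r N1(1) N2(1) N1(3) N2(2) N1(4)] N1(2) by blast
    next
      case True
      moreover have "en e \<noteq> {}" using fin(3)[OF e(1)] by auto
      ultimately have "\<not> en e \<subseteq> V - S" by auto
      from side2[OF e this] obtain N2 f where
        N2: "conform (insert r (V - (V - S))) {e\<in>E. \<not> en e \<subseteq> V - S} (\<lambda>e. merge (V - S) r ` en e) x N2"
        "e \<in> N2" "f \<in> N2" "f \<in> mcut E en S" "0 < x f" by blast
      from side1[of f] cutin[OF N2(4)] N2(5) obtain N1 where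
        N1: "conform (insert s (V - S)) {e\<in>E. \<not> en e \<subseteq> S} (\<lambda>e. merge S s ` en e) x N1" "f \<in> N1" by blast
      show ?thesis using conform_glue[OF G x S(1,2) S'(2) S(5) s r N1(1) N2(1) N1(2) N2(3) N2(4)] N2(2) by blast
    qed
  qed
  have "frac_pm V E en x \<Longrightarrow> e \<in> E \<Longrightarrow> 0 < x e \<Longrightarrow> \<exists>N. conform V E en x N \<and> e \<in> N"
  proof (induction "card {e\<in>E. 0 < x e}" arbitrary: x e rule: less_induct)
    case (less x e)
    note x = less.prems(1) and e = less.prems(2,3)
    have x0: "\<And>e. e \<in> E \<Longrightarrow> 0 \<le> x e" using x by (simp add: frac_pm_def)
    define nontriv where "nontriv S \<longleftrightarrow> S \<subseteq> V \<and> odd (card S) \<and> 3 \<le> card S \<and> card S + 3 \<le> card V" for S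
    show ?case
    proof (cases "card V \<le> 4 \<or> (\<exists>S. nontriv S \<and> sum x (mcut E en S) = 1)")
      case True
      then show ?thesis using glue[OF x e] conform_two_or_four[OF G x e] by (auto simp: nontriv_def)
    next
      case False
      then have "\<not> card V \<le> 4" by blast
      then have V6: "6 \<le> card V" using frac_pm_even[OF G x] by presburger
      have nt: "sum x (mcut E en S) \<noteq> 1" if "nontriv S" for S using False that by blast
      define E' where "E' = {e\<in>E. 0 < x e \<and> x e < 1}"
      show ?thesis
      proof (cases "E' = {}")
        case True
        have "x e = 0 \<or> x e = 1" if e: "e \<in> E" for e
        proof -
          obtain v where v: "v \<in> en e" using fin(3)[OF e] by fastforce
          then have "v \<in> V" using fin(4) e by auto
          then have "sum x (mcut E en {v}) = 1" using x by (simp add: frac_pm_def)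
          moreover have "x e \<le> sum x (mcut E en {v})"
            using mem_mcut_singleton[OF G e, of v] v x0 fin by (intro member_le_sum) (auto simp: mcut_def)
          ultimately show ?thesis using True e x0[OF e] by (force simp: E'_def)
        qed
        then have int: "\<And>e. e \<in> E \<Longrightarrow> x e = 0 \<or> x e = 1" .
        have "x e = 1" using int[OF e(1)] e by auto
        then show ?thesis using conform_integral[OF G x int] e by blast
      next
        case False
        obtain y0 :: "'e \<Rightarrow> real" where y0: "\<forall>e. e \<notin> E' \<longrightarrow> y0 e = 0"
          "\<forall>v\<in>V. sum y0 (mcut E en {v}) = 0" "\<exists>e. y0 e \<noteq> 0"
        proof (rule ccontr)
          assume "\<not> thesis"
          then have "\<exists>S\<subseteq>V. card S = 3 \<and> sum x (mcut E en S) = 1"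
            using that by (intro kernel_or_nontrivial_tight[OF G x E'_def False]) blast
          then obtain S where "S \<subseteq> V" "card S = 3" "sum x (mcut E en S) = 1" by blast
          then show False using nt[of S] V6 by (simp add: nontriv_def)
        qed
        \<comment> \<open>The sign keeps \<open>e\<close> in the support while \<open>x\<close>
          moves along \<open>y\<close>.\<close>
        define y where "y = (if 0 \<le> y0 e then y0 else (\<lambda>e'. - y0 e'))"
        have y: "\<forall>e. e \<notin> E' \<longrightarrow> y e = 0" "\<exists>e. y e \<noteq> 0" "0 \<le> y e"
          "\<And>v. v \<in> V \<Longrightarrow> sum y (mcut E en {v}) = 0"
          using y0 by (auto simp: y_def sum_negf)
        have triv: "sum x (mcut E en S) = 1 \<and> sum y (mcut E en S) = 0"
          if S: "S \<subseteq> V" "odd (card S)" "\<not> nontriv S" for S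
        proof -
          obtain v where "v \<in> V" "mcut E en S = mcut E en {v}"
            using trivial_cut[OF G x S(1,2)] S by (auto simp: nontriv_def)
          then show ?thesis using y x by (simp add: frac_pm_def)
        qed
        define I where "I = Inl ` E \<union> Inr ` {S. S \<subseteq> V \<and> odd (card S)}"
        define a where "a = case_sum x (\<lambda>S. sum x (mcut E en S) - 1)"
        define b where "b = case_sum y (\<lambda>S. sum y (mcut E en S))"
        have "\<exists>i\<in>I. b i < 0"
        proof -
          obtain f where f: "y f \<noteq> 0" using y by auto
          then have fE: "f \<in> E" using y(1) by (auto simp: E'_def)
          obtain v where v: "v \<in> en f" using fin(3)[OF fE] by fastforce
          then have vV: "v \<in> V" using fin(4) fE by auto
          have fm: "f \<in> mcut E en {v}" using mem_mcut_singleton[OF G fE] v by simp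
          have "\<exists>g\<in>mcut E en {v}. y g < 0"
          proof (rule ccontr)
            assume "\<not> ?thesis"
            then have "\<forall>g\<in>mcut E en {v}. y g = 0"
              using y(4)[OF vV] fin by (subst (asm) sum_nonneg_eq_0_iff) force+
            then show False using f fm by auto
          qed
          then obtain g where "g \<in> E" "y g < 0" by (auto simp: mcut_def)
          then show ?thesis by (intro bexI[of _ "Inl g"]) (auto simp: I_def b_def)
        qed
        moreover have "finite I" using fin by (auto simp: I_def)
        moreover have "0 \<le> a i" if "i \<in> I" for i
          using that x x0 by (auto simp: I_def a_def frac_pm_def)
        moreover have "0 \<le> b i" if "i \<in> I" "a i = 0" for i
        proof (cases i)
          case (Inl f)
          then show ?thesis using that y(1) by (auto simp: a_def b_def E'_def)
        next
          case (Inr S)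
          then have "S \<subseteq> V" "odd (card S)" "sum x (mcut E en S) = 1" using that by (auto simp: I_def a_def)
          then have "sum y (mcut E en S) = 0" using triv nt by blast
          then show ?thesis using Inr by (simp add: b_def)
        qed
        ultimately obtain t where t: "0 < t" "\<And>i. i \<in> I \<Longrightarrow> 0 \<le> a i + t * b i" "\<exists>i\<in>I. 0 < a i \<and> a i + t * b i = 0"
          using maximal_step[of I a b] by blast
        define x' where "x' e = x e + t * y e" for e
        have x's: "sum x' A = sum x A + t * sum y A" for A
          by (simp add: x'_def sum.distrib sum_distrib_left)
        have "0 \<le> x' e" if "e \<in> E" for e
          using t(2)[of "Inl e"] that by (auto simp: I_def a_def b_def x'_def)
        moreover have "1 \<le> sum x' (mcut E en S)" if "S \<subseteq> V" "odd (card S)" for S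
          using t(2)[of "Inr S"] that by (auto simp: I_def a_def b_def x's)
        ultimately have x': "frac_pm V E en x'" using x y(4) by (auto simp: frac_pm_def x's)
        have e': "0 < x' e" using e y(3) t(1) by (simp add: x'_def add_pos_nonneg)
        have supp: "{e\<in>E. 0 < x' e} \<subseteq> {e\<in>E. 0 < x e}"
        proof -
          have "x f \<noteq> 0" if "0 < x' f" for f
            using that y(1) by (auto simp: x'_def E'_def)
          then show ?thesis using x0 by (force simp: less_le)
        qed
        \<comment> \<open>All sets tight for \<open>x\<close> are trivial in this case and stay
          tight for \<open>x'\<close>, so conforming to \<open>x'\<close> is the stronger
          condition.\<close>
        have conf_x: "conform V E en x N" if N: "conform V E en x' N" for N
          unfolding conform_def
        proof (intro conjI allI impI)
          show "N \<subseteq> {e\<in>E. 0 < x e}" using N supp by (auto simp: conform_def)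
          fix S assume S: "S \<subseteq> V" "odd (card S)" "sum x (mcut E en S) = 1"
          then have "sum y (mcut E en S) = 0" using triv nt by blast
          then have "sum x' (mcut E en S) = 1" using S by (simp add: x's)
          then show "card (N \<inter> mcut E en S) = 1" using N S by (simp add: conform_def)
        qed
        obtain i where i: "i \<in> I" "0 < a i" "a i + t * b i = 0" using t(3) by blast
        show ?thesis
        proof (cases i)
          case (Inl f)
          then have f: "f \<in> E" "0 < x f" "x' f = 0" using i by (auto simp: I_def a_def b_def x'_def)
          then have "f \<in> {e\<in>E. 0 < x e}" "f \<notin> {e\<in>E. 0 < x' e}" by auto
          then have "{e\<in>E. 0 < x' e} \<subset> {e\<in>E. 0 < x e}" using supp by blast
          then have "card {e\<in>E. 0 < x' e} < card {e\<in>E. 0 < x e}" using fin by (intro psubset_card_mono) auto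
          then show ?thesis using less.hyps[OF _ x' e(1) e'] conf_x by blast
        next
          case (Inr S)
          then have S: "S \<subseteq> V" "odd (card S)" "sum x (mcut E en S) \<noteq> 1" "sum x' (mcut E en S) = 1"
            using i by (auto simp: I_def a_def b_def x's)
          then have "nontriv S" using triv by blast
          then show ?thesis using glue[OF x' e(1) e', of S] S conf_x by (auto simp: nontriv_def)
        qed
      qed
    qed
  qed
  then show ?case using less.prems by blast
qed

section \<open>Counting alternating circuits\<close>

fun alt :: "('a \<Rightarrow> 'b::comm_ring_1) \<Rightarrow> 'a list \<Rightarrow> 'b" where
  "alt f [] = 0"
| "alt f (x # xs) = f x - alt f xs"

lemma alt_append: "alt f (xs @ ys) = alt f xs + (-1) ^ length xs * alt f ys"
  by (induction xs) (auto simp: algebra_simps)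

lemma alt_rev: "alt f (rev xs) = - ((-1) ^ length xs * alt f xs)"
  by (induction xs) (auto simp: algebra_simps alt_append)

lemma alt_conv_sum: "alt f xs = (\<Sum>i<length xs. (-1) ^ i * f (xs ! i))"
  by (induction xs) (auto simp: sum.lessThan_Suc_shift sum_negf simp del: sum.lessThan_Suc)

definition chi :: "'e list \<Rightarrow> 'e \<Rightarrow> int" where
  "chi es e = alt (\<lambda>x. of_bool (x = e)) es"

lemma alt_indicator_chi: "alt_indicator es e = real_of_int (chi es e)"
  by (auto simp: alt_indicator_def chi_def alt_conv_sum indicator_def intro!: sum.cong)

text \<open>An alternating sum over a walk depends on the walk only through \<open>chi\<close>. This
  is what bounds the number of lifts by the number of alternating indicators.\<close>

lemma alt_chi:
  assumes "finite A" "set es \<subseteq> A"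
  shows "alt f es = (\<Sum>e\<in>A. of_int (chi es e) * f e)"
  using assms(2)
proof (induction es)
  case (Cons a es)
  have "f a = (\<Sum>e\<in>A. of_bool (a = e) * f e)" using Cons.prems assms(1) by (simp add: of_bool_def if_distrib[of "\<lambda>x. x * _"] cong: if_cong)
  then show ?case using Cons by (simp add: chi_def left_diff_distrib sum_subtractf)
qed (simp add: chi_def)

section \<open>Walks as lists\<close>

fun hdn :: "('n \<times> 'e) list \<Rightarrow> 'n \<Rightarrow> 'n" where
  "hdn [] v = v"
| "hdn (x # xs) v = fst x"

text \<open>A walk is a list of pairs of a tail and an edge, together with its final node. In
  contrast to the cyclic indexing of \<open>cyclic_walk\<close>, this form can be split and
  concatenated freely.\<close>

fun chain :: "('n, 'e) nw_multigraph \<Rightarrow> ('n \<times> 'e) list \<Rightarrow> 'n \<Rightarrow> bool" where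
  "chain H [] v = True"
| "chain H (x # xs) v = (fst x \<in> mg_nodes H \<and> snd x \<in> mg_edges H \<and>
     mg_ends H (snd x) = {fst x, hdn xs v} \<and> chain H xs v)"

lemma hdn_append: "hdn (xs @ ys) v = hdn xs (hdn ys v)"
  by (cases xs) auto

lemma hdn_nonempty: "xs \<noteq> [] \<Longrightarrow> hdn xs v = fst (hd xs)"
  by (cases xs) auto

lemma chain_append: "chain H (xs @ ys) v \<longleftrightarrow> chain H xs (hdn ys v) \<and> chain H ys v"
  by (induction xs) (auto simp: hdn_append)

lemma chain_edges: "chain H xs v \<Longrightarrow> snd ` set xs \<subseteq> mg_edges H"
  by (induction xs) auto

lemma chain_nth: "chain H xs v \<longleftrightarrow> (\<forall>i<length xs. fst (xs ! i) \<in> mg_nodes H \<and> snd (xs ! i) \<in> mg_edges H \<and>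
    mg_ends H (snd (xs ! i)) = {fst (xs ! i), (map fst xs @ [v]) ! Suc i})"
proof (induction xs)
  case (Cons x xs)
  have "hdn xs v = (map fst xs @ [v]) ! 0" by (cases xs) auto
  then show ?case using Cons by (simp add: All_less_Suc2)
qed simp

lemma cyclic_walk_chain:
  assumes "xs \<noteq> []"
  shows "cyclic_walk H (map fst xs) (map snd xs) \<longleftrightarrow> chain H xs (fst (hd xs))"
proof -
  have nx: "map fst xs ! (Suc i mod length xs) = (map fst xs @ [fst (hd xs)]) ! Suc i" if "i < length xs" for i
  proof (cases "Suc i = length xs")
    case True
    then show ?thesis using assms by (simp add: nth_append hd_conv_nth)
  next
    case False
    then show ?thesis using that by (simp add: nth_append)
  qed
  have "cyclic_walk H (map fst xs) (map snd xs) \<longleftrightarrow>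
    (\<forall>i<length xs. fst (xs ! i) \<in> mg_nodes H) \<and> (\<forall>i<length xs. snd (xs ! i) \<in> mg_edges H) \<and>
    (\<forall>i<length xs. mg_ends H (snd (xs ! i)) = {fst (xs ! i), map fst xs ! (Suc i mod length xs)})"
    unfolding cyclic_walk_def by (auto simp: set_conv_nth)
  also have "\<dots> \<longleftrightarrow> chain H xs (fst (hd xs))"
    unfolding chain_nth using nx by auto
  finally show ?thesis .
qed

definition circuit :: "('n, 'e) nw_multigraph \<Rightarrow> ('n \<times> 'e) list \<Rightarrow> bool" where
  "circuit H xs \<longleftrightarrow> xs \<noteq> [] \<and> even (length xs) \<and> chain H xs (fst (hd xs)) \<and> chi (map snd xs) \<noteq> (\<lambda>_. 0)"

definition nwt :: "('n, 'e) nw_multigraph \<Rightarrow> ('n \<times> 'e) list \<Rightarrow> nat" where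
  "nwt H xs = (\<Sum>x\<leftarrow>xs. mg_weight H (fst x))"

lemma nwt_simps [simp]: "nwt H [] = 0" "nwt H (x # xs) = mg_weight H (fst x) + nwt H xs"
  "nwt H (xs @ ys) = nwt H xs + nwt H ys"
  by (auto simp: nwt_def)

lemma alternating_circuit_iff: "alternating_circuit H (map fst xs) (map snd xs) \<longleftrightarrow> circuit H xs"
proof (cases "xs = []")
  case False
  have "(alt_indicator (map snd xs) = (\<lambda>_. 0)) = (chi (map snd xs) = (\<lambda>_. 0))"
    by (auto simp: fun_eq_iff alt_indicator_chi)
  moreover have "even (length xs) \<Longrightarrow> 2 \<le> length xs" using False by (cases xs; cases "tl xs") auto
  ultimately show ?thesis using False
    by (auto simp: alternating_circuit_def circuit_def cyclic_walk_chain)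
qed (simp add: alternating_circuit_def circuit_def)

lemma walk_node_weight_nwt: "walk_node_weight H (map fst xs) = nwt H xs"
  by (simp add: walk_node_weight_def nwt_def comp_def)

lemma no_alternating_circuit_iff:
  "(\<nexists>vs es. alternating_circuit H vs es \<and> real (walk_node_weight H vs) \<le> \<mu>) \<longleftrightarrow>
   (\<forall>xs. circuit H xs \<longrightarrow> \<mu> < real (nwt H xs))"
proof -
  have "\<exists>xs. vs = map fst xs \<and> es = map snd xs" if "alternating_circuit H vs es" for vs es
    using that by (intro exI[of _ "zip vs es"]) (auto simp: alternating_circuit_def cyclic_walk_def)
  then show ?thesis
    by (metis alternating_circuit_iff walk_node_weight_nwt not_less)
qed

text \<open>Going backwards, an edge is left from its former head, so the tails shift by one
  position against the edges.\<close>

fun rwalk :: "('n \<times> 'e) list \<Rightarrow> 'n \<Rightarrow> ('n \<times> 'e) list" where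
  "rwalk [] v = []"
| "rwalk (x # xs) v = rwalk xs v @ [(hdn xs v, snd x)]"

lemma rwalk_simps:
  "length (rwalk xs v) = length xs" "map snd (rwalk xs v) = rev (map snd xs)"
  "hdn (rwalk xs v) (hdn xs v) = v"
  "nwt H (rwalk xs v) + mg_weight H (hdn xs v) = nwt H xs + mg_weight H v"
  by (induction xs) (auto simp: hdn_append)

lemma hdn_node: "chain H xs v \<Longrightarrow> v \<in> mg_nodes H \<Longrightarrow> hdn xs v \<in> mg_nodes H"
  by (cases xs) auto

lemma chain_rwalk: "chain H xs v \<Longrightarrow> v \<in> mg_nodes H \<Longrightarrow> chain H (rwalk xs v) (hdn xs v)"
  by (induction xs) (auto simp: chain_append hdn_node)

section \<open>Short pieces of circuits and their signatures\<close>

lemma chi_append: "chi (xs @ ys) e = chi xs e + (-1) ^ length xs * chi ys e"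
  by (simp add: chi_def alt_append)

definition small_piece :: "('n, 'e) nw_multigraph \<Rightarrow> real \<Rightarrow> ('n \<times> 'e) list \<Rightarrow> bool" where
  "small_piece H h p \<longleftrightarrow> p \<noteq> [] \<and> (length p = 1 \<or> real (nwt H p) \<le> h)"

text \<open>If two pieces with the same endpoints had different alternating indicators, going along one
  and back along the other would be a short alternating circuit.\<close>

lemma chi_piece_unique:
  assumes short: "\<And>xs. circuit H xs \<Longrightarrow> 2 * h < real (nwt H xs)"
    and p: "small_piece H h p" "chain H p v" and q: "small_piece H h q" "chain H q v"
    and same: "last p = last q" "fst (hd p) = fst (hd q)" "even (length p) = even (length q)"
  shows "chi (map snd p) = chi (map snd q)"
proof -
  have ne: "p \<noteq> []" "q \<noteq> []" using p q by (auto simp: small_piece_def)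
  have wp: "mg_weight H (fst (hd p)) \<le> nwt H p" using ne by (cases p) auto
  have wq: "mg_weight H (fst (hd q)) \<le> nwt H q" using ne by (cases q) auto
  have single: "r = [last r]" if "length r = 1" for r :: "('n \<times> 'e) list" using that by (cases r) auto
  show ?thesis
  proof (cases "real (nwt H p) \<le> h \<and> real (nwt H q) \<le> h")
    case False
    \<comment> \<open>A heavy piece is a single edge. Its tail is also the start of the other piece,
      which is thereby heavy and a single edge too.\<close>
    then have "length p = 1 \<and> length q = 1"
    proof (elim disjE[OF iffD1[OF de_Morgan_conj]])
      assume a: "\<not> real (nwt H p) \<le> h"
      then have "p = [last p]" using p single[of p] by (auto simp: small_piece_def)
      then obtain z where "p = [z]" by metis
      then have "nwt H p = mg_weight H (fst (hd q))" using same by auto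
      then show ?thesis using \<open>p = [z]\<close> a wq q by (auto simp: small_piece_def)
    next
      assume a: "\<not> real (nwt H q) \<le> h"
      then have "q = [last q]" using q single[of q] by (auto simp: small_piece_def)
      then obtain z where "q = [z]" by metis
      then have "nwt H q = mg_weight H (fst (hd p))" using same by auto
      then show ?thesis using \<open>q = [z]\<close> a wp p by (auto simp: small_piece_def)
    qed
    then have "p = q" using single[of p] single[of q] same by auto
    then show ?thesis by simp
  next
    case True
    define z where "z = last p"
    define p' where "p' = butlast p"
    define q' where "q' = butlast q"
    have pq: "p = p' @ [z]" "q = q' @ [z]" using append_butlast_last_id[OF ne(1)] append_butlast_last_id[OF ne(2)] same(1)
      unfolding z_def p'_def q'_def by metis+
    have ch: "chain H p' (fst z)" "chain H q' (fst z)" "fst z \<in> mg_nodes H"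
      using p q by (auto simp: pq chain_append)
    have st: "hdn p' (fst z) = hdn q' (fst z)" using same(2) by (cases p'; cases q') (auto simp: pq)
    \<comment> \<open>Up to the common last entry along \<open>p\<close> and back along
      \<open>q\<close>. Adding the weight of the turning point and leaving out that of the common
      start, \<open>C\<close> weighs at most as much as \<open>p\<close> and \<open>q\<close>
      together.\<close>
    define C where "C = p' @ rwalk q' (fst z)"
    have lenC: "length C = length p' + length q'" by (simp add: C_def rwalk_simps)
    have evC: "even (length C)" using same(3) unfolding lenC pq by auto
    have chiC: "chi (map snd C) e = chi (map snd p') e - chi (map snd q') e" for e
    proof -
      have "chi (map snd C) e = chi (map snd p') e - (-1) ^ length p' * (-1) ^ length q' * chi (map snd q') e"
        by (simp add: C_def chi_def alt_append rwalk_simps alt_rev mult.assoc)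
      moreover have "(-1::int) ^ length p' * (-1) ^ length q' = 1"
        using evC unfolding lenC by (simp flip: power_add)
      ultimately show ?thesis by simp
    qed
    have wC: "real (nwt H C) \<le> 2 * h"
    proof -
      have "nwt H C + mg_weight H (hdn q' (fst z)) = nwt H p' + (nwt H q' + mg_weight H (fst z))"
        using rwalk_simps(4)[of H q' "fst z"] by (simp add: C_def)
      moreover have "nwt H p = nwt H p' + mg_weight H (fst z)" "nwt H q = nwt H q' + mg_weight H (fst z)"
        by (simp_all add: pq)
      ultimately have "nwt H C \<le> nwt H p + nwt H q" by linarith
      then show ?thesis using True by linarith
    qed
    have chC: "C \<noteq> [] \<Longrightarrow> chain H C (fst (hd C))"
    proof -
      assume "C \<noteq> []"
      have "chain H C (hdn q' (fst z))"
        using ch chain_rwalk[OF ch(2,3)] by (simp add: C_def chain_append rwalk_simps)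
      moreover have "hdn C (hdn q' (fst z)) = hdn q' (fst z)"
        by (simp add: C_def hdn_append rwalk_simps st)
      ultimately show ?thesis using \<open>C \<noteq> []\<close> by (simp add: hdn_nonempty)
    qed
    have "chi (map snd C) = (\<lambda>_. 0)"
    proof (cases "C = []")
      case False
      then show ?thesis using short[of C] wC evC chC by (force simp: circuit_def)
    qed (simp add: chi_def fun_eq_iff)
    then have "chi (map snd p') = chi (map snd q')" using chiC by (auto simp: fun_eq_iff)
    then have "chi (map snd p') e = chi (map snd q') e" for e by simp
    moreover have "even (length p') = even (length q')" using same(3) by (auto simp: pq)
    then have "(-1::int) ^ length p' = (-1) ^ length q'" by (auto simp: minus_one_power_iff)
    ultimately show ?thesis by (auto simp: fun_eq_iff pq chi_append)
  qed
qed

text \<open>In a splitting into as few small pieces as possible, two neighbouring pieces weigh more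
  than \<open>h\<close> together, since otherwise they could be joined. Eight pieces contain four
  disjoint neighbouring pairs and would weigh more than \<open>4 * h\<close>.\<close>

lemma split_small_pieces:
  assumes w: "real (nwt H xs) \<le> 4 * h" and h: "0 < h"
  obtains pss where "concat pss = xs" "\<forall>p\<in>set pss. small_piece H h p" "length pss \<le> 7"
proof -
  define P where "P pss \<longleftrightarrow> concat pss = xs \<and> (\<forall>p\<in>set pss. small_piece H h p)" for pss
  have "P (map (\<lambda>x. [x]) xs)" by (auto simp: P_def small_piece_def)
  then obtain pss where pss: "P pss" and min: "\<And>qss. P qss \<Longrightarrow> length pss \<le> length qss"
    using ex_has_least_nat[of P _ length] by blast
  have adj: "h < real (nwt H a) + real (nwt H b)" if eq: "pss = as @ a # b # bs" for as a b bs
  proof (rule ccontr)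
    assume "\<not> ?thesis"
    then have "small_piece H h (a @ b)" using pss by (auto simp: P_def eq small_piece_def)
    then have "P (as @ (a @ b) # bs)" using pss by (auto simp: P_def eq)
    from min[OF this] show False by (simp add: eq)
  qed
  have "length pss \<le> 7"
  proof (rule ccontr)
    assume "\<not> ?thesis"
    then have "8 \<le> length pss" by simp
    then obtain a1 a2 a3 a4 a5 a6 a7 a8 r where eq: "pss = a1 # a2 # a3 # a4 # a5 # a6 # a7 # a8 # r"
      by (auto simp: numeral_eq_Suc Suc_le_length_iff)
    have "h < real (nwt H a1) + real (nwt H a2)" by (rule adj[of "[]"]) (simp add: eq)
    moreover have "h < real (nwt H a3) + real (nwt H a4)" by (rule adj[of "[a1, a2]"]) (simp add: eq)
    moreover have "h < real (nwt H a5) + real (nwt H a6)" by (rule adj[of "[a1, a2, a3, a4]"]) (simp add: eq)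
    moreover have "h < real (nwt H a7) + real (nwt H a8)" by (rule adj[of "[a1, a2, a3, a4, a5, a6]"]) (simp add: eq)
    moreover have "nwt H xs = nwt H a1 + nwt H a2 + nwt H a3 + nwt H a4 + nwt H a5 + nwt H a6 + nwt H a7 + nwt H a8 + nwt H (concat r)"
    proof -
      have "xs = concat pss" using pss by (simp add: P_def)
      then show ?thesis by (simp add: eq)
    qed
    ultimately show False using w by linarith
  qed
  then show thesis using that pss by (auto simp: P_def)
qed

text \<open>A piece leaves behind its last edge with tail and head and the parity of its length. The
  head is the start of the next piece, so both end nodes of each piece can be read off, which is
  what \<open>chi_piece_unique\<close> asks for.\<close>

fun signature :: "('n \<times> 'e) list list \<Rightarrow> 'n \<Rightarrow> (('n \<times> 'e \<times> 'n) \<times> bool) list" where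
  "signature [] v = []"
| "signature (p # ps) v = ((fst (last p), snd (last p), hdn (concat ps) v), even (length p)) # signature ps v"

lemma length_signature: "length (signature ps v) = length ps"
  by (induction ps) auto

lemma signature_eq_Nil: "signature ps v = [] \<longleftrightarrow> ps = []"
  by (cases ps) auto

lemma last_signature: "ps \<noteq> [] \<Longrightarrow> snd (snd (fst (last (signature ps v)))) = v"
  by (induction ps) (auto simp: signature_eq_Nil)

lemma signature_unique:
  assumes short: "\<And>xs. circuit H xs \<Longrightarrow> 2 * h < real (nwt H xs)"
    and "signature ps v = signature qs v" "hdn (concat ps) v = hdn (concat qs) v"
    and "chain H (concat ps) v" "chain H (concat qs) v"
    and "\<forall>p\<in>set ps. small_piece H h p" "\<forall>q\<in>set qs. small_piece H h q"
  shows "chi (map snd (concat ps)) = chi (map snd (concat qs))"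
  using assms(2-)
proof (induction ps arbitrary: qs)
  case Nil
  then have "qs = []" by (cases qs) auto
  then show ?case by simp
next
  case (Cons p ps)
  then obtain q qs' where qs: "qs = q # qs'" by (cases qs) auto
  have ne: "p \<noteq> []" "q \<noteq> []" using Cons.prems qs by (auto simp: small_piece_def)
  have n: "hdn (concat ps) v = hdn (concat qs') v" using Cons.prems(1) qs by auto
  have rest: "chi (map snd (concat ps)) = chi (map snd (concat qs'))"
    using Cons.prems qs n by (intro Cons.IH) (auto simp: chain_append)
  have par: "even (length p) = even (length q)" using Cons.prems(1) qs by auto
  have pq: "chi (map snd p) = chi (map snd q)"
  proof (rule chi_piece_unique[OF short])
    show "small_piece H h p" "small_piece H h q" using Cons.prems qs by auto
    show "chain H p (hdn (concat ps) v)" "chain H q (hdn (concat ps) v)"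
      using Cons.prems qs n by (auto simp: chain_append)
    show "last p = last q" using Cons.prems(1) qs by (auto simp: prod_eq_iff)
    show "fst (hd p) = fst (hd q)" using Cons.prems(2) ne by (simp add: qs hdn_append hdn_nonempty)
  qed (use par in auto)
  have sg: "(-1::int) ^ length p = (-1) ^ length q" using par by (auto simp: minus_one_power_iff)
  show ?case
  proof
    fix e
    have "chi (map snd (concat (p # ps))) e = chi (map snd p) e + (-1) ^ length p * chi (map snd (concat ps)) e"
      by (simp add: chi_append)
    moreover have "chi (map snd (concat qs)) e = chi (map snd q) e + (-1) ^ length q * chi (map snd (concat qs')) e"
      by (simp add: chi_append qs)
    ultimately show "chi (map snd (concat (p # ps))) e = chi (map snd (concat qs)) e"
      by (simp only: pq sg rest)
  qed
qed

lemma signature_arcs: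
  assumes "chain H (concat ps) v" "\<forall>p\<in>set ps. p \<noteq> []"
  shows "set (signature ps v) \<subseteq> {(u, e, w). e \<in> mg_edges H \<and> mg_ends H e = {u, w}} \<times> UNIV"
  using assms
proof (induction ps)
  case (Cons p ps)
  then have "chain H p (hdn (concat ps) v)" "p = butlast p @ [last p]" by (auto simp: chain_append)
  then have "chain H (butlast p @ [last p]) (hdn (concat ps) v)" by simp
  then have "snd (last p) \<in> mg_edges H" "mg_ends H (snd (last p)) = {fst (last p), hdn (concat ps) v}"
    by (auto simp: chain_append)
  then show ?case using Cons by (auto simp: chain_append)
qed simp

lemma card_arcs_le:
  assumes "finite (mg_edges H)"
  shows "finite {(u, e, w). e \<in> mg_edges H \<and> mg_ends H e = {u, w}}"
    and "card {(u, e, w). e \<in> mg_edges H \<and> mg_ends H e = {u, w}} \<le> 2 * card (mg_edges H)"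
proof -
  let ?A = "{(u, e, w). e \<in> mg_edges H \<and> mg_ends H e = {u, w}}"
  define f where "f e = (SOME u. \<exists>w. mg_ends H e = {u, w})" for e
  define g where "g e = (SOME w. mg_ends H e = {f e, w})" for e
  define k where "k = (\<lambda>(e, b). if b then (f e, e, g e) else (g e, e, f e))"
  have fg: "mg_ends H e = {f e, g e}" if "mg_ends H e = {u, w}" for e u w
  proof -
    have "\<exists>w. mg_ends H e = {f e, w}" unfolding f_def by (rule someI[of _ u]) (use that in blast)
    then show ?thesis unfolding g_def by (rule someI_ex)
  qed
  have sub: "?A \<subseteq> k ` (mg_edges H \<times> (UNIV :: bool set))"
  proof (clarify)
    fix u e w assume e: "e \<in> mg_edges H" "mg_ends H e = {u, w}"
    then have "{u, w} = {f e, g e}" using fg by simp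
    then have "(u, e, w) = k (e, True) \<or> (u, e, w) = k (e, False)" by (auto simp: k_def doubleton_eq_iff)
    then show "(u, e, w) \<in> k ` (mg_edges H \<times> UNIV)" using e by blast
  qed
  have fin: "finite (mg_edges H \<times> (UNIV :: bool set))" using assms by simp
  show "finite ?A" using sub fin finite_subset by blast
  have "card ?A \<le> card (k ` (mg_edges H \<times> (UNIV :: bool set)))" using sub fin by (intro card_mono) auto
  also have "\<dots> \<le> card (mg_edges H \<times> (UNIV :: bool set))" by (rule card_image_le[OF fin])
  also have "\<dots> = 2 * card (mg_edges H)" by (simp add: card_cartesian_product)
  finally show "card ?A \<le> 2 * card (mg_edges H)" .
qed

text \<open>This is the case \<open>h = l / 2\<close>: all circuits weigh more than
  \<open>2 * h\<close>, and the counted ones at most \<open>4 * h\<close>. The factor 4 stands for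
  the two directions of the last edge of a piece and the two parities. On a closed walk the final
  node is the head of the last recorded edge and also the start of the first piece.\<close>

theorem card_chi_circuits_le:
  fixes H :: "('n, 'e) nw_multigraph"
  assumes fin: "finite (mg_edges H)" and l: "0 < l"
    and short: "\<And>xs. circuit H xs \<Longrightarrow> l < real (nwt H xs)"
  defines "X \<equiv> {chi (map snd xs) | xs. circuit H xs \<and> real (nwt H xs) \<le> 2 * l}"
  shows "finite X" "card X \<le> (\<Sum>i\<le>7. (4 * card (mg_edges H)) ^ i)"
proof -
  define A where "A = {(u, e, w). e \<in> mg_edges H \<and> mg_ends H e = {u, w}} \<times> (UNIV :: bool set)"
  have A: "finite A" "card A \<le> 4 * card (mg_edges H)"
    using card_arcs_le[OF fin] by (auto simp: A_def card_cartesian_product)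
  have short': "\<And>xs. circuit H xs \<Longrightarrow> 2 * (l / 2) < real (nwt H xs)" using short by simp
  define good where "good ps v c \<longleftrightarrow> ps \<noteq> [] \<and> chain H (concat ps) v \<and> hdn (concat ps) v = v \<and>
    (\<forall>p\<in>set ps. small_piece H (l / 2) p) \<and> length ps \<le> 7 \<and> c = chi (map snd (concat ps))" for ps v c
  have ex: "\<exists>ps v. good ps v c" if cX: "c \<in> X" for c
  proof -
    obtain xs where xs: "circuit H xs" "real (nwt H xs) \<le> 4 * (l / 2)" "c = chi (map snd xs)"
      using cX by (auto simp: X_def)
    obtain ps where "concat ps = xs" "\<forall>p\<in>set ps. small_piece H (l / 2) p" "length ps \<le> 7"
      using split_small_pieces[OF xs(2)] l by auto
    then have "good ps (fst (hd xs)) c" using xs by (auto simp: good_def circuit_def hdn_nonempty)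
    then show ?thesis by blast
  qed
  then obtain ps v where pv: "\<And>c. c \<in> X \<Longrightarrow> good (ps c) (v c) c" by metis
  define sg where "sg c = signature (ps c) (v c)" for c
  define B where "B = {s. set s \<subseteq> A \<and> length s \<le> 7}"
  have B: "finite B" "card B = (\<Sum>i\<le>7. card A ^ i)"
    using finite_lists_length_le[OF A(1)] card_lists_length_le[OF A(1)] by (auto simp: B_def)
  have inj: "inj_on sg X"
  proof (rule inj_onI)
    fix c d assume cd: "c \<in> X" "d \<in> X" "sg c = sg d"
    note c = pv[OF cd(1), unfolded good_def] and d = pv[OF cd(2), unfolded good_def]
    have "v c = v d" using last_signature[of "ps c" "v c"] last_signature[of "ps d" "v d"] c d cd(3)
      by (simp add: sg_def)
    then have "chi (map snd (concat (ps c))) = chi (map snd (concat (ps d)))"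
      using c d cd(3) by (intro signature_unique[OF short', where v = "v c"]) (auto simp: sg_def)
    then show "c = d" using c d by simp
  qed
  have sub: "sg ` X \<subseteq> B"
  proof clarify
    fix c assume "c \<in> X"
    note c = pv[OF this, unfolded good_def]
    then have "\<forall>p\<in>set (ps c). p \<noteq> []" by (auto simp: small_piece_def)
    then show "sg c \<in> B" using c signature_arcs[of H "ps c" "v c"] by (auto simp: B_def A_def sg_def length_signature)
  qed
  have "finite X" "card X \<le> card B"
    using inj_on_finite[OF inj sub B(1)] card_inj_on_le[OF inj sub B(1)] by auto
  moreover have "(\<Sum>i\<le>7. card A ^ i) \<le> (\<Sum>i\<le>7. (4 * card (mg_edges H)) ^ i)"
    using A(2) by (intro sum_mono power_mono) auto
  ultimately show "finite X" "card X \<le> (\<Sum>i\<le>7. (4 * card (mg_edges H)) ^ i)"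
    using B(2) by linarith+
qed

section \<open>Separating weight functions\<close>

lemma sum_choose_Suc_diff:
  fixes g :: "nat \<Rightarrow> real"
  shows "(\<Sum>j\<le>Suc m. (-1) ^ j * real (Suc m choose j) * g j) =
    (\<Sum>j\<le>m. (-1) ^ j * real (m choose j) * (g j - g (Suc j)))"
proof -
  have "(\<Sum>j\<le>m. (-1) ^ j * real (m choose j) * g j) = (\<Sum>j\<le>Suc m. (-1) ^ j * real (m choose j) * g j)"
    by simp
  also have "\<dots> = g 0 + (\<Sum>j\<le>m. - ((-1) ^ j * real (m choose Suc j) * g (Suc j)))"
    by (simp only: sum.atMost_Suc_shift) simp
  finally have "(\<Sum>j\<le>m. (-1) ^ j * real (m choose j) * g j) = \<dots>" .
  moreover have "(\<Sum>j\<le>Suc m. (-1) ^ j * real (Suc m choose j) * g j) =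
    g 0 + (\<Sum>j\<le>m. - ((-1) ^ j * real (m choose Suc j) * g (Suc j)) - (-1) ^ j * real (m choose j) * g (Suc j))"
  proof -
    have "(-1) ^ Suc j * real (Suc m choose Suc j) * g (Suc j) =
      - ((-1) ^ j * real (m choose Suc j) * g (Suc j)) - (-1) ^ j * real (m choose j) * g (Suc j)" for j
      by (simp add: algebra_simps)
    then show ?thesis by (simp only: sum.atMost_Suc_shift) simp
  qed
  ultimately show ?thesis by (simp add: sum_subtractf right_diff_distrib)
qed

text \<open>Up to sign, this is the \<open>m\<close>-th finite difference of \<open>1 / x\<close>;
  the induction takes one more difference by Pascal's rule.\<close>

lemma partial_fraction_binomial:
  fixes x :: real
  assumes "0 < x"
  shows "(\<Sum>j\<le>m. (-1) ^ j * real (m choose j) * (1 / (x + real j))) = fact m / (\<Prod>j\<le>m. x + real j)"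
  using assms
proof (induction m arbitrary: x)
  case (Suc m)
  define P where "P = (\<Prod>j\<le>m. x + real j)"
  define Q where "Q = (\<Prod>j\<le>m. x + 1 + real j)"
  have pos: "0 < P" "0 < Q" using Suc.prems by (auto simp: P_def Q_def intro!: prod_pos add_pos_nonneg)
  have PQ: "P * (x + real m + 1) = x * Q"
  proof -
    have "P * (x + real m + 1) = (\<Prod>j\<le>Suc m. x + real j)" by (simp add: P_def add_ac)
    also have "\<dots> = x * Q" by (simp only: prod.atMost_Suc_shift) (simp add: Q_def add_ac)
    finally show ?thesis .
  qed
  have "(\<Sum>j\<le>Suc m. (-1) ^ j * real (Suc m choose j) * (1 / (x + real j))) =
    (\<Sum>j\<le>m. (-1) ^ j * real (m choose j) * (1 / (x + real j))) -
    (\<Sum>j\<le>m. (-1) ^ j * real (m choose j) * (1 / (x + 1 + real j)))"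
    unfolding sum_choose_Suc_diff by (simp add: right_diff_distrib sum_subtractf add_ac)
  also have "\<dots> = fact m / P - fact m / Q"
    using Suc.IH[of x] Suc.IH[of "x + 1"] Suc.prems by (simp add: P_def Q_def)
  also have "\<dots> = fact m * (Q - P) / (P * Q)" using pos by (simp add: field_simps)
  also have "\<dots> = fact (Suc m) / (P * (x + real m + 1))"
  proof -
    have "(Q - P) * (P * (x + real m + 1)) = (real m + 1) * (P * Q)"
    proof -
      have "(Q - P) * (P * (x + real m + 1)) = Q * P * (x + real m + 1) - P * (P * (x + real m + 1))"
        by (simp add: algebra_simps)
      also have "\<dots> = Q * P * (x + real m + 1) - P * (x * Q)" by (simp only: PQ)
      also have "\<dots> = (real m + 1) * (P * Q)" by (simp add: algebra_simps)
      finally show ?thesis .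
    qed
    then have "fact m * (Q - P) * (P * (x + real m + 1)) = fact (Suc m) * (P * Q)"
      by (simp add: mult.assoc) (simp add: algebra_simps)
    moreover have "P * Q \<noteq> 0" "P * (x + real m + 1) \<noteq> 0" using pos Suc.prems by auto
    ultimately show ?thesis using frac_eq_eq by blast
  qed
  also have "P * (x + real m + 1) = (\<Prod>j\<le>Suc m. x + real j)" by (simp add: P_def add_ac)
  finally show ?case .
qed simp

text \<open>Nair's bound on the least common multiple: \<open>a\<close> times the alternating sum
  \<open>\<Sum>j\<le>m. (-1) ^ j * (m choose j) / (m + 1 + j)\<close> is a positive integer.\<close>

lemma common_multiple_ge:
  fixes a :: nat
  assumes "0 < a" and dvd: "\<And>k. 2 \<le> k \<Longrightarrow> k \<le> 2 * m + 1 \<Longrightarrow> k dvd a"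
  shows "2 ^ m \<le> a"
proof -
  define P where "P = (\<Prod>j\<le>m. real (m + 1) + real j)"
  have Ppos: "0 < P" by (auto simp: P_def intro!: prod_pos)
  have id: "(\<Sum>j\<le>m. (-1) ^ j * real (m choose j) * (1 / (real (m + 1) + real j))) = fact m / P"
    unfolding P_def by (rule partial_fraction_binomial) simp
  define z where "z = (\<Sum>j\<le>m. (-1) ^ j * int (m choose j) * int (a div (m + 1 + j)))"
  have "real_of_int z = real a * (fact m / P)"
  proof -
    have "real (a div (m + 1 + j)) = real a * (1 / (real (m + 1) + real j))" if "j \<le> m" for j
    proof -
      have "m + 1 + j dvd a" using that dvd[of "m + 1 + j"] by (cases "m + 1 + j = 1") auto
      then show ?thesis by (simp add: real_of_nat_div)
    qed
    then have "real_of_int z = (\<Sum>j\<le>m. (-1) ^ j * real (m choose j) * (real a * (1 / (real (m + 1) + real j))))"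
      by (simp add: z_def)
    also have "\<dots> = real a * (\<Sum>j\<le>m. (-1) ^ j * real (m choose j) * (1 / (real (m + 1) + real j)))"
      unfolding sum_distrib_left by (intro sum.cong) auto
    finally show ?thesis using id by simp
  qed
  moreover have "0 < real a * (fact m / P)" using assms(1) Ppos by simp
  \<comment> \<open>A positive integer is at least 1, so \<open>a\<close> is at least
    \<open>P / fact m\<close>.\<close>
  ultimately have "1 \<le> real a * (fact m / P)" by (metis of_int_0_less_iff of_int_1_le_iff int_one_le_iff_zero_less)
  then have *: "P \<le> real a * fact m" using Ppos by (simp add: pos_le_divide_eq)
  \<comment> \<open>It remains to bound \<open>P / fact m\<close> from below by
    \<open>2 ^ m\<close>. Without its factor for \<open>j = 0\<close>, the product \<open>P\<close>
    dominates \<open>2 ^ m * fact m\<close> factor by factor.\<close>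
  have "2 ^ m * (fact m :: real) = (\<Prod>j<m. 2 * real (Suc j))"
    by (induction m) (auto simp: algebra_simps)
  also have "\<dots> \<le> (\<Prod>j<m. real (m + 1) + real (Suc j))"
    by (intro prod_mono) auto
  also have "\<dots> \<le> real (m + 1) * (\<Prod>j<m. real (m + 1) + real (Suc j))"
  proof -
    have "0 \<le> (\<Prod>j<m. real (m + 1) + real (Suc j))" by (intro prod_nonneg) auto
    then show ?thesis by (simp add: distrib_right)
  qed
  also have "\<dots> = P" unfolding P_def prod.atMost_shift by simp
  finally have "2 ^ m * (fact m :: real) \<le> real a * fact m" using * by linarith
  then have "2 ^ m \<le> real a" by simp
  then show ?thesis by (metis of_nat_le_iff of_nat_numeral of_nat_power)
qed

section \<open>Digit expansions and the choice of a modulus\<close>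

lemma abs_digit_sum_less:
  fixes c :: "nat \<Rightarrow> int" and B :: int
  assumes "1 < B" "\<And>j. \<bar>c j\<bar> \<le> B - 1"
  shows "\<bar>\<Sum>j<M. B ^ j * c j\<bar> < B ^ M"
proof (induction M)
  case (Suc M)
  have "\<bar>B ^ M * c M\<bar> \<le> B ^ M * (B - 1)" using assms by (simp add: abs_mult mult_left_mono)
  then show ?case using Suc by (simp add: algebra_simps)
qed simp

text \<open>The leading nonzero digit outweighs all lower ones.\<close>

lemma digit_sum_nonzero:
  fixes c :: "nat \<Rightarrow> int" and B :: int
  assumes "1 < B" "\<And>j. \<bar>c j\<bar> \<le> B - 1" "\<exists>j<M. c j \<noteq> 0"
  shows "(\<Sum>j<M. B ^ j * c j) \<noteq> 0"
  using assms(3)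
proof (induction M)
  case (Suc M)
  show ?case
  proof (cases "c M = 0")
    case True
    then have "\<exists>j<M. c j \<noteq> 0" using Suc.prems less_Suc_eq by auto
    then show ?thesis using Suc.IH True by simp
  next
    case False
    have "B ^ M * 1 \<le> B ^ M * \<bar>c M\<bar>" using False assms(1) by (intro mult_left_mono) auto
    then have "B ^ M \<le> \<bar>B ^ M * c M\<bar>" using assms(1) by (simp add: abs_mult)
    then show ?thesis using abs_digit_sum_less[where c = c and M = M, OF assms(1,2)] by simp
  qed
qed simp

lemma sum_digits_bij:
  fixes y :: "'b \<Rightarrow> int"
  assumes "bij_betw num E {1..M}"
  shows "(\<Sum>e\<in>E. B ^ num e * y e) =
    (\<Sum>j<Suc M. B ^ j * (if j = 0 then 0 else y (the_inv_into E num j)))"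
proof -
  have inj: "inj_on num E" and im: "num ` E = {1..M}" using assms by (auto simp: bij_betw_def)
  have "(\<Sum>j<Suc M. B ^ j * (if j = 0 then 0 else y (the_inv_into E num j))) =
    (\<Sum>j\<in>num ` E. B ^ j * (if j = 0 then 0 else y (the_inv_into E num j)))"
    unfolding im by (rule sum.mono_neutral_right) auto
  also have "\<dots> = (\<Sum>e\<in>E. B ^ num e * y e)"
    unfolding sum.reindex[OF inj]
  proof (intro sum.cong refl)
    fix e assume e: "e \<in> E"
    then have "num e \<in> {1..M}" using im by blast
    then show "((\<lambda>j. B ^ j * (if j = 0 then 0 else y (the_inv_into E num j))) \<circ> num) e = B ^ num e * y e"
      using e by (simp add: the_inv_into_f_f[OF inj])
  qed
  finally show ?thesis by simp
qed

lemma four_square_less_power: "9 \<le> n \<Longrightarrow> 4 * n\<^sup>2 + 1 \<le> (2::nat) ^ n"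
proof (induction n rule: dec_induct)
  case (step n)
  have "3 * n \<le> n * n" using step(1) by (intro mult_right_mono) auto
  then have "8 * n + 3 \<le> 4 * (n * n)" using step(1) by linarith
  then have "4 * (Suc n)\<^sup>2 + 1 \<le> 2 * (4 * n\<^sup>2 + 1)"
    by (simp add: power2_eq_square algebra_simps)
  then show ?case using step(3) by simp
qed simp

text \<open>The entries of \<open>y\<close> are digits of \<open>f y\<close> in base
  \<open>4 * n ^ 2 + 1\<close>, so \<open>f y\<close> is nonzero and less than the base to the power
  \<open>card E + 1\<close>. If no modulus worked, every \<open>k\<close> from 2 to
  \<open>n ^ 20\<close> would divide some \<open>f y\<close> and hence the product \<open>a\<close>
  of all of them. Then \<open>a\<close> would be at least \<open>2 ^ m\<close> with \<open>m\<close>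
  about half of \<open>n ^ 20\<close>. As the base is at most \<open>2 ^ n\<close>, however,
  \<open>a\<close> is at most \<open>2 ^ (n ^ 19 + n ^ 17)\<close>.\<close>

theorem ex_separating_weight:
  fixes num :: "'a set \<Rightarrow> nat" and Y :: "('a set \<Rightarrow> int) set"
  assumes num: "bij_betw num E {1..card E}" and E: "card E \<le> n\<^sup>2" and n: "9 \<le> n"
    and Y: "finite Y" "card Y \<le> n ^ 16"
    and nz: "\<And>y. y \<in> Y \<Longrightarrow> \<exists>e\<in>E. y e \<noteq> 0"
    and bd: "\<And>y e. y \<in> Y \<Longrightarrow> e \<in> E \<Longrightarrow> \<bar>y e\<bar> \<le> 4 * int n ^ 2"
  shows "\<exists>w\<in>weights n num. \<forall>y\<in>Y. (\<Sum>e\<in>E. w e * y e) \<noteq> 0"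
proof (rule ccontr)
  assume no: "\<not> ?thesis"
  then have no': "\<exists>y\<in>Y. (\<Sum>e\<in>E. w e * y e) = 0" if "w \<in> weights n num" for w using that by blast
  define B where "B = 4 * int n ^ 2 + 1"
  define M where "M = card E"
  define f where "f y = (\<Sum>e\<in>E. B ^ num e * y e)" for y :: "'a set \<Rightarrow> int"
  have inj: "inj_on num E" and im: "num ` E = {1..M}" using num by (auto simp: bij_betw_def M_def)
  have B1: "1 < B" using n by (simp add: B_def)
  have fy: "f y \<noteq> 0 \<and> \<bar>f y\<bar> < B ^ Suc M" if y: "y \<in> Y" for y
  proof -
    define c where "c j = (if j \<in> {1..M} then y (the_inv_into E num j) else 0)" for j
    have inE: "the_inv_into E num j \<in> E" if "j \<in> {1..M}" for j
      using the_inv_into_into[OF inj, of j E] that im by auto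
    have f: "f y = (\<Sum>j<Suc M. B ^ j * c j)"
      unfolding f_def sum_digits_bij[OF num[folded M_def]] by (intro sum.cong) (auto simp: c_def)
    have cb: "\<bar>c j\<bar> \<le> B - 1" for j
      using bd[OF y inE, of j] by (auto simp: c_def B_def)
    obtain e where e: "e \<in> E" "y e \<noteq> 0" using nz[OF y] by auto
    then have "num e \<in> {1..M}" using im by auto
    then have "\<exists>j<Suc M. c j \<noteq> 0" using e by (intro exI[of _ "num e"]) (auto simp: c_def the_inv_into_f_f[OF inj])
    from digit_sum_nonzero[where c = c, OF B1 cb this] abs_digit_sum_less[where c = c and M = "Suc M", OF B1 cb]
    show ?thesis unfolding f by (rule conjI)
  qed
  have div: "\<exists>y\<in>Y. int k dvd f y" if k: "2 \<le> k" "k \<le> n ^ 20" for k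
  proof -
    let ?w = "\<lambda>e. int ((4 * n\<^sup>2 + 1) ^ num e mod k)"
    have "?w \<in> weights n num" unfolding weights_def weights_upto_def using k by (intro image_eqI[of _ _ k]) auto
    from no'[OF this] obtain y where y: "y \<in> Y" "(\<Sum>e\<in>E. ?w e * y e) = 0" by (rule bexE)
    have "f y mod int k = (\<Sum>e\<in>E. B ^ num e * y e mod int k) mod int k"
      unfolding f_def by (simp add: mod_sum_eq)
    also have "\<dots> = (\<Sum>e\<in>E. ?w e * y e mod int k) mod int k"
    proof -
      have "B ^ num e * y e mod int k = ?w e * y e mod int k" for e
      proof -
        have "B ^ num e = int ((4 * n\<^sup>2 + 1) ^ num e)" by (simp add: B_def add.commute)
        then show ?thesis by (simp only: zmod_int mod_mult_left_eq)
      qed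
      then show ?thesis by simp
    qed
    also have "\<dots> = (\<Sum>e\<in>E. ?w e * y e) mod int k" by (rule mod_sum_eq)
    also have "\<dots> = 0" using y by simp
    finally show ?thesis using y by auto
  qed
  define a where "a = (\<Prod>y\<in>Y. nat \<bar>f y\<bar>)"
  have a0: "0 < a" using fy by (auto simp: a_def intro!: prod_pos)
  have dvda: "k dvd a" if "2 \<le> k" "k \<le> n ^ 20" for k
  proof -
    obtain y where y: "y \<in> Y" "int k dvd f y" using div \<open>2 \<le> k\<close> \<open>k \<le> n ^ 20\<close> by blast
    then have "k dvd nat \<bar>f y\<bar>" by (simp flip: int_dvd_int_iff)
    then show ?thesis unfolding a_def using Y y by (meson dvd_prodI dvd_trans)
  qed
  define m where "m = (n ^ 20 - 1) div 2"
  have "1 \<le> n ^ 20" using n by simp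
  then have m: "2 * m + 1 \<le> n ^ 20" unfolding m_def by linarith
  have "2 ^ m \<le> a" using dvda m by (intro common_multiple_ge[OF a0]) auto
  also have "a \<le> (\<Prod>y\<in>Y. nat (B ^ Suc M))"
    unfolding a_def
  proof (intro prod_mono conjI)
    fix y assume "y \<in> Y"
    then show "nat \<bar>f y\<bar> \<le> nat (B ^ Suc M)" using fy by (intro nat_mono less_imp_le) blast
  qed simp
  also have "\<dots> = nat (B ^ Suc M) ^ card Y" by simp
  also have "nat (B ^ Suc M) = (4 * n\<^sup>2 + 1) ^ Suc M"
  proof -
    have "B = int (4 * n\<^sup>2 + 1)" by (simp add: B_def)
    then have "B ^ Suc M = int ((4 * n\<^sup>2 + 1) ^ Suc M)" by (simp only: of_nat_power)
    then show ?thesis by (simp only: nat_int)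
  qed
  also have "((4 * n\<^sup>2 + 1) ^ Suc M) ^ card Y \<le> ((2 ^ n) ^ Suc M) ^ card Y"
    using four_square_less_power[OF n] by (intro power_mono) auto
  also have "\<dots> = 2 ^ (n * Suc M * card Y)" by (simp only: power_mult)
  also have "\<dots> \<le> 2 ^ (n * (n ^ 2 + 1) * n ^ 16)"
    using E Y(2) by (intro power_increasing mult_mono) (auto simp: M_def)
  finally have "m \<le> n * (n ^ 2 + 1) * n ^ 16" by simp
  moreover have "n * (n ^ 2 + 1) * n ^ 16 = n ^ 19 + n ^ 17"
    by (simp add: algebra_simps power_add[symmetric] flip: power_Suc)
  moreover have "n ^ 17 \<le> n ^ 19" using n by (intro power_increasing) auto
  moreover have "9 * n ^ 19 \<le> n ^ 20" 
  proof -
    have "n ^ 20 = n * n ^ 19" using power_Suc[of n 19] by simp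
    then show ?thesis using n by simp
  qed
  moreover have "1 \<le> n ^ 19" using n by simp
  ultimately show False unfolding m_def by linarith
qed

section \<open>Faces of the perfect matching polytope\<close>

definition inner_on :: "'b set \<Rightarrow> ('b \<Rightarrow> real) \<Rightarrow> ('b \<Rightarrow> real) \<Rightarrow> real" where
  "inner_on E w x = (\<Sum>e\<in>E. w e * x e)"

definition face_dir :: "'a set \<Rightarrow> 'a set set \<Rightarrow> ('a set \<Rightarrow> real) set \<Rightarrow> ('a set \<Rightarrow> real) set" where
  "face_dir V E F = {y. (\<forall>e. e \<notin> face_supp E F \<longrightarrow> y e = 0) \<and> (\<forall>S\<in>face_tight V E F. sum y (cut E S) = 0)}"

definition swap_on :: "'a set \<Rightarrow> 'a set set \<Rightarrow> 'a set set \<Rightarrow> 'a set set" where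
  "swap_on D N1 N2 = {g \<in> N1. g \<inter> D = {}} \<union> {g \<in> N2. g \<inter> D \<noteq> {}}"

lemma cut_mcut: "cut E S = mcut E (\<lambda>e. e) S"
  by (simp add: cut_def mcut_def)

lemma inner_on_simps:
  "inner_on E w (\<lambda>e. x e + y e) = inner_on E w x + inner_on E w y"
  "inner_on E w (\<lambda>e. x e - y e) = inner_on E w x - inner_on E w y"
  "inner_on E w (\<lambda>e. c * x e) = c * inner_on E w x"
  "inner_on E w (\<lambda>e. - x e) = - inner_on E w x"
  by (simp_all add: inner_on_def sum.distrib sum_subtractf sum_distrib_left sum_negf algebra_simps)

lemma face_Min_iff: "x \<in> face_Min E F w \<longleftrightarrow> x \<in> F \<and> (\<forall>z\<in>F. inner_on E w x \<le> inner_on E w z)"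
  by (auto simp: face_Min_def is_arg_min_def inner_on_def not_less)

lemma face_Min_subset: "face_Min E F w \<subseteq> F"
  by (auto simp: face_Min_iff)

lemma face_supp_mono: "F' \<subseteq> F \<Longrightarrow> face_supp E F' \<subseteq> face_supp E F"
  by (auto simp: face_supp_def)

lemma face_tight_mono: "F' \<subseteq> F \<Longrightarrow> face_tight V E F \<subseteq> face_tight V E F'"
  by (auto simp: face_tight_def)

lemma matchings_mono: "F' \<subseteq> F \<Longrightarrow> matchings_in_face V E F' \<subseteq> matchings_in_face V E F"
  by (auto simp: matchings_in_face_def)

text \<open>The midpoint of two points keeps positive every functional that is positive at one of
  them, so the finitely many functionals can be treated one after another. The result is a point of
  the relative interior.\<close>

lemma ex_common_positive:
  fixes \<phi> :: "'i \<Rightarrow> ('b \<Rightarrow> real) \<Rightarrow> real"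
  assumes "finite I" "F \<noteq> {}"
    and mid: "\<And>x y. x \<in> F \<Longrightarrow> y \<in> F \<Longrightarrow> (\<lambda>e. (x e + y e) / 2) \<in> F"
    and \<phi>: "\<And>i x y. \<phi> i (\<lambda>e. (x e + y e) / 2) = (\<phi> i x + \<phi> i y) / 2"
    and nn: "\<And>i x. i \<in> I \<Longrightarrow> x \<in> F \<Longrightarrow> 0 \<le> \<phi> i x"
  shows "\<exists>z\<in>F. \<forall>i\<in>I. (\<exists>x\<in>F. 0 < \<phi> i x) \<longrightarrow> 0 < \<phi> i z"
  using assms(1,5)
proof (induction I rule: finite_induct)
  case empty
  then show ?case using assms(2) by blast
next
  case (insert i I)
  then obtain z where z: "z \<in> F" "\<forall>i\<in>I. (\<exists>x\<in>F. 0 < \<phi> i x) \<longrightarrow> 0 < \<phi> i z" by auto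
  show ?case
  proof (cases "\<exists>x\<in>F. 0 < \<phi> i x")
    case False
    then show ?thesis using z by blast
  next
    case True
    then obtain x where x: "x \<in> F" "0 < \<phi> i x" by blast
    show ?thesis
    proof (intro bexI[of _ "\<lambda>e. (x e + z e) / 2"] ballI impI)
      fix j assume j: "j \<in> insert i I" "\<exists>x\<in>F. 0 < \<phi> j x"
      have "0 \<le> \<phi> j x" "0 \<le> \<phi> j z" using insert.prems j x z by auto
      then show "0 < \<phi> j (\<lambda>e. (x e + z e) / 2)" unfolding \<phi> using j x z by (cases "j = i") auto
    qed (use mid x z in blast)
  qed
qed

lemma ex_small_step:
  fixes a b :: "'i \<Rightarrow> real"
  assumes "finite I" "\<And>i. i \<in> I \<Longrightarrow> 0 < a i"
  shows "\<exists>t>0. \<forall>i\<in>I. 0 \<le> a i + t * b i"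
  using assms
proof (induction I rule: finite_induct)
  case empty
  then show ?case by (intro exI[of _ 1]) auto
next
  case (insert i I)
  then obtain t where t: "0 < t" "\<forall>i\<in>I. 0 \<le> a i + t * b i" by auto
  have ai: "0 < a i" using insert by auto
  define s where "s = min t (a i / (\<bar>b i\<bar> + 1))"
  have s: "0 < s" "s \<le> t" using t ai by (auto simp: s_def)
  have "s * (\<bar>b i\<bar> + 1) \<le> a i"
  proof -
    have "s \<le> a i / (\<bar>b i\<bar> + 1)" by (simp add: s_def)
    then show ?thesis by (subst (asm) pos_le_divide_eq) auto
  qed
  moreover have "s * - b i \<le> s * (\<bar>b i\<bar> + 1)" using s by (intro mult_left_mono) auto
  ultimately have "0 \<le> a i + s * b i" by simp
  moreover have "0 \<le> a j + s * b j" if "j \<in> I" for j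
  proof (cases "0 \<le> b j")
    case True
    then show ?thesis using s insert.prems[of j] that by (simp add: less_imp_le)
  next
    case False
    then have "t * b j \<le> s * b j" using s by (intro mult_right_mono_neg) auto
    then show ?thesis using t that by force
  qed
  ultimately show ?case using s by (intro exI[of _ s]) auto
qed

section \<open>Faces and their perfect matchings\<close>

locale sgraph =
  fixes V :: "'a set" and E :: "'a set set"
  assumes sg: "simple_graph V E"
begin

abbreviation PM where "PM \<equiv> matchings_in_face V E"
abbreviation tight where "tight \<equiv> face_tight V E"
abbreviation supp where "supp \<equiv> face_supp E"

lemma fin: "finite V" "finite E" "\<And>e. e \<in> E \<Longrightarrow> e \<subseteq> V" "\<And>e. e \<in> E \<Longrightarrow> card e = 2"
proof -
  show "finite V" "\<And>e. e \<in> E \<Longrightarrow> e \<subseteq> V" "\<And>e. e \<in> E \<Longrightarrow> card e = 2"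
    using sg by (auto simp: simple_graph_def)
  have "E \<subseteq> Pow V" using sg by (auto simp: simple_graph_def)
  then show "finite E" using \<open>finite V\<close> finite_subset by blast
qed

lemma mg: "multigraph V E (\<lambda>e. e)"
  using fin by (auto simp: multigraph_def)

lemma finite_cut [simp]: "finite (cut E S)"
  using fin by (simp add: cut_def)

lemma finite_odd_sets [simp]: "finite (odd_sets V)"
  using fin by (simp add: odd_sets_def)

lemma polytope_iff: "x \<in> pm_polytope V E \<longleftrightarrow> (\<forall>e. e \<notin> E \<longrightarrow> x e = 0) \<and> frac_pm V E (\<lambda>e. e) x"
  by (auto simp: pm_polytope_def frac_pm_def cut_mcut odd_sets_def)

lemma cut_singleton: "g \<in> E \<Longrightarrow> g \<in> cut E {v} \<longleftrightarrow> v \<in> g"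
  using mem_mcut_singleton[OF mg] by (simp add: cut_mcut)

lemma mem_cut: "g \<in> E \<Longrightarrow> g \<in> cut E S \<longleftrightarrow> g \<inter> S \<noteq> {} \<and> \<not> g \<subseteq> S"
proof -
  assume g: "g \<in> E"
  from fin(4)[OF g] obtain a b where ab: "g = {a, b}" "a \<noteq> b" by (rule card_eq_2E)
  show ?thesis using g ab(2) unfolding cut_def mem_Collect_eq ab(1) card_pair_Int[OF ab(2)] by auto
qed

lemma sum_indicator_cut: "sum (indicator N) (cut E S) = real (card (N \<inter> cut E S))"
  unfolding cut_mcut using card_Int_mcut[OF fin(2), of N "\<lambda>e. e" S] by simp

lemma pm_subset: "perfect_matching V E N \<Longrightarrow> N \<subseteq> E"
  by (simp add: perfect_matching_def)

lemma pm_card_vertex: "N \<subseteq> E \<Longrightarrow> perfect_matching V E N \<longleftrightarrow> (\<forall>v\<in>V. card (N \<inter> cut E {v}) = 1)"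
proof -
  assume N: "N \<subseteq> E"
  have "N \<inter> cut E {v} = {e \<in> N. v \<in> e}" for v using N cut_singleton by blast
  moreover have "(\<exists>!e. e \<in> N \<and> v \<in> e) \<longleftrightarrow> card {e \<in> N. v \<in> e} = 1" for v
    unfolding card_1_singleton_iff One_nat_def Ex1_def by blast
  ultimately show ?thesis using N by (simp add: perfect_matching_def)
qed

text \<open>The degree sum over an odd set \<open>S\<close> is odd, and edges inside
  \<open>S\<close> contribute 2 each, so an odd number of matching edges leaves
  \<open>S\<close>.\<close>

lemma pm_in_polytope:
  assumes N: "perfect_matching V E N"
  shows "indicator N \<in> pm_polytope V E"
proof -
  note NE = pm_subset[OF N]
  have v: "sum (indicator N) (cut E {v}) = (1::real)" if "v \<in> V" for v
    using that N pm_card_vertex[OF NE] by (simp add: sum_indicator_cut)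
  have S: "1 \<le> (sum (indicator N) (cut E S) :: real)" if S: "S \<in> odd_sets V" for S
  proof -
    have S': "S \<subseteq> V" "odd (card S)" "finite S" using S fin(1) finite_subset by (auto simp: odd_sets_def)
    have "(\<Sum>v\<in>S. sum (indicator N) (cut E {v})) = (real (card S))"
      using v S' by (simp add: subset_iff)
    moreover have "(\<Sum>v\<in>S. sum (indicator N) (cut E {v})) =
       (sum (indicator N) (cut E S) + 2 * sum (indicator N) {e\<in>E. e \<subseteq> S} :: real)"
      unfolding cut_mcut using fin S' by (intro sum_degrees) auto
    moreover have "sum (indicator N) {e\<in>E. e \<subseteq> S} = real (card (N \<inter> {e\<in>E. e \<subseteq> S}))"
      using fin by (simp add: indicator_def of_bool_def sum.If_cases Int_commute)
    ultimately have "real (card S) = real (card (N \<inter> cut E S) + 2 * card (N \<inter> {e\<in>E. e \<subseteq> S}))"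
      by (simp add: sum_indicator_cut)
    then have "card S = card (N \<inter> cut E S) + 2 * card (N \<inter> {e\<in>E. e \<subseteq> S})" by (simp only: of_nat_eq_iff)
    then have "card (N \<inter> cut E S) \<noteq> 0" using S'(2) by auto
    then have "1 \<le> card (N \<inter> cut E S)" by linarith
    then show ?thesis unfolding sum_indicator_cut by simp
  qed
  show ?thesis using v S NE by (auto simp: pm_polytope_def indicator_def)
qed

lemma face_polytope: "pm_face V E F \<Longrightarrow> F \<subseteq> pm_polytope V E"
  by (auto simp: pm_face_def)

lemma PM_D: "N \<in> PM F \<Longrightarrow> perfect_matching V E N" "N \<in> PM F \<Longrightarrow> indicator N \<in> F" "N \<in> PM F \<Longrightarrow> N \<subseteq> E"
  by (auto simp: matchings_in_face_def perfect_matching_def)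

lemma finite_PM: "finite (PM F)"
proof -
  have "PM F \<subseteq> Pow E" by (auto simp: matchings_in_face_def perfect_matching_def)
  then show ?thesis using fin(2) finite_subset by blast
qed

text \<open>Imposing every equation that already holds on \<open>F\<close> does not shrink
  \<open>F\<close>. Faces can therefore be compared through \<open>tight\<close> and
  \<open>supp\<close>, without reference to the equations they were defined by.\<close>

lemma face_canonical:
  assumes "pm_face V E F"
  shows "x \<in> F \<longleftrightarrow> x \<in> pm_polytope V E \<and> (\<forall>S\<in>tight F. sum x (cut E S) = 1) \<and> (\<forall>e\<in>E - supp F. x e = 0)"
proof -
  obtain A B where AB: "A \<subseteq> odd_sets V" "B \<subseteq> E"
    "F = {x \<in> pm_polytope V E. (\<forall>S\<in>A. sum x (cut E S) = 1) \<and> (\<forall>e\<in>B. x e = 0)}"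
    using assms by (auto simp: pm_face_def)
  have A: "A \<subseteq> tight F" using AB by (auto simp: face_tight_def)
  have B: "B \<subseteq> E - supp F" using AB by (auto simp: face_supp_def)
  have z: "x e = 0" if "x \<in> F" "e \<in> E - supp F" for e
  proof -
    have "0 \<le> x e" using that AB(3) by (auto simp: pm_polytope_def)
    then show ?thesis using that by (force simp: face_supp_def)
  qed
  show ?thesis
  proof
    assume x: "x \<in> F"
    then have "x \<in> pm_polytope V E" using AB(3) by blast
    moreover have "\<forall>S\<in>tight F. sum x (cut E S) = 1" using x by (simp add: face_tight_def)
    ultimately show "x \<in> pm_polytope V E \<and> (\<forall>S\<in>tight F. sum x (cut E S) = 1) \<and> (\<forall>e\<in>E - supp F. x e = 0)"
      using z[OF x] by blast
  next
    assume "x \<in> pm_polytope V E \<and> (\<forall>S\<in>tight F. sum x (cut E S) = 1) \<and> (\<forall>e\<in>E - supp F. x e = 0)"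
    then have "x \<in> {x \<in> pm_polytope V E. (\<forall>S\<in>A. sum x (cut E S) = 1) \<and> (\<forall>e\<in>B. x e = 0)}"
      using A B by blast
    then show "x \<in> F" using AB(3) by blast
  qed
qed

lemma conform_in_face:
  assumes F: "pm_face V E F" and x: "x \<in> F" and N: "conform V E (\<lambda>e. e) x N"
  shows "N \<in> PM F"
proof -
  have xp: "frac_pm V E (\<lambda>e. e) x" using x face_polytope[OF F] by (auto simp: polytope_iff)
  have NE: "N \<subseteq> E" using N by (auto simp: conform_def)
  have c1: "card (N \<inter> cut E S) = 1" if "S \<in> odd_sets V" "sum x (cut E S) = 1" for S
    using N that by (auto simp: conform_def cut_mcut odd_sets_def)
  have "card (N \<inter> cut E {v}) = 1" if "v \<in> V" for v
    using that xp by (intro c1) (auto simp: odd_sets_def cut_mcut frac_pm_def)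
  then have pm: "perfect_matching V E N" using pm_card_vertex[OF NE] by simp
  have "indicator N \<in> F"
    unfolding face_canonical[OF F]
  proof (intro conjI ballI)
    fix S assume "S \<in> tight F"
    then show "sum (indicator N) (cut E S) = (1::real)"
      using c1[of S] x by (auto simp: face_tight_def sum_indicator_cut)
  next
    fix e assume "e \<in> E - supp F"
    then have "e \<notin> N" using x N by (auto simp: face_supp_def conform_def)
    then show "indicator N e = (0::real)" by simp
  qed (rule pm_in_polytope[OF pm])
  then show ?thesis using pm by (simp add: matchings_in_face_def)
qed

lemma ex_matching_edge:
  assumes F: "pm_face V E F" and e: "e \<in> supp F"
  shows "\<exists>N\<in>PM F. e \<in> N"
proof -
  obtain x where x: "x \<in> F" "e \<in> E" "0 < x e" using e by (auto simp: face_supp_def)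
  have "frac_pm V E (\<lambda>e. e) x" using x face_polytope[OF F] by (auto simp: polytope_iff)
  from edmonds[OF mg this x(2,3)] show ?thesis using conform_in_face[OF F x(1)] by blast
qed

lemma matching_in_supp: "N \<in> PM F \<Longrightarrow> N \<subseteq> supp F"
proof
  fix e assume "N \<in> PM F" "e \<in> N"
  then show "e \<in> supp F" using PM_D[of N F] by (auto simp: face_supp_def intro!: bexI[of _ "indicator N"])
qed

lemma edge_at_vertex:
  assumes "x \<in> pm_polytope V E" "v \<in> V"
  shows "\<exists>e\<in>E. v \<in> e \<and> 0 < x e"
proof -
  have "sum x (cut E {v}) = 1" using assms by (auto simp: pm_polytope_def)
  then have "\<exists>e\<in>cut E {v}. 0 < x e" by (metis not_le sum_nonpos zero_less_one)
  then show ?thesis using cut_singleton by (auto simp: cut_def)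
qed

text \<open>Both vectors have degree 1 at every vertex, so their nonnegative difference
  vanishes.\<close>

lemma dominating_pm_eq:
  assumes x: "x \<in> pm_polytope V E" and N: "perfect_matching V E N"
    and ge: "\<And>e. e \<in> E \<Longrightarrow> indicator N e \<le> x e" and e: "e \<in> E"
  shows "x e = indicator N e"
proof -
  obtain v where v: "v \<in> e" using fin(4)[OF e] by fastforce
  then have vV: "v \<in> V" using fin e by auto
  have "(\<Sum>g\<in>cut E {v}. x g - indicator N g) = 0"
    using x vV pm_in_polytope[OF N] by (simp add: sum_subtractf pm_polytope_def)
  then have "\<forall>g\<in>cut E {v}. x g - indicator N g = 0"
    using ge by (subst (asm) sum_nonneg_eq_0_iff) (auto simp: cut_def fin)
  moreover have "e \<in> cut E {v}" using cut_singleton[OF e] v by simp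
  ultimately show ?thesis by auto
qed

text \<open>If the matching \<open>N\<close> in the smallest face of \<open>x\<close> is heavier than \<open>x\<close>, moving from \<open>x\<close> away from
  \<open>N\<close> decreases the weight until a new constraint becomes tight.\<close>

lemma ex_matching_le:
  assumes F: "pm_face V E F" and V: "V \<noteq> {}" and x: "x \<in> F"
  shows "\<exists>N\<in>PM F. inner_on E w (indicator N) \<le> inner_on E w x"
  using x
\<comment> \<open>The measure counts the slack constraints at \<open>x\<close>: nonvanishing edges
  and odd sets that are not tight.\<close>
proof (induction "card {e\<in>E. x e \<noteq> 0} + card {S\<in>odd_sets V. sum x (cut E S) \<noteq> 1}" arbitrary: x rule: less_induct)
  case (less x)
  note x = less.prems
  have xP: "x \<in> pm_polytope V E" using x face_polytope[OF F] by auto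
  obtain v where "v \<in> V" using V by auto
  then obtain e where e: "e \<in> E" "0 < x e" using edge_at_vertex[OF xP] by blast
  have xf: "frac_pm V E (\<lambda>e. e) x" using xP by (simp add: polytope_iff)
  obtain N where N: "conform V E (\<lambda>e. e) x N" using edmonds[OF mg xf e] by blast
  have NF: "N \<in> PM F" by (rule conform_in_face[OF F x N])
  note NP = PM_D(1)[OF NF]
  show ?case
  proof (cases "inner_on E w (indicator N) \<le> inner_on E w x")
    case True
    then show ?thesis using NF by blast
  next
    case False
    have N0: "indicator N e = (0::real)" if "x e = 0" for e using N that by (auto simp: conform_def indicator_def)
    have N1: "sum (indicator N) (cut E S) = (1::real)" if "S \<in> odd_sets V" "sum x (cut E S) = 1" for S
    proof -
      have "card (N \<inter> cut E S) = 1" using N that by (simp add: conform_def odd_sets_def cut_mcut)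
      then show ?thesis by (simp add: sum_indicator_cut)
    qed
    define d where "d e = x e - indicator N e" for e
    define I where "I = Inl ` E \<union> Inr ` odd_sets V"
    define a where "a = case_sum x (\<lambda>S. sum x (cut E S) - 1)"
    define b where "b = case_sum d (\<lambda>S. sum d (cut E S))"
    have ds: "sum d A = sum x A - sum (indicator N) A" for A by (simp add: d_def sum_subtractf)
    \<comment> \<open>If no slack decreased, \<open>x\<close> would dominate the matching and so
      equal it, against the strict inequality of the weights.\<close>
    have "\<exists>i\<in>I. b i < 0"
    proof (rule ccontr)
      assume no: "\<not> ?thesis"
      have "indicator N e \<le> x e" if "e \<in> E" for e
      proof -
        have "Inl e \<in> I" using that by (simp add: I_def)
        then show ?thesis using no by (force simp: b_def d_def)
      qed
      then have "\<forall>e\<in>E. x e = indicator N e" using dominating_pm_eq[OF xP NP] by blast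
      then have "inner_on E w x = inner_on E w (indicator N)" by (simp add: inner_on_def)
      then show False using False by simp
    qed
    moreover have "finite I" using fin by (simp add: I_def)
    moreover have "0 \<le> a i" if "i \<in> I" for i
      using that xP by (auto simp: I_def a_def pm_polytope_def)
    moreover have "0 \<le> b i" if i: "i \<in> I" "a i = 0" for i
    proof (cases i)
      case (Inl f)
      then show ?thesis using i N0[of f] by (auto simp: a_def b_def d_def)
    next
      case (Inr S)
      then have "S \<in> odd_sets V" "sum x (cut E S) = 1" using i by (auto simp: I_def a_def)
      then show ?thesis using N1[of S] Inr by (simp add: b_def ds)
    qed
    ultimately obtain t where t: "0 < t" "\<And>i. i \<in> I \<Longrightarrow> 0 \<le> a i + t * b i" "\<exists>i\<in>I. 0 < a i \<and> a i + t * b i = 0"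
      using maximal_step[of I a b] by blast
    define x' where "x' e = x e + t * d e" for e
    have x's: "sum x' A = sum x A + t * sum d A" for A
      by (simp add: x'_def sum.distrib sum_distrib_left)
    have tight': "sum x' (cut E S) = 1" if "S \<in> odd_sets V" "sum x (cut E S) = 1" for S
      using that N1[OF that] by (simp add: x's ds)
    have zero': "x' e = 0" if "x e = 0" for e using that N0[OF that] by (simp add: x'_def d_def)
    have "0 \<le> x' e" if "e \<in> E" for e
      using t(2)[of "Inl e"] that by (auto simp: I_def a_def b_def x'_def)
    moreover have "1 \<le> sum x' (cut E S)" if "S \<in> odd_sets V" for S
      using t(2)[of "Inr S"] that by (auto simp: I_def a_def b_def x's)
    moreover have "sum x' (cut E {v}) = 1" if "v \<in> V" for v
      using that xP by (intro tight') (auto simp: odd_sets_def pm_polytope_def)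
    ultimately have x'P: "x' \<in> pm_polytope V E" using xP zero' by (auto simp: pm_polytope_def)
    have xc: "\<forall>S\<in>tight F. sum x (cut E S) = 1" "\<forall>e\<in>E - supp F. x e = 0"
      using x face_canonical[OF F] by blast+
    have "tight F \<subseteq> odd_sets V" by (auto simp: face_tight_def)
    then have x'F: "x' \<in> F"
      unfolding face_canonical[OF F] using x'P xc zero' tight' by blast
    obtain i where i: "i \<in> I" "0 < a i" "a i + t * b i = 0" using t(3) by blast
    have s1: "{e\<in>E. x' e \<noteq> 0} \<subseteq> {e\<in>E. x e \<noteq> 0}" using zero' by auto
    have s2: "{S\<in>odd_sets V. sum x' (cut E S) \<noteq> 1} \<subseteq> {S\<in>odd_sets V. sum x (cut E S) \<noteq> 1}" using tight' by auto
    have f1: "finite {e\<in>E. x e \<noteq> 0}" "finite {S\<in>odd_sets V. sum x (cut E S) \<noteq> 1}" using fin by auto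
    have le: "card {e\<in>E. x' e \<noteq> 0} \<le> card {e\<in>E. x e \<noteq> 0}"
      "card {S\<in>odd_sets V. sum x' (cut E S) \<noteq> 1} \<le> card {S\<in>odd_sets V. sum x (cut E S) \<noteq> 1}"
      using card_mono[OF f1(1) s1] card_mono[OF f1(2) s2] by auto
    have "card {e\<in>E. x' e \<noteq> 0} + card {S\<in>odd_sets V. sum x' (cut E S) \<noteq> 1} <
      card {e\<in>E. x e \<noteq> 0} + card {S\<in>odd_sets V. sum x (cut E S) \<noteq> 1}"
    proof (cases i)
      case (Inl f)
      then have "f \<in> {e\<in>E. x e \<noteq> 0}" "f \<notin> {e\<in>E. x' e \<noteq> 0}" using i by (auto simp: I_def a_def b_def x'_def)
      then have "card {e\<in>E. x' e \<noteq> 0} < card {e\<in>E. x e \<noteq> 0}" using s1 f1 by (intro psubset_card_mono) blast+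
      then show ?thesis using le by linarith
    next
      case (Inr S)
      then have "S \<in> {S\<in>odd_sets V. sum x (cut E S) \<noteq> 1}" "S \<notin> {S\<in>odd_sets V. sum x' (cut E S) \<noteq> 1}"
        using i by (auto simp: I_def a_def b_def x's)
      then have "card {S\<in>odd_sets V. sum x' (cut E S) \<noteq> 1} < card {S\<in>odd_sets V. sum x (cut E S) \<noteq> 1}"
        using s2 f1 by (intro psubset_card_mono) blast+
      then show ?thesis using le by linarith
    qed
    from less.hyps[OF this x'F] obtain M where M: "M \<in> PM F" "inner_on E w (indicator M) \<le> inner_on E w x'" by blast
    have "inner_on E w x' = inner_on E w x + t * (inner_on E w x - inner_on E w (indicator N))"
      unfolding x'_def d_def inner_on_simps ..
    then have "inner_on E w x' \<le> inner_on E w x" using False t(1) by (simp add: mult_le_0_iff)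
    then show ?thesis using M by force
  qed
qed

lemma PM_nonempty: "pm_face V E F \<Longrightarrow> V \<noteq> {} \<Longrightarrow> PM F \<noteq> {}"
  using ex_matching_le[of F] by (fastforce simp: pm_face_def)

lemma PM_face_Min:
  assumes F: "pm_face V E F" and V: "V \<noteq> {}"
  shows "N \<in> PM (face_Min E F w) \<longleftrightarrow>
    N \<in> PM F \<and> (\<forall>M\<in>PM F. inner_on E w (indicator N) \<le> inner_on E w (indicator M))"
proof
  assume N: "N \<in> PM (face_Min E F w)"
  then show "N \<in> PM F \<and> (\<forall>M\<in>PM F. inner_on E w (indicator N) \<le> inner_on E w (indicator M))"
    by (auto simp: matchings_in_face_def face_Min_iff)
next
  assume N: "N \<in> PM F \<and> (\<forall>M\<in>PM F. inner_on E w (indicator N) \<le> inner_on E w (indicator M))"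
  then have "inner_on E w (indicator N) \<le> inner_on E w z" if "z \<in> F" for z
    using ex_matching_le[OF F V that, of w] by force
  then show "N \<in> PM (face_Min E F w)" using N by (auto simp: matchings_in_face_def face_Min_iff)
qed

lemma face_Min_nonempty:
  assumes F: "pm_face V E F" and V: "V \<noteq> {}"
  shows "PM (face_Min E F w) \<noteq> {}"
proof -
  obtain N where "N \<in> PM F" "\<forall>M\<in>PM F. inner_on E w (indicator N) \<le> inner_on E w (indicator M)"
    using ex_min_if_finite[of "(\<lambda>N. inner_on E w (indicator N)) ` PM F"] finite_PM PM_nonempty[OF F V]
    by (force simp: not_less)
  then show ?thesis using PM_face_Min[OF F V] by blast
qed

section \<open>Directions of a face of minimisers\<close>

lemma face_mid: "pm_face V E F \<Longrightarrow> x \<in> F \<Longrightarrow> y \<in> F \<Longrightarrow> (\<lambda>e. (x e + y e) / 2) \<in> F"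
proof -
  assume F: "pm_face V E F" and xy: "x \<in> F" "y \<in> F"
  have s: "(\<Sum>e\<in>A. (x e + y e) / 2) = (sum x A + sum y A) / 2" for A
    by (simp add: sum_divide_distrib[symmetric] sum.distrib)
  have P: "x \<in> pm_polytope V E" "y \<in> pm_polytope V E" using xy face_polytope[OF F] by auto
  have "1 \<le> (sum x (cut E S) + sum y (cut E S)) / 2" if "S \<in> odd_sets V" for S
  proof -
    have "1 \<le> sum x (cut E S)" "1 \<le> sum y (cut E S)" using P that by (auto simp: pm_polytope_def)
    then show ?thesis by simp
  qed
  then have "(\<lambda>e. (x e + y e) / 2) \<in> pm_polytope V E" using P unfolding pm_polytope_def mem_Collect_eq s by auto
  then show ?thesis using xy unfolding face_canonical[OF F] s by simp
qed

lemma face_Min_mid: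
  assumes "pm_face V E F" "x \<in> face_Min E F w" "y \<in> face_Min E F w"
  shows "(\<lambda>e. (x e + y e) / 2) \<in> face_Min E F w"
proof -
  have "inner_on E w (\<lambda>e. (x e + y e) / 2) = (inner_on E w x + inner_on E w y) / 2"
    using inner_on_simps(3)[of E w "1/2" "\<lambda>e. x e + y e"] by (simp add: inner_on_simps)
  then show ?thesis using assms face_mid[OF assms(1)] by (fastforce simp: face_Min_iff)
qed

lemma ex_relative_interior:
  assumes "F \<noteq> {}" "F \<subseteq> pm_polytope V E" and mid: "\<And>x y. x \<in> F \<Longrightarrow> y \<in> F \<Longrightarrow> (\<lambda>e. (x e + y e) / 2) \<in> F"
  obtains z where "z \<in> F" "\<And>e. e \<in> supp F \<Longrightarrow> 0 < z e" "\<And>S. S \<in> odd_sets V \<Longrightarrow> S \<notin> tight F \<Longrightarrow> 1 < sum z (cut E S)"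
proof -
  define I where "I = Inl ` E \<union> Inr ` odd_sets V"
  define \<phi> where "\<phi> i x = (case i of Inl e \<Rightarrow> x e | Inr S \<Rightarrow> sum x (cut E S) - 1)" for i and x :: "'a set \<Rightarrow> real"
  have "\<exists>z\<in>F. \<forall>i\<in>I. (\<exists>x\<in>F. 0 < \<phi> i x) \<longrightarrow> 0 < \<phi> i z"
  proof (rule ex_common_positive)
    show "finite I" using fin by (simp add: I_def)
    show "F \<noteq> {}" by fact
    show "\<phi> i (\<lambda>e. (x e + y e) / 2) = (\<phi> i x + \<phi> i y) / 2" for i x y
      by (cases i) (auto simp: \<phi>_def sum_divide_distrib[symmetric] sum.distrib field_simps)
    show "0 \<le> \<phi> i x" if "i \<in> I" "x \<in> F" for i x
      using that assms(2) by (auto simp: \<phi>_def I_def pm_polytope_def)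
  qed (rule mid)
  then obtain z where z: "z \<in> F" "\<And>i. i \<in> I \<Longrightarrow> (\<exists>x\<in>F. 0 < \<phi> i x) \<Longrightarrow> 0 < \<phi> i z" by blast
  have "0 < z e" if "e \<in> supp F" for e
    using that z(2)[of "Inl e"] by (auto simp: face_supp_def I_def \<phi>_def)
  moreover have "1 < sum z (cut E S)" if S: "S \<in> odd_sets V" "S \<notin> tight F" for S
  proof -
    obtain x where x: "x \<in> F" "sum x (cut E S) \<noteq> 1" using S by (auto simp: face_tight_def)
    moreover have "1 \<le> sum x (cut E S)" using x assms(2) S by (auto simp: pm_polytope_def)
    ultimately have "0 < \<phi> (Inr S) x" by (simp add: \<phi>_def)
    then show ?thesis using z(2)[of "Inr S"] x S by (auto simp: I_def \<phi>_def)
  qed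
  ultimately show thesis using that z(1) by blast
qed

text \<open>Starting from a relative interior point of the face of minimisers, a small step along
  \<open>y\<close> violates no slack constraint and changes no equation. It stays in
  \<open>F\<close>, so it cannot decrease the weight.\<close>

lemma inner_dir_nonneg:
  assumes F: "pm_face V E F" and V: "V \<noteq> {}" and y: "y \<in> face_dir V E (face_Min E F w)"
  shows "0 \<le> inner_on E w y"
proof -
  let ?F = "face_Min E F w"
  have ne: "?F \<noteq> {}" using face_Min_nonempty[OF F V, of w] PM_D(2) by blast
  have sub: "?F \<subseteq> pm_polytope V E" using face_Min_subset face_polytope[OF F] by blast
  obtain z where z: "z \<in> ?F" "\<And>e. e \<in> supp ?F \<Longrightarrow> 0 < z e"
    "\<And>S. S \<in> odd_sets V \<Longrightarrow> S \<notin> tight ?F \<Longrightarrow> 1 < sum z (cut E S)"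
    using ex_relative_interior[OF ne sub face_Min_mid[OF F]] by blast
  define I where "I = Inl ` supp ?F \<union> Inr ` (odd_sets V - tight ?F)"
  define a where "a = case_sum z (\<lambda>S. sum z (cut E S) - 1)"
  define b where "b = case_sum y (\<lambda>S. sum y (cut E S))"
  have "finite (supp ?F)" using fin by (simp add: face_supp_def)
  then have "finite I" by (simp add: I_def)
  moreover have "0 < a i" if "i \<in> I" for i using that z by (auto simp: I_def a_def)
  ultimately obtain t where t: "0 < t" "\<And>i. i \<in> I \<Longrightarrow> 0 \<le> a i + t * b i"
    using ex_small_step[of I a b] by blast
  define x where "x e = z e + t * y e" for e
  have xs: "sum x A = sum z A + t * sum y A" for A by (simp add: x_def sum.distrib sum_distrib_left)
  have y0: "y e = 0" if "e \<notin> supp ?F" for e using y that by (auto simp: face_dir_def)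
  have yt: "sum y (cut E S) = 0" if "S \<in> tight ?F" for S using y that by (auto simp: face_dir_def)
  have zP: "z \<in> pm_polytope V E" "z \<in> F" using z(1) sub face_Min_subset by blast+
  have xt: "sum x (cut E S) = 1" if "S \<in> tight ?F" for S
    using that z(1) yt[OF that] by (auto simp: xs face_tight_def)
  have xP: "x \<in> pm_polytope V E"
    unfolding pm_polytope_def
  proof (intro CollectI conjI ballI allI impI)
    fix e assume "e \<notin> E"
    then show "x e = 0" using zP y0 by (auto simp: x_def pm_polytope_def face_supp_def)
  next
    fix v assume "v \<in> V"
    then have "{v} \<in> tight ?F" using sub by (auto simp: face_tight_def odd_sets_def pm_polytope_def)
    then show "sum x (cut E {v}) = 1" by (rule xt)
  next
    fix S assume S: "S \<in> odd_sets V"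
    show "1 \<le> sum x (cut E S)"
    proof (cases "S \<in> tight ?F")
      case False
      then show ?thesis using t(2)[of "Inr S"] S by (auto simp: I_def a_def b_def xs)
    qed (simp add: xt)
  next
    fix e assume e: "e \<in> E"
    show "0 \<le> x e"
    proof (cases "e \<in> supp ?F")
      case True
      then show ?thesis using t(2)[of "Inl e"] by (auto simp: I_def a_def b_def x_def)
    next
      case False
      then show ?thesis using zP e y0 by (auto simp: x_def pm_polytope_def)
    qed
  qed
  have "x \<in> F"
    unfolding face_canonical[OF F]
  proof (intro conjI ballI)
    fix S assume "S \<in> tight F"
    then show "sum x (cut E S) = 1" using xt face_tight_mono[OF face_Min_subset] by blast
  next
    fix e assume e: "e \<in> E - supp F"
    then have "e \<notin> supp ?F" using face_supp_mono[OF face_Min_subset] by blast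
    then show "x e = 0" using e zP(2) y0 unfolding face_canonical[OF F] by (auto simp: x_def)
  qed (rule xP)
  then have "inner_on E w z \<le> inner_on E w x" using z(1) by (simp add: face_Min_iff)
  also have "inner_on E w x = inner_on E w z + t * inner_on E w y"
    unfolding x_def inner_on_simps ..
  finally show ?thesis using t(1) by (simp add: zero_le_mult_iff)
qed

lemma inner_dir_zero:
  assumes F: "pm_face V E F" and V: "V \<noteq> {}" and y: "y \<in> face_dir V E (face_Min E F w)"
  shows "inner_on E w y = 0"
proof -
  have "(\<lambda>e. - y e) \<in> face_dir V E (face_Min E F w)"
    using y by (auto simp: face_dir_def sum_negf)
  from inner_dir_nonneg[OF F V this] inner_dir_nonneg[OF F V y] show ?thesis
    by (simp add: inner_on_simps)
qed

lemma diff_in_dir: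
  assumes "x \<in> F" "y \<in> F" "F \<subseteq> pm_polytope V E"
  shows "(\<lambda>e. x e - y e) \<in> face_dir V E F"
proof -
  have z0: "z e = 0" if "z \<in> F" "e \<notin> supp F" for z e
  proof (cases "e \<in> E")
    case True
    then have "0 \<le> z e" using that assms(3) by (auto simp: pm_polytope_def)
    then show ?thesis using that True by (force simp: face_supp_def)
  qed (use that assms(3) in \<open>auto simp: pm_polytope_def\<close>)
  show ?thesis
    unfolding face_dir_def mem_Collect_eq
  proof (intro conjI allI impI ballI)
    fix e assume "e \<notin> supp F"
    then show "x e - y e = 0" using z0[OF assms(1)] z0[OF assms(2)] by simp
  qed (use assms in \<open>simp add: sum_subtractf face_tight_def\<close>)
qed

text \<open>The set \<open>G\<close> is defined by the equations valid on all minimisers. A point of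
  \<open>G\<close> differs from a minimiser by a direction, to which the weight is orthogonal, so it
  is a minimiser itself.\<close>

lemma pm_face_Min:
  assumes F: "pm_face V E F" and V: "V \<noteq> {}"
  shows "pm_face V E (face_Min E F w)"
proof -
  let ?F = "face_Min E F w"
  have ne: "?F \<noteq> {}" using face_Min_nonempty[OF F V, of w] PM_D(2) by blast
  have sub: "?F \<subseteq> pm_polytope V E" using face_Min_subset face_polytope[OF F] by blast
  define G where "G = {x \<in> pm_polytope V E. (\<forall>S\<in>tight ?F. sum x (cut E S) = 1) \<and> (\<forall>e\<in>E - supp ?F. x e = 0)}"
  have "x \<in> G" if "x \<in> ?F" for x
  proof -
    have "x e = 0" if "e \<in> E - supp ?F" for e
    proof -
      have "0 \<le> x e" using \<open>x \<in> ?F\<close> that sub by (auto simp: pm_polytope_def)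
      then show ?thesis using \<open>x \<in> ?F\<close> that by (force simp: face_supp_def)
    qed
    then show ?thesis using that sub by (auto simp: G_def face_tight_def)
  qed
  moreover have "x \<in> ?F" if x: "x \<in> G" for x
  proof -
    obtain z where z: "z \<in> ?F" using ne by blast
    then have "z \<in> G" using calculation by blast
    have "(\<lambda>e. x e - z e) \<in> face_dir V E ?F"
      unfolding face_dir_def mem_Collect_eq
    proof (intro conjI allI impI ballI)
      fix e assume "e \<notin> supp ?F"
      then show "x e - z e = 0" using x \<open>z \<in> G\<close> by (cases "e \<in> E") (auto simp: G_def pm_polytope_def)
    qed (use x \<open>z \<in> G\<close> in \<open>simp add: sum_subtractf G_def\<close>)
    from inner_dir_zero[OF F V this] have "inner_on E w x = inner_on E w z" by (simp add: inner_on_simps)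
    moreover have "x \<in> F"
    proof -
      have "tight F \<subseteq> tight ?F" "supp ?F \<subseteq> supp F"
        by (rule face_tight_mono[OF face_Min_subset], rule face_supp_mono[OF face_Min_subset])
      then show ?thesis unfolding face_canonical[OF F] using x by (auto simp: G_def)
    qed
    ultimately show ?thesis using z by (simp add: face_Min_iff)
  qed
  ultimately have "?F = G" by blast
  moreover have "tight ?F \<subseteq> odd_sets V" "E - supp ?F \<subseteq> E" by (auto simp: face_tight_def)
  ultimately show ?thesis unfolding pm_face_def using ne G_def by blast
qed

text \<open>Matchings determine \<open>supp\<close> and \<open>tight\<close>, and these determine
  the face. This reduces equations between faces of minimisers to comparisons of matching
  weights.\<close>

lemma face_eq_if_PM_eq:
  assumes F: "pm_face V E F" "pm_face V E G" and V: "V \<noteq> {}" and eq: "PM F = PM G"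
  shows "F = G"
proof -
  have supp: "supp H = \<Union>(PM H)" if "pm_face V E H" for H
    using ex_matching_edge[OF that] matching_in_supp by blast
  have tight: "tight H = {S\<in>odd_sets V. \<forall>N\<in>PM H. card (N \<inter> cut E S) = 1}" if H: "pm_face V E H" for H
  proof -
    have "sum x (cut E S) = 1" if S: "S \<in> odd_sets V" "\<forall>N\<in>PM H. card (N \<inter> cut E S) = 1" and x: "x \<in> H" for S x
    proof -
      \<comment> \<open>With the negated cut indicator as weight, some matching has a cut sum at
        least that of \<open>x\<close>; its cut sum 1 bounds that of \<open>x\<close> from
        above.\<close>
      have id: "inner_on E (\<lambda>e. - indicator (cut E S) e) z = - sum z (cut E S)" for z :: "'a set \<Rightarrow> real"
      proof -
        have "inner_on E (\<lambda>e. - indicator (cut E S) e) z = (\<Sum>e\<in>E. if e \<in> cut E S then - z e else 0)"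
          unfolding inner_on_def by (intro sum.cong) auto
        also have "\<dots> = - sum z (cut E S)"
        proof -
          have "- sum z (cut E S) = (\<Sum>e\<in>cut E S. - z e)" by (simp add: sum_negf)
          also have "\<dots> = (\<Sum>e\<in>{e\<in>E. e \<in> cut E S}. - z e)" by (intro sum.cong) (auto simp: cut_def)
          also have "\<dots> = (\<Sum>e\<in>E. if e \<in> cut E S then - z e else 0)" by (rule sum.inter_filter[OF fin(2)])
          finally show ?thesis by simp
        qed
        finally show ?thesis .
      qed
      obtain N where "N \<in> PM H" "sum x (cut E S) \<le> sum (indicator N) (cut E S)"
        using ex_matching_le[OF H V x, of "\<lambda>e. - indicator (cut E S) e"] unfolding id by auto
      moreover have "1 \<le> sum x (cut E S)" using x face_polytope[OF H] S by (auto simp: pm_polytope_def)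
      ultimately show ?thesis using S(2) by (auto simp: sum_indicator_cut)
    qed
    moreover have "card (N \<inter> cut E S) = 1" if "S \<in> tight H" "N \<in> PM H" for N S
    proof -
      have "sum (indicator N) (cut E S) = (1::real)" using that PM_D(2) by (auto simp: face_tight_def)
      then show ?thesis by (simp add: sum_indicator_cut)
    qed
    ultimately show ?thesis by (auto simp: face_tight_def)
  qed
  show ?thesis using supp tight F eq face_canonical[OF F(1)] face_canonical[OF F(2)] by (intro set_eqI) simp
qed

lemma tight_card: "S \<in> tight F \<Longrightarrow> N \<in> PM F \<Longrightarrow> card (N \<inter> cut E S) = 1"
proof -
  assume "S \<in> tight F" "N \<in> PM F"
  then have "sum (indicator N) (cut E S) = (1::real)" using PM_D(2) by (auto simp: face_tight_def)
  then show ?thesis by (simp add: sum_indicator_cut)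
qed

section \<open>Composition of weight functions\<close>

lemma inner_indicator:
  assumes "N \<subseteq> E"
  shows "inner_on E (\<lambda>e. real_of_int (w e)) (indicator N) = real_of_int (\<Sum>e\<in>N. w e)"
proof -
  have "inner_on E (\<lambda>e. real_of_int (w e)) (indicator N) = (\<Sum>e\<in>E. if e \<in> N then real_of_int (w e) else 0)"
    unfolding inner_on_def by (intro sum.cong) auto
  also have "\<dots> = (\<Sum>e\<in>N. real_of_int (w e))"
    using fin(2) assms by (simp add: sum.inter_restrict[symmetric] Int_absorb1)
  finally show ?thesis by simp
qed

lemma pm_card_le: "perfect_matching V E N \<Longrightarrow> card N \<le> card V"
proof -
  assume N: "perfect_matching V E N"
  define f where "f e = (SOME v. v \<in> e)" for e :: "'a set"
  have NE: "N \<subseteq> E" using N by (simp add: perfect_matching_def)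
  have f: "f e \<in> e" if "e \<in> N" for e
  proof -
    have "e \<noteq> {}" using fin(4) NE that by fastforce
    then show ?thesis unfolding f_def by (simp add: some_in_eq)
  qed
  have "inj_on f N"
  proof (rule inj_onI)
    fix a b assume ab: "a \<in> N" "b \<in> N" "f a = f b"
    have "f a \<in> V" using f[OF ab(1)] ab(1) NE fin(3) by blast
    then show "a = b" using N f[OF ab(1)] f[OF ab(2)] ab unfolding perfect_matching_def by metis
  qed
  moreover have "f ` N \<subseteq> V" using f NE fin(3) by blast
  ultimately show ?thesis using fin(1) by (intro card_inj_on_le) auto
qed

text \<open>Values of \<open>w'\<close> are at most \<open>n ^ 20 - 1\<close> and a matching has at
  most \<open>n\<close> edges, so its \<open>w'\<close>-weight is less than \<open>n ^ 21\<close>.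
  Minimising the composition is therefore lexicographic minimisation, first by \<open>w\<close> and
  then by \<open>w'\<close>.\<close>

lemma face_Min_comp:
  assumes F: "pm_face V E F" and V: "V \<noteq> {}" and w': "w' \<in> weights (card V) num"
  shows "face_Min E F (\<lambda>e. real_of_int (weight_comp (card V) w w' e)) =
    face_Min E (face_Min E F (\<lambda>e. real_of_int (w e))) (\<lambda>e. real_of_int (w' e))"
proof (rule face_eq_if_PM_eq[OF _ _ V])
  let ?W = "weight_comp (card V) w w'"
  let ?n = "card V"
  let ?F = "face_Min E F (\<lambda>e. real_of_int (w e))"
  have F1: "pm_face V E ?F" by (rule pm_face_Min[OF F V])
  show "pm_face V E (face_Min E F (\<lambda>e. real_of_int (?W e)))" by (rule pm_face_Min[OF F V])
  show "pm_face V E (face_Min E ?F (\<lambda>e. real_of_int (w' e)))" by (rule pm_face_Min[OF F1 V])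
  have n0: "0 < ?n" using V fin(1) by (simp add: card_gt_0_iff)
  have w'b: "0 \<le> w' e" "w' e \<le> int ?n ^ 20 - 1" for e
  proof -
    obtain k where k: "2 \<le> k" "k \<le> ?n ^ 20" "w' = (\<lambda>e. int ((4 * ?n\<^sup>2 + 1) ^ num e mod k))"
      using w' by (auto simp: weights_def weights_upto_def)
    have "(4 * ?n\<^sup>2 + 1) ^ num e mod k < k" using k by simp
    then have "(4 * ?n\<^sup>2 + 1) ^ num e mod k < ?n ^ 20" using k by linarith
    then have "int ((4 * ?n\<^sup>2 + 1) ^ num e mod k) < int (?n ^ 20)" by (simp only: of_nat_less_iff)
    then show "0 \<le> w' e" "w' e \<le> int ?n ^ 20 - 1" using k(3) by simp_all
  qed
  define A where "A N = (\<Sum>e\<in>N. w e)" for N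
  define B where "B N = (\<Sum>e\<in>N. w' e)" for N
  have W: "(\<Sum>e\<in>N. ?W e) = int ?n ^ 21 * A N + B N" for N
    by (simp add: A_def B_def weight_comp_def sum.distrib sum_distrib_left)
  have Bb: "0 \<le> B N" "B N < int ?n ^ 21" if "N \<in> PM F" for N
  proof -
    show "0 \<le> B N" unfolding B_def using w'b by (simp add: sum_nonneg)
    have "B N \<le> (\<Sum>e\<in>N. int ?n ^ 20 - 1)" unfolding B_def using w'b by (intro sum_mono) auto
    also have "\<dots> = int (card N) * (int ?n ^ 20 - 1)" by simp
    also have "\<dots> \<le> int ?n * (int ?n ^ 20 - 1)"
      using pm_card_le[OF PM_D(1)[OF that]] n0 by (intro mult_right_mono) auto
    also have "\<dots> < int ?n ^ 21" using n0 power_Suc[of "int ?n" 20] by (simp add: right_diff_distrib)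
    finally show "B N < int ?n ^ 21" .
  qed
  have inF: "N \<in> PM F \<Longrightarrow> N \<subseteq> E" for N by (rule PM_D(3))
  have le: "inner_on E (\<lambda>e. real_of_int (f e)) (indicator N) \<le> inner_on E (\<lambda>e. real_of_int (f e)) (indicator M)
      \<longleftrightarrow> (\<Sum>e\<in>N. f e) \<le> (\<Sum>e\<in>M. f e)" if "N \<in> PM F" "M \<in> PM F" for f :: "'a set \<Rightarrow> int" and N M
    by (simp only: inner_indicator[OF inF[OF that(1)]] inner_indicator[OF inF[OF that(2)]] of_int_le_iff)
  have mW: "N \<in> PM (face_Min E F (\<lambda>e. real_of_int (?W e))) \<longleftrightarrow>
    N \<in> PM F \<and> (\<forall>M\<in>PM F. int ?n ^ 21 * A N + B N \<le> int ?n ^ 21 * A M + B M)" for N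
    unfolding PM_face_Min[OF F V] using le[of N _ ?W] unfolding W by blast
  have mA: "N \<in> PM ?F \<longleftrightarrow> N \<in> PM F \<and> (\<forall>M\<in>PM F. A N \<le> A M)" for N
    unfolding PM_face_Min[OF F V] A_def using le[of N _ w] by blast
  have mB: "N \<in> PM (face_Min E ?F (\<lambda>e. real_of_int (w' e))) \<longleftrightarrow>
     N \<in> PM ?F \<and> (\<forall>M\<in>PM ?F. B N \<le> B M)" for N
    unfolding PM_face_Min[OF F1 V] B_def using le[of N _ w'] mA by blast
  define K where "K = int ?n ^ 21"
  have K: "0 < K" using n0 by (simp add: K_def)
  have key: "K * A N + B N \<le> K * A M + B M \<longleftrightarrow> A N < A M \<or> A N = A M \<and> B N \<le> B M"
    if "N \<in> PM F" "M \<in> PM F" for N M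
  proof -
    have b: "0 \<le> B N" "B N < K" "0 \<le> B M" "B M < K" using Bb that by (auto simp: K_def)
    consider "A N < A M" | "A N = A M" | "A M < A N" by linarith
    then show ?thesis
    proof cases
      case 1
      then have "K * (A N + 1) \<le> K * A M" using K by (intro mult_left_mono) auto
      then show ?thesis using 1 b by (simp add: distrib_left)
    next
      case 3
      then have "K * (A M + 1) \<le> K * A N" using K by (intro mult_left_mono) auto
      then show ?thesis using 3 b by (simp add: distrib_left)
    qed auto
  qed
  show "PM (face_Min E F (\<lambda>e. real_of_int (?W e))) = PM (face_Min E ?F (\<lambda>e. real_of_int (w' e)))"
  proof (intro set_eqI iffI)
    fix N assume "N \<in> PM (face_Min E F (\<lambda>e. real_of_int (?W e)))"
    then have N: "N \<in> PM F" "\<And>M. M \<in> PM F \<Longrightarrow> K * A N + B N \<le> K * A M + B M"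
      using mW by (auto simp: K_def)
    then have lex: "\<And>M. M \<in> PM F \<Longrightarrow> A N < A M \<or> A N = A M \<and> B N \<le> B M" using key by blast
    then have "N \<in> PM ?F" using N(1) unfolding mA by (auto simp: le_less)
    moreover have "B N \<le> B M" if "M \<in> PM ?F" for M
    proof -
      have "M \<in> PM F" "A M \<le> A N" using that N(1) mA by auto
      then show ?thesis using lex by fastforce
    qed
    ultimately show "N \<in> PM (face_Min E ?F (\<lambda>e. real_of_int (w' e)))" unfolding mB by blast
  next
    fix N assume "N \<in> PM (face_Min E ?F (\<lambda>e. real_of_int (w' e)))"
    then have N3: "N \<in> PM ?F" "\<And>M. M \<in> PM ?F \<Longrightarrow> B N \<le> B M" using mB by blast+
    then have N: "N \<in> PM F" "\<And>M. M \<in> PM F \<Longrightarrow> A N \<le> A M" using mA by blast+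
    have "K * A N + B N \<le> K * A M + B M" if M: "M \<in> PM F" for M
    proof (cases "A N = A M")
      case True
      then have "M \<in> PM ?F" using M N(2) unfolding mA by auto
      then show ?thesis using N3(2) True by simp
    next
      case False
      then show ?thesis using N(2)[OF M] key[OF N(1) M] by simp
    qed
    then show "N \<in> PM (face_Min E F (\<lambda>e. real_of_int (?W e)))" using N(1) unfolding mW K_def by blast
  qed
qed

section \<open>Uncrossing against a maximal laminar family\<close>

lemma laminar_insert:
  fixes S :: "'b set"
  assumes "laminar L" "\<not> laminar (insert S L)"
  obtains T where "T \<in> L" "crossing S T"
proof -
  have sym: "crossing A B \<longleftrightarrow> crossing B A" for A B :: "'b set" by (auto simp: crossing_def)
  have irr: "\<not> crossing S S" by (simp add: crossing_def)
  obtain A B where AB: "A \<in> insert S L" "B \<in> insert S L" "crossing A B"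
    using assms(2) by (auto simp: laminar_def)
  show thesis
  proof (cases "A = S")
    case True
    then show thesis using AB irr that[of B] by auto
  next
    case False
    then have "B = S" using AB assms(1) by (auto simp: laminar_def)
    then have "crossing S A" using AB sym[of A S] by simp
    moreover have "A \<in> L" using AB False by simp
    ultimately show thesis by (rule that[rotated])
  qed
qed

text \<open>By induction on the number of members of \<open>L\<close> that a tight set crosses.\<close>

lemma dir_if_laminar:
  assumes F: "pm_face V E F" and L: "maximal_laminar_subset (tight F) L"
    and y: "\<And>e. e \<notin> supp F \<Longrightarrow> y e = 0" "\<And>S. S \<in> L \<Longrightarrow> sum y (cut E S) = 0"
  shows "y \<in> face_dir V E F"
proof -
  have ne: "F \<noteq> {}" using F by (simp add: pm_face_def)
  obtain z where z: "z \<in> F" "\<And>e. e \<in> supp F \<Longrightarrow> 0 < z e"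
    "\<And>S. S \<in> odd_sets V \<Longrightarrow> S \<notin> tight F \<Longrightarrow> 1 < sum z (cut E S)"
    using ex_relative_interior[OF ne face_polytope[OF F] face_mid[OF F]] by blast
  have zP: "frac_pm V E (\<lambda>e. e) z" using z(1) face_polytope[OF F] by (auto simp: polytope_iff)
  have Lt: "L \<subseteq> tight F" "laminar L" using L by (auto simp: maximal_laminar_subset_def)
  have "tight F \<subseteq> Pow V" by (auto simp: face_tight_def odd_sets_def)
  then have finL: "finite L" using Lt fin(1) finite_subset by (metis finite_Pow_iff)
  have tD: "S \<subseteq> V" "odd (card S)" "sum z (cut E S) = 1" if "S \<in> tight F" for S
    using that z(1) by (auto simp: face_tight_def odd_sets_def)
  have tI: "S \<in> tight F" if "S \<subseteq> V" "odd (card S)" "sum z (cut E S) = 1" for S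
    using that z(3)[of S] by (force simp: odd_sets_def)
  have "sum y (cut E S) = 0" if "S \<in> tight F" for S
    using that
  proof (induction "card {T\<in>L. crossing S T}" arbitrary: S rule: less_induct)
    case (less S)
    show ?case
    proof (cases "S \<in> L")
      case False
      then have "\<not> laminar (insert S L)" using L less.prems by (auto simp: maximal_laminar_subset_def)
      then obtain T where T: "T \<in> L" "crossing S T" using laminar_insert[OF Lt(2)] by blast
      then have Tt: "T \<in> tight F" using Lt by blast
      obtain A B where AB: "(A = S \<inter> T \<and> B = S \<union> T) \<or> (A = S - T \<and> B = T - S)"
        "odd (card A)" "odd (card B)" "sum z (mcut E (\<lambda>e. e) A) = 1" "sum z (mcut E (\<lambda>e. e) B) = 1"
        and id: "\<And>y :: 'a set \<Rightarrow> real. (\<forall>e\<in>E. z e = 0 \<longrightarrow> y e = 0) \<Longrightarrow>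
          sum y (mcut E (\<lambda>e. e) S) + sum y (mcut E (\<lambda>e. e) T) = sum y (mcut E (\<lambda>e. e) A) + sum y (mcut E (\<lambda>e. e) B)"
        using uncross[OF mg zP tD(1,2)[OF less.prems] tD(3)[OF less.prems, unfolded cut_mcut]
            tD(1,2)[OF Tt] tD(3)[OF Tt, unfolded cut_mcut]] by blast
      have At: "A \<in> tight F" "B \<in> tight F"
        using AB tD(1)[OF less.prems] tD(1)[OF Tt] by (auto intro!: tI simp: cut_mcut)
      \<comment> \<open>A member \<open>R\<close> of \<open>L\<close> does not cross
        \<open>T\<close>, so if it crosses one of the uncrossed sets, it crosses \<open>S\<close>.
        The member \<open>T\<close> itself is crossed by \<open>S\<close> but by none of the
        uncrossed sets.\<close>
      have smaller: "card {R\<in>L. crossing C R} < card {R\<in>L. crossing S R}"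
        if C: "C = S \<inter> T \<or> C = S \<union> T \<or> C = S - T \<or> C = T - S" for C
      proof (rule psubset_card_mono)
        show "finite {R\<in>L. crossing S R}" using finL by simp
        have nc: "\<not> crossing R T" if "R \<in> L" for R using that T Lt by (auto simp: laminar_def)
        have "crossing S R" if "R \<in> L" "crossing C R" for R
          using nc[OF that(1)] that(2) T(2) C unfolding crossing_def by blast
        moreover have "\<not> crossing C T" using C by (auto simp: crossing_def)
        ultimately show "{R\<in>L. crossing C R} \<subset> {R\<in>L. crossing S R}" using T by blast
      qed
      have "sum y (cut E A) = 0" "sum y (cut E B) = 0"
        using AB(1) by (auto intro!: less.hyps[OF smaller] At)
      moreover have "\<forall>e\<in>E. z e = 0 \<longrightarrow> y e = 0" using y(1) z(2) by force
      ultimately show ?thesis using id[of y] y(2)[OF T(1)] by (simp add: cut_mcut)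
    qed (rule y(2))
  qed
  then show ?thesis using y(1) by (auto simp: face_dir_def)
qed

section \<open>Exchanging two matchings on a region\<close>

lemma swap_pm:
  assumes N: "perfect_matching V E N1" "perfect_matching V E N2"
    and D: "\<And>g. g \<in> N1 \<union> N2 \<Longrightarrow> g \<in> N1 \<inter> N2 \<or> g \<subseteq> D \<or> g \<inter> D = {}"
  shows "perfect_matching V E (swap_on D N1 N2)"
  unfolding perfect_matching_def
proof (intro conjI ballI)
  show "swap_on D N1 N2 \<subseteq> E" using N by (auto simp: swap_on_def perfect_matching_def)
  fix v assume v: "v \<in> V"
  obtain a where a: "a \<in> N1" "v \<in> a" "\<And>g. g \<in> N1 \<Longrightarrow> v \<in> g \<Longrightarrow> g = a"
    using N(1) v unfolding perfect_matching_def by metis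
  obtain b where b: "b \<in> N2" "v \<in> b" "\<And>g. g \<in> N2 \<Longrightarrow> v \<in> g \<Longrightarrow> g = b"
    using N(2) v unfolding perfect_matching_def by metis
  show "\<exists>!e. e \<in> swap_on D N1 N2 \<and> v \<in> e"
  proof (cases "v \<in> D")
    case True
    show ?thesis
    proof (rule ex1I[of _ b])
      show "b \<in> swap_on D N1 N2 \<and> v \<in> b" using True b(1,2) by (auto simp: swap_on_def)
      fix g assume "g \<in> swap_on D N1 N2 \<and> v \<in> g"
      then have "g \<in> N2" "v \<in> g" using True by (auto simp: swap_on_def)
      then show "g = b" by (rule b(3))
    qed
  next
    case False
    have sub: "g \<in> N1" if "g \<in> swap_on D N1 N2" "v \<in> g" for g
      using that D[of g] False by (auto simp: swap_on_def)
    have "a \<in> swap_on D N1 N2" using a(1,2) D[of a] False by (auto simp: swap_on_def)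
    then show ?thesis using a(2,3) sub by (intro ex1I[of _ a]) blast+
  qed
qed

text \<open>The two swapped matchings have the same sum as the given ones, so a face containing the latter
  contains the former.\<close>

lemma swap_in_face:
  assumes F: "pm_face V E F" and N: "N1 \<in> PM F" "N2 \<in> PM F"
    and D: "\<And>g. g \<in> N1 \<union> N2 \<Longrightarrow> g \<in> N1 \<inter> N2 \<or> g \<subseteq> D \<or> g \<inter> D = {}"
  shows "swap_on D N1 N2 \<in> PM F"
proof -
  let ?N3 = "swap_on D N1 N2" and ?N4 = "swap_on D N2 N1"
  have p3: "perfect_matching V E ?N3" using D PM_D(1)[OF N(1)] PM_D(1)[OF N(2)] by (intro swap_pm) auto
  have p4: "perfect_matching V E ?N4" using D PM_D(1)[OF N(1)] PM_D(1)[OF N(2)] by (intro swap_pm) blast+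
  have id: "indicator N1 e + indicator N2 e = (indicator ?N3 e + indicator ?N4 e :: real)" for e
    by (auto simp: swap_on_def indicator_def)
  have "indicator ?N3 \<in> F"
    unfolding face_canonical[OF F]
  proof (intro conjI ballI)
    show P3: "indicator ?N3 \<in> pm_polytope V E" by (rule pm_in_polytope[OF p3])
    fix S assume S: "S \<in> tight F"
    then have So: "S \<in> odd_sets V" by (simp add: face_tight_def)
    have "(\<Sum>e\<in>cut E S. indicator N1 e + indicator N2 e) = (\<Sum>e\<in>cut E S. indicator ?N3 e + indicator ?N4 e :: real)"
      using id by (intro sum.cong) auto
    then have "sum (indicator N1) (cut E S) + sum (indicator N2) (cut E S) =
      sum (indicator ?N3) (cut E S) + (sum (indicator ?N4) (cut E S) :: real)" by (simp add: sum.distrib)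
    moreover have "sum (indicator N1) (cut E S) = (1::real)" "sum (indicator N2) (cut E S) = (1::real)"
      using S N PM_D(2) by (auto simp: face_tight_def)
    moreover have "1 \<le> (sum (indicator ?N3) (cut E S) :: real)" "1 \<le> (sum (indicator ?N4) (cut E S) :: real)"
      using P3 pm_in_polytope[OF p4] So by (auto simp: pm_polytope_def)
    ultimately show "sum (indicator ?N3) (cut E S) = (1::real)" by linarith
  next
    fix e assume "e \<in> E - supp F"
    then have "e \<notin> N1" "e \<notin> N2" using matching_in_supp N by auto
    then show "indicator ?N3 e = (0::real)" by (auto simp: swap_on_def indicator_def)
  qed
  then show ?thesis using p3 by (simp add: matchings_in_face_def)
qed

end

section \<open>Lifts of alternating circuits\<close>

text \<open>\<open>esum\<close> sums over the edges of a walk, \<open>vsum\<close> regroups the same sum by visited nodes; \<open>e0\<close> is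
  the edge by which the walk is entered.\<close>

fun esum :: "('e \<Rightarrow> 'n \<Rightarrow> int) \<Rightarrow> ('n \<times> 'e) list \<Rightarrow> 'n \<Rightarrow> int" where
  "esum A [] v = 0"
| "esum A (x # xs) v = A (snd x) (fst x) + A (snd x) (hdn xs v) - esum A xs v"

fun vsum :: "('e \<Rightarrow> 'n \<Rightarrow> int) \<Rightarrow> 'e \<Rightarrow> ('n \<times> 'e) list \<Rightarrow> int" where
  "vsum A e0 [] = 0"
| "vsum A e0 (x # xs) = A (snd x) (fst x) - A e0 (fst x) - vsum A (snd x) xs"

fun laste :: "('n \<times> 'e) list \<Rightarrow> 'e \<Rightarrow> 'e" where
  "laste [] e0 = e0"
| "laste (x # xs) e0 = laste xs (snd x)"

lemma laste_last: "xs \<noteq> [] \<Longrightarrow> laste xs e0 = snd (last xs)"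
  by (induction xs arbitrary: e0) auto

lemma esum_vsum: "esum A xs v = vsum A e0 xs + A e0 (hdn xs v) - (-1) ^ length xs * A (laste xs e0) v"
proof (induction xs arbitrary: e0)
  case (Cons x xs)
  show ?case using Cons[of "snd x"] by simp
qed simp

lemma vsum_append: "vsum A e0 (xs @ ys) = vsum A e0 xs + (-1) ^ length xs * vsum A (laste xs e0) ys"
  by (induction xs arbitrary: e0) (auto simp: algebra_simps)

lemma laste_append: "laste (xs @ ys) e0 = laste ys (laste xs e0)"
  by (induction xs arbitrary: e0) auto

text \<open>On a closed walk the entering edge is the last edge, and even length makes the two
  boundary terms of \<open>esum_vsum\<close> cancel.\<close>

lemma esum_closed:
  assumes "xs \<noteq> []" "even (length xs)"
  shows "esum A xs (fst (hd xs)) = vsum A (snd (last xs)) xs"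
  using esum_vsum[of A xs "fst (hd xs)" "snd (last xs)"] assms by (simp add: laste_last hdn_nonempty)

lemma vsum_index:
  "vsum A (G 0) (map (\<lambda>j. (q j, G (Suc j))) [0..<k]) = (\<Sum>j<k. (-1) ^ j * (A (G (Suc j)) (q j) - A (G j) (q j)))"
proof (induction k)
  case (Suc k)
  have "laste (map (\<lambda>j. (q j, G (Suc j))) [0..<k]) (G 0) = G k"
    by (cases k) (auto simp: laste_append)
  then show ?case using Suc by (simp add: vsum_append)
qed simp

lemma chi_notin: "e \<notin> set es \<Longrightarrow> chi es e = 0"
  by (induction es) (auto simp: chi_def)

text \<open>The first repetition of the alternating orbit is a return to the start after an even number of
  steps, because every other one would already have occurred a step earlier.\<close>

lemma alternating_orbit:
  fixes p q :: "'b \<Rightarrow> 'b"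
  assumes fin: "finite Q"
    and p: "\<And>x. x \<in> Q \<Longrightarrow> p x \<in> Q \<and> p (p x) = x \<and> p x \<noteq> x"
    and q: "\<And>x. x \<in> Q \<Longrightarrow> q x \<in> Q \<and> q (q x) = x \<and> q x \<noteq> x"
    and a: "a \<in> Q"
  obtains v m where "v 0 = a" "0 < m" "even m" "v m = a" "\<And>i. v i \<in> Q" "inj_on v {..<m}"
    "\<And>i. v (Suc i) = (if even i then p (v i) else q (v i))"
proof -
  define v where "v = rec_nat a (\<lambda>i x. if even i then p x else q x)"
  have v0: "v 0 = a" and vS: "v (Suc i) = (if even i then p (v i) else q (v i))" for i
    by (simp_all add: v_def)
  have vQ: "v i \<in> Q" for i by (induction i) (auto simp: v0 vS a p q)
  define f where "f i = (if even i then p else q)" for i :: nat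
  have f: "v (Suc i) = f i (v i)" "f i (f i (v j)) = v j" "f i (v j) \<noteq> v j" for i j
    using p[OF vQ] q[OF vQ] by (auto simp: f_def vS)
  have f_par: "f i = f j" if "even i = even j" for i j using that by (simp add: f_def)
  have "\<exists>m. \<exists>j<m. v m = v j"
  proof (rule ccontr)
    assume "\<not> ?thesis"
    then have "inj v" by (metis injI linorder_neqE_nat)
    moreover have "range v \<subseteq> Q" using vQ by auto
    ultimately show False using fin by (metis finite_subset finite_imageD infinite_UNIV_nat)
  qed
  note rpt = this
  define m where "m = (LEAST m. \<exists>j<m. v m = v j)"
  have m: "\<exists>j<m. v m = v j" unfolding m_def by (rule LeastI_ex[OF rpt])
  have least: "\<not> (\<exists>j<k. v k = v j)" if "k < m" for k
    using not_less_Least[OF that[unfolded m_def]] .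
  obtain j where j: "j < m" "v m = v j" using m by blast
  have inj: "inj_on v {..<m}"
  proof (rule inj_onI)
    fix x y assume "x \<in> {..<m}" "y \<in> {..<m}" "v x = v y"
    then show "x = y" using least[of x] least[of y] by (metis lessThan_iff linorder_neqE_nat)
  qed
  have eq: "x = y" if "v x = v y" "x < m" "y < m" for x y
    using inj that by (auto simp: inj_on_def)
  obtain k where k: "m = Suc k" using j by (cases m) auto
  \<comment> \<open>\<open>k\<close> is the last index before the repetition. The steps are
    involutions, so the last one can be read backwards from \<open>v j\<close>.\<close>
  have vk: "v k = f k (v j)" using f(1)[of k] f(2)[of k k] j k by simp
  have kj: "k \<noteq> j" using j k f(1)[of k] f(3)[of k k] by auto
  then have jk: "j < k" using j k by linarith
  have "even k \<noteq> even j"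
  proof
    assume par: "even k = even j"
    then have "v k = v (Suc j)" using vk f(1)[of j] f_par[OF par] by simp
    then have "k = Suc j" using eq[of k "Suc j"] jk k by simp
    then show False using par by simp
  qed
  moreover have "j = 0"
  proof (cases j)
    case (Suc i)
    then have par: "even k = even i" using calculation by auto
    have "v k = v i" using vk f(1)[of i] f(2)[of i i] f_par[OF par] Suc by simp
    then have "k = i" using eq[of k i] jk k Suc by simp
    then show ?thesis using jk Suc by simp
  qed simp
  ultimately have "even m" "v m = a" using k j v0 by auto
  then show thesis using that[of v m] v0 vQ inj vS k by blast
qed

text \<open>Counting the end points of \<open>g\<close> in \<open>U\<close> instead of \<open>g\<close> itself makes \<open>hl\<close> additive in \<open>U\<close>. In
  return, \<open>lift\<close> below is twice the vector obtained by completing a circuit inside its nodes.\<close>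

definition hl :: "'a set set \<Rightarrow> 'a set \<Rightarrow> 'a set \<Rightarrow> int" where
  "hl N U g = (if g \<in> N then int (card (g \<inter> U)) else 0)"

definition touching :: "'a set set \<Rightarrow> 'a set \<Rightarrow> 'a set set" where
  "touching N D = {g \<in> N. g \<inter> D \<noteq> {}}"

context sgraph
begin

definition bd :: "'a set set \<Rightarrow> 'a set \<Rightarrow> 'a set" where
  "bd N S = (THE g. g \<in> N \<inter> cut E S)"

text \<open>Any matching of \<open>F\<close> through \<open>e\<close> may serve here: by
  \<open>rep_hl\<close>, its part on a contractible node that \<open>e\<close> leaves is the same
  for all of them.\<close>

definition rep :: "('a set \<Rightarrow> real) set \<Rightarrow> 'a set \<Rightarrow> 'a set set" where
  "rep F e = (SOME N. N \<in> PM F \<and> e \<in> N)"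

definition lift :: "('a set \<Rightarrow> real) set \<Rightarrow> 'a set set \<Rightarrow> real \<Rightarrow> 'a set list \<Rightarrow> 'a set \<Rightarrow> int" where
  "lift F L \<mu> es g = alt (\<lambda>e. hl (rep F e) (\<Union>(mg_ends (contraction E F L \<mu>) e)) g) es"

lemma rep: "pm_face V E F \<Longrightarrow> e \<in> supp F \<Longrightarrow> rep F e \<in> PM F \<and> e \<in> rep F e"
  unfolding rep_def using ex_matching_edge[of F e] by (metis (mono_tags, lifting) someI_ex)

lemma bd:
  assumes "S \<in> tight F" "N \<in> PM F"
  shows "bd N S \<in> N" "bd N S \<in> cut E S" "g \<in> N \<Longrightarrow> g \<in> cut E S \<Longrightarrow> g = bd N S"
proof -
  obtain h where h: "N \<inter> cut E S = {h}" using tight_card[OF assms] by (auto simp: card_1_singleton_iff)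
  then have "bd N S = h" by (simp add: bd_def)
  then show "bd N S \<in> N" "bd N S \<in> cut E S" "g \<in> N \<Longrightarrow> g \<in> cut E S \<Longrightarrow> g = bd N S" using h by auto
qed

lemma touching_cases:
  assumes "S \<in> tight F" "N \<in> PM F" "g \<in> N" "g \<inter> S \<noteq> {}"
  shows "g \<subseteq> S \<or> g = bd N S"
  using bd(3)[OF assms(1,2,3)] mem_cut[of g S] assms PM_D(3)[OF assms(2)] by blast

text \<open>An edge of a matching of \<open>F\<close> that meets \<open>U\<close> lies inside
  \<open>U\<close> or is the boundary edge, which is \<open>e\<close> for both matchings.\<close>

lemma contractible_touching:
  assumes "contractible V E F U" "N \<in> PM F" "M \<in> PM F" "e \<in> N" "e \<in> M" "e \<in> cut E U"
  shows "touching N U = touching M U"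
proof -
  have U: "U \<in> tight F" using assms(1) by (simp add: contractible_def)
  have "\<not> (\<exists>M\<in>PM F. \<exists>N\<in>PM F. e \<in> M \<and> e \<in> N \<and> M \<inter> edges_within E U \<noteq> N \<inter> edges_within E U)"
    by (rule bspec[OF conjunct2[OF assms(1)[unfolded contractible_def]] assms(6)])
  then have eq: "N \<inter> edges_within E U = M \<inter> edges_within E U" using assms(2-5) by blast
  have e: "e = bd N U" "e = bd M U" using bd(3)[OF U assms(2,4,6)] bd(3)[OF U assms(3,5,6)] by auto
  have NE: "N \<subseteq> E" "M \<subseteq> E" using PM_D(3) assms by auto
  have "g \<in> M" if "g \<in> N" "g \<inter> U \<noteq> {}" for g
    using touching_cases[OF U assms(2) that] e assms eq that NE by (auto simp: edges_within_def)
  moreover have "g \<in> N" if "g \<in> M" "g \<inter> U \<noteq> {}" for g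
    using touching_cases[OF U assms(3) that] e assms eq that NE by (auto simp: edges_within_def)
  ultimately show ?thesis by (auto simp: touching_def)
qed

lemma hl_touching:
  assumes "touching N U = touching M U"
  shows "hl N U = hl M U"
proof (rule ext)
  fix g
  show "hl N U g = hl M U g"
  proof (cases "g \<inter> U = {}")
    case False
    then have "g \<in> N \<longleftrightarrow> g \<in> M" using assms unfolding touching_def by blast
    then show ?thesis by (simp add: hl_def)
  qed (simp add: hl_def)
qed

lemma contractible_hl:
  assumes "contractible V E F U" "N \<in> PM F" "M \<in> PM F" "e \<in> N" "e \<in> M" "e \<in> cut E U"
  shows "hl N U = hl M U"
  by (rule hl_touching[OF contractible_touching[OF assms]])

lemma hl_Un:
  assumes "N \<subseteq> E" "U \<inter> W = {}"
  shows "hl N (U \<union> W) g = hl N U g + hl N W g"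
proof (cases "g \<in> N")
  case True
  then have "finite g" using assms(1) fin(1,3) finite_subset by blast
  then have "card (g \<inter> (U \<union> W)) = card (g \<inter> U) + card (g \<inter> W)"
    using assms(2) by (simp add: Int_Un_distrib) (rule card_Un_disjoint, auto)
  then show ?thesis by (simp add: hl_def)
qed (simp add: hl_def)

lemma hl_UN:
  assumes "N \<subseteq> E" "finite J" "\<And>i j. i \<in> J \<Longrightarrow> j \<in> J \<Longrightarrow> i \<noteq> j \<Longrightarrow> q i \<inter> q j = {}"
  shows "hl N (\<Union>(q ` J)) g = (\<Sum>j\<in>J. hl N (q j) g)"
  using assms(2,3)
proof (induction J rule: finite_induct)
  case (insert j J)
  then have "q j \<inter> \<Union>(q ` J) = {}" by blast
  then show ?case using insert by (simp add: hl_Un[OF assms(1)])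
qed (simp add: hl_def)

lemma dir_scale: "y \<in> face_dir V E F \<Longrightarrow> (\<lambda>e. c * y e) \<in> face_dir V E F"
  by (auto simp: face_dir_def sum_distrib_left[symmetric])

section \<open>Nodes and edges of the contraction\<close>

lemma flpD:
  assumes "face_laminar_pair V E F L"
  shows "pm_face V E F" "laminar L" "\<And>v. v \<in> V \<Longrightarrow> {v} \<in> L" "L \<subseteq> tight F"
    "\<And>S. S \<in> L \<Longrightarrow> S \<subseteq> V" "\<And>S. S \<in> L \<Longrightarrow> S \<noteq> {}" "\<And>S. S \<in> L \<Longrightarrow> finite S" "finite L"
proof -
  show L: "pm_face V E F" "laminar L" "\<And>v. v \<in> V \<Longrightarrow> {v} \<in> L" "L \<subseteq> tight F"
    using assms by (auto simp: face_laminar_pair_def)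
  then show sub: "\<And>S. S \<in> L \<Longrightarrow> S \<subseteq> V" by (auto simp: face_tight_def odd_sets_def)
  show "\<And>S. S \<in> L \<Longrightarrow> S \<noteq> {}" using L(4) by (auto simp: face_tight_def odd_sets_def)
  show "\<And>S. S \<in> L \<Longrightarrow> finite S" using sub fin(1) finite_subset by blast
  have "L \<subseteq> Pow V" using sub by blast
  then show "finite L" using fin(1) finite_subset by blast
qed

lemma laminarD: "laminar L \<Longrightarrow> S \<in> L \<Longrightarrow> T \<in> L \<Longrightarrow> S \<inter> T = {} \<or> S \<subseteq> T \<or> T \<subseteq> S"
  unfolding laminar_def crossing_def by blast

lemma nodesD: "U \<in> contraction_nodes L \<mu> \<Longrightarrow> U \<in> L" "U \<in> contraction_nodes L \<mu> \<Longrightarrow> real (card U) \<le> \<mu>"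
  "U \<in> contraction_nodes L \<mu> \<Longrightarrow> T \<in> L \<Longrightarrow> real (card T) \<le> \<mu> \<Longrightarrow> U \<subseteq> T \<Longrightarrow> T = U"
  by (auto simp: contraction_nodes_def)

lemma node_superset:
  assumes L: "face_laminar_pair V E F L" and S: "S \<in> L" "real (card S) \<le> \<mu>"
  obtains U where "U \<in> contraction_nodes L \<mu>" "S \<subseteq> U"
proof -
  define P where "P T \<longleftrightarrow> T \<in> L \<and> real (card T) \<le> \<mu> \<and> S \<subseteq> T" for T
  have "card T < Suc (card V)" if "P T" for T
    using that flpD(5)[OF L] fin(1) by (auto simp: P_def intro!: card_mono le_imp_less_Suc)
  moreover have "P S" using S by (simp add: P_def)
  ultimately obtain U where U: "P U" "\<And>T. P T \<Longrightarrow> card T \<le> card U"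
    using ex_has_greatest_nat[of P S card "Suc (card V)"] by blast
  have "U \<in> contraction_nodes L \<mu>"
    unfolding contraction_nodes_def
  proof (intro CollectI conjI ballI impI notI)
    fix T assume T: "T \<in> L" "real (card T) \<le> \<mu>" "U \<subset> T"
    then have "P T" using U by (auto simp: P_def)
    moreover have "card U < card T" using T flpD(7)[OF L] by (intro psubset_card_mono) auto
    ultimately show False using U(2) by fastforce
  qed (use U in \<open>auto simp: P_def\<close>)
  then show thesis using that U by (auto simp: P_def)
qed

lemma node_of:
  assumes L: "face_laminar_pair V E F L" and "1 \<le> \<mu>" "v \<in> V"
  obtains U where "U \<in> contraction_nodes L \<mu>" "v \<in> U"
  using node_superset[OF L flpD(3)[OF L assms(3)], of \<mu>] assms(2) by auto

lemma node_unique: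
  assumes L: "face_laminar_pair V E F L" and U: "U \<in> contraction_nodes L \<mu>" "W \<in> contraction_nodes L \<mu>" "U \<inter> W \<noteq> {}"
  shows "U = W"
  using laminarD[OF flpD(2)[OF L] nodesD(1)[OF U(1)] nodesD(1)[OF U(2)]] U nodesD by blast

lemma node_big:
  assumes L: "face_laminar_pair V E F L" and U: "U \<in> contraction_nodes L \<mu>" and T: "T \<in> L" "\<mu> < real (card T)"
  shows "T \<inter> U = {} \<or> U \<subseteq> T"
proof -
  have "\<not> T \<subseteq> U"
  proof
    assume "T \<subseteq> U"
    then have "card T \<le> card U" using flpD(7)[OF L nodesD(1)[OF U]] by (rule card_mono[rotated])
    then show False using nodesD(2)[OF U] T by linarith
  qed
  then show ?thesis using laminarD[OF flpD(2)[OF L] T(1) nodesD(1)[OF U]] by blast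
qed

lemma node_small:
  assumes L: "face_laminar_pair V E F L" and U: "U \<in> contraction_nodes L \<mu>" and T: "T \<in> L" "real (card T) \<le> \<mu>"
  shows "T \<inter> U = {} \<or> T \<subseteq> U"
  using laminarD[OF flpD(2)[OF L] T(1) nodesD(1)[OF U]] nodesD(3)[OF U T] by blast

lemma con_simps:
  "mg_nodes (contraction E F L \<mu>) = contraction_nodes L \<mu>"
  "mg_ends (contraction E F L \<mu>) e = {S \<in> contraction_nodes L \<mu>. e \<inter> S \<noteq> {}}"
  "mg_weight (contraction E F L \<mu>) = card"
  "e \<in> mg_edges (contraction E F L \<mu>) \<longleftrightarrow> e \<in> supp F \<and> (\<forall>T\<in>L. \<mu> < real (card T) \<longrightarrow> e \<notin> cut E T) \<and>
     (\<forall>S\<in>contraction_nodes L \<mu>. \<not> e \<subseteq> S)"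
  by (auto simp: contraction_def)

lemma supp_E: "e \<in> supp F \<Longrightarrow> e \<in> E"
  by (simp add: face_supp_def)

lemma ends_eq:
  assumes L: "face_laminar_pair V E F L" and e: "e \<in> E"
    and U: "U \<in> contraction_nodes L \<mu>" "W \<in> contraction_nodes L \<mu>" "U \<noteq> W" "e \<inter> U \<noteq> {}" "e \<inter> W \<noteq> {}"
  shows "mg_ends (contraction E F' L \<mu>) e = {U, W}" "e \<subseteq> U \<union> W" "e \<in> cut E U" "e \<in> cut E W"
proof -
  have dj: "U \<inter> W = {}" using node_unique[OF L U(1,2)] U(3) by blast
  from fin(4)[OF e] obtain a b where ab: "e = {a, b}" "a \<noteq> b" by (rule card_eq_2E)
  show sub: "e \<subseteq> U \<union> W" using U dj by (auto simp: ab)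
  have "S = U \<or> S = W" if "S \<in> contraction_nodes L \<mu>" "e \<inter> S \<noteq> {}" for S
    using that sub node_unique[OF L that(1) U(1)] node_unique[OF L that(1) U(2)] by blast
  then show "mg_ends (contraction E F' L \<mu>) e = {U, W}" unfolding con_simps using U by blast
  show "e \<in> cut E U" "e \<in> cut E W" unfolding mem_cut[OF e] using U dj by blast+
qed

lemma edge_ends:
  assumes L: "face_laminar_pair V E F L" and \<mu>: "1 \<le> \<mu>"
    and e: "e \<in> mg_edges (contraction E F' L \<mu>)" "mg_ends (contraction E F' L \<mu>) e = {U, W}"
  shows "U \<in> contraction_nodes L \<mu>" "W \<in> contraction_nodes L \<mu>" "U \<noteq> W" "U \<inter> W = {}" "e \<subseteq> U \<union> W"
    "e \<in> cut E U" "e \<in> cut E W"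
proof -
  have eE: "e \<in> E" using e(1) supp_E unfolding con_simps by blast
  from fin(4)[OF eE] obtain a b where ab: "e = {a, b}" "a \<noteq> b" by (rule card_eq_2E)
  have "a \<in> V" "b \<in> V" using fin(3)[OF eE] ab by auto
  then obtain A B where A: "A \<in> contraction_nodes L \<mu>" "a \<in> A" and B: "B \<in> contraction_nodes L \<mu>" "b \<in> B"
    using node_of[OF L \<mu>] by metis
  have "A \<noteq> B" using e(1) A B ab by (auto simp: con_simps)
  note * = ends_eq[OF L eE A(1) B(1) this]
  have AB: "{U, W} = {A, B}" using *(1) e(2) A B ab by auto
  then have "U = A \<and> W = B \<or> U = B \<and> W = A" by (auto simp: doubleton_eq_iff)
  moreover have "A \<inter> B = {}" using node_unique[OF L A(1) B(1)] \<open>A \<noteq> B\<close> by blast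
  ultimately show "U \<in> contraction_nodes L \<mu>" "W \<in> contraction_nodes L \<mu>" "U \<noteq> W" "U \<inter> W = {}" "e \<subseteq> U \<union> W"
    "e \<in> cut E U" "e \<in> cut E W"
    using *(2,3,4) A B ab \<open>A \<noteq> B\<close> by auto
qed

section \<open>Lifts regrouped by visited nodes, and circuits from two matchings\<close>

lemma lift_esum:
  assumes L: "face_laminar_pair V E F L" and \<mu>: "1 \<le> \<mu>" and ch: "chain (contraction E F L \<mu>) xs v"
  shows "lift F L \<mu> (map snd xs) g = esum (\<lambda>e u. hl (rep F e) u g) xs v"
  using ch
proof (induction xs)
  case (Cons x xs)
  then have x: "snd x \<in> mg_edges (contraction E F L \<mu>)"
    "mg_ends (contraction E F L \<mu>) (snd x) = {fst x, hdn xs v}" by auto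
  have "snd x \<in> supp F" using x(1) by (simp add: con_simps)
  then have "rep F (snd x) \<subseteq> E" using rep[OF flpD(1)[OF L]] PM_D(3) by blast
  then have "hl (rep F (snd x)) (\<Union>(mg_ends (contraction E F L \<mu>) (snd x))) g =
    hl (rep F (snd x)) (fst x) g + hl (rep F (snd x)) (hdn xs v) g"
    unfolding x(2) using edge_ends(4)[OF L \<mu> x] by (simp add: hl_Un)
  then show ?case using Cons by (simp add: lift_def)
qed (simp add: lift_def)

lemma lift_vsum:
  assumes L: "face_laminar_pair V E F L" and \<mu>: "1 \<le> \<mu>" and xs: "circuit (contraction E F L \<mu>) xs"
  shows "lift F L \<mu> (map snd xs) g = vsum (\<lambda>e u. hl (rep F e) u g) (snd (last xs)) xs"
  using xs lift_esum[OF L \<mu>, of xs "fst (hd xs)" g] esum_closed[of xs] by (simp add: circuit_def)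

lemma rep_hl:
  assumes L: "face_laminar_pair V E F L"
    and contr: "\<And>S. S \<in> L \<Longrightarrow> real (card S) \<le> \<mu> \<Longrightarrow> contractible V E F S"
    and N: "N \<in> PM F" and U: "U \<in> contraction_nodes L \<mu>"
  shows "hl (rep F (bd N U)) U = hl N U"
proof -
  have Ut: "U \<in> tight F" using nodesD(1)[OF U] flpD(4)[OF L] by blast
  note b = bd[OF Ut N]
  have "bd N U \<in> supp F" using b(1) matching_in_supp[OF N] by blast
  note r = rep[OF flpD(1)[OF L] this]
  show ?thesis using contractible_hl[OF contr[OF nodesD(1,2)[OF U]] _ N _ b(1) b(2)] r by blast
qed

lemma card_UN_nodes:
  fixes m :: nat
  assumes L: "face_laminar_pair V E F L" and inj: "inj_on q {..<m}"
    and q: "\<And>i. i < m \<Longrightarrow> q i \<in> contraction_nodes L \<mu>"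
  shows "card (\<Union>(q ` {..<m})) = (\<Sum>i<m. card (q i))"
    and "\<And>i j. i < m \<Longrightarrow> j < m \<Longrightarrow> i \<noteq> j \<Longrightarrow> q i \<inter> q j = {}"
proof -
  show dj: "q i \<inter> q j = {}" if "i < m" "j < m" "i \<noteq> j" for i j
    using node_unique[OF L q[OF that(1)] q[OF that(2)]] inj that by (auto simp: inj_on_def)
  show "card (\<Union>(q ` {..<m})) = (\<Sum>i<m. card (q i))"
    using dj flpD(7)[OF L nodesD(1)[OF q]] by (intro card_UN_disjoint) auto
qed

text \<open>Following the two matchings alternately through the nodes at which they leave by different
  edges gives a circuit whose lift is twice the difference of two matchings of \<open>F'\<close>.\<close>

lemma region_agree:
  assumes L: "face_laminar_pair V E F L" and \<mu>: "1 \<le> \<mu>"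
    and contr: "\<And>S. S \<in> L \<Longrightarrow> real (card S) \<le> \<mu> \<Longrightarrow> contractible V E F S"
    and F': "pm_face V E F'" "F' \<subseteq> F"
    and kill: "\<And>xs. circuit (contraction E F L \<mu>) xs \<Longrightarrow> real (nwt (contraction E F L \<mu>) xs) \<le> \<nu> \<Longrightarrow>
      (\<lambda>g. real_of_int (lift F L \<mu> (map snd xs) g)) \<notin> face_dir V E F'"
    and N: "N1 \<in> PM F'" "N2 \<in> PM F'"
    and Q0: "Q0 \<subseteq> contraction_nodes L \<mu>" "D = \<Union>Q0" "real (card D) \<le> \<nu>"
    and D: "\<And>g. g \<in> (N1 - N2) \<union> (N2 - N1) \<Longrightarrow> g \<inter> D \<noteq> {} \<Longrightarrow>
      g \<subseteq> D \<and> (\<forall>T\<in>L. \<mu> < real (card T) \<longrightarrow> g \<notin> cut E T)"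
  shows "touching N1 D = touching N2 D"
proof (rule ccontr)
  assume neq: "touching N1 D \<noteq> touching N2 D"
  let ?H = "contraction E F L \<mu>"
  have NF: "N1 \<in> PM F" "N2 \<in> PM F" using N matchings_mono[OF F'(2)] by blast+
  have NE: "N1 \<subseteq> E" "N2 \<subseteq> E" using PM_D(3) N by blast+
  have Qt: "U \<in> tight F" if "U \<in> Q0" for U using that Q0 nodesD(1) flpD(4)[OF L] by blast
  define Q where "Q = {U\<in>Q0. bd N1 U \<noteq> bd N2 U}"
  have "finite Q0" using Q0 nodesD(1) flpD(8)[OF L] finite_subset by (metis subsetI)
  then have finQ: "finite Q" by (simp add: Q_def)
  have eqU: "touching N1 U = touching N2 U" if U: "U \<in> Q0" "U \<notin> Q" for U
  proof -
    have "bd N1 U = bd N2 U" using U by (simp add: Q_def)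
    then have "bd N1 U \<in> N2" using bd(1)[OF Qt[OF U(1)] NF(2)] by simp
    moreover have "U \<in> contraction_nodes L \<mu>" using U(1) Q0(1) by blast
    ultimately show ?thesis
      using contractible_touching[OF contr NF bd(1)[OF Qt[OF U(1)] NF(1)] _ bd(2)[OF Qt[OF U(1)] NF(1)]] nodesD(1,2)
      by blast
  qed
  have "Q \<noteq> {}"
  proof
    assume "Q = {}"
    then have "\<forall>U\<in>Q0. touching N1 U = touching N2 U" using eqU by blast
    then have "touching N1 D = touching N2 D" unfolding Q0(2) touching_def by blast
    then show False using neq by simp
  qed
  then obtain a where a: "a \<in> Q" by blast
  \<comment> \<open>The partner of \<open>U\<close> is the other node met by its boundary edge in
    \<open>N\<close>. Hypothesis \<open>D\<close> keeps this edge inside the region, and the partner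
    lies in \<open>Q\<close> again, because the edge belongs to only one of the two
    matchings.\<close>
  define p where "p N U = (SOME W. W \<in> Q0 \<and> W \<noteq> U \<and> bd N U \<inter> W \<noteq> {})" for N U
  have step: "p N U \<in> Q \<and> p N U \<noteq> U \<and> bd N (p N U) = bd N U \<and> p N (p N U) = U \<and> bd N U \<notin> M \<and>
      bd N U \<in> mg_edges ?H \<and> mg_ends ?H (bd N U) = {U, p N U}"
    if NM: "N = N1 \<and> M = N2 \<or> N = N2 \<and> M = N1" and U: "U \<in> Q" for N M U
  proof -
    have NMF: "N \<in> PM F" "M \<in> PM F" using NM NF by auto
    have QE: "bd N W \<noteq> bd M W \<longleftrightarrow> bd N1 W \<noteq> bd N2 W" for W using NM by auto
    have U0: "U \<in> Q0" "bd N U \<noteq> bd M U" using U QE by (auto simp: Q_def)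
    note b = bd[OF Qt[OF U0(1)] NMF(1)]
    have nM: "bd N U \<notin> M" using bd(3)[OF Qt[OF U0(1)] NMF(2) _ b(2)] U0(2) by blast
    have bE: "bd N U \<in> E" using b(1) NE NM by blast
    have bU: "bd N U \<inter> U \<noteq> {}" "\<not> bd N U \<subseteq> U" using b(2) mem_cut[OF bE] by auto
    have "bd N U \<inter> D \<noteq> {}" using bU U0 Q0(2) by blast
    moreover have "bd N U \<in> (N1 - N2) \<union> (N2 - N1)" using NM b(1) nM by blast
    ultimately have bD: "bd N U \<subseteq> D" "\<forall>T\<in>L. \<mu> < real (card T) \<longrightarrow> bd N U \<notin> cut E T" using D by blast+
    then obtain z where z: "z \<in> bd N U" "z \<notin> U" "z \<in> D" using bU by blast
    then obtain W0 where "W0 \<in> Q0" "z \<in> W0" using Q0(2) by blast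
    then have "\<exists>W. W \<in> Q0 \<and> W \<noteq> U \<and> bd N U \<inter> W \<noteq> {}" using z by blast
    then have W: "p N U \<in> Q0" "p N U \<noteq> U" "bd N U \<inter> p N U \<noteq> {}"
      unfolding p_def by (metis (mono_tags, lifting) someI_ex)+
    let ?W = "p N U"
    have nodes: "U \<in> contraction_nodes L \<mu>" "?W \<in> contraction_nodes L \<mu>" using W U0 Q0 by auto
    note en = ends_eq[OF L bE nodes W(2)[symmetric] bU(1) W(3)]
    have bW: "bd N ?W = bd N U" using bd(3)[OF Qt[OF W(1)] NMF(1) b(1) en(4)] by simp
    have "bd M ?W \<noteq> bd N ?W" using bd(1)[OF Qt[OF W(1)] NMF(2)] nM bW by metis
    then have WQ: "?W \<in> Q" using W QE by (auto simp: Q_def)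
    have "\<exists>S. S \<in> Q0 \<and> S \<noteq> ?W \<and> bd N ?W \<inter> S \<noteq> {}" using U0 W bU bW by metis
    then have S: "p N ?W \<in> Q0" "p N ?W \<noteq> ?W" "bd N ?W \<inter> p N ?W \<noteq> {}"
      unfolding p_def[of N ?W] by (metis (mono_tags, lifting) someI_ex)+
    have "p N ?W \<in> mg_ends ?H (bd N U)" using S Q0(1) bW by (auto simp: con_simps)
    then have "p N ?W = U" using en(1) S(2) by blast
    moreover have "bd N U \<in> mg_edges ?H"
      unfolding con_simps
    proof (intro conjI ballI)
      show "bd N U \<in> supp F" using b(1) matching_in_supp[OF NMF(1)] by blast
      show "\<mu> < real (card T) \<longrightarrow> bd N U \<notin> cut E T" if "T \<in> L" for T using bD that by blast
      fix S assume "S \<in> contraction_nodes L \<mu>"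
      then show "\<not> bd N U \<subseteq> S" using node_unique[OF L _ nodes(1), of S] bU by blast
    qed
    ultimately show ?thesis using WQ W(2) bW nM en(1) by blast
  qed
  have P1: "p N1 x \<in> Q \<and> p N1 (p N1 x) = x \<and> p N1 x \<noteq> x" if "x \<in> Q" for x using step[of N1 N2 x] that by blast
  have P2: "p N2 x \<in> Q \<and> p N2 (p N2 x) = x \<and> p N2 x \<noteq> x" if "x \<in> Q" for x using step[of N2 N1 x] that by blast
  obtain q m where q: "q 0 = a" "0 < m" "even m" "q m = a" "\<And>i. q i \<in> Q" "inj_on q {..<m}"
    and qS: "\<And>i. q (Suc i) = (if even i then p N1 (q i) else p N2 (q i))"
    using alternating_orbit[OF finQ P1 P2 a] by blast
  \<comment> \<open>\<open>G j\<close> enters and \<open>G (Suc j)\<close> leaves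
    \<open>q j\<close>. At even indices the walk leaves along \<open>N1\<close>, at odd ones along
    \<open>N2\<close>; the value at 0 is the edge that closes the walk.\<close>
  define G where "G j = (if j = 0 then bd N2 a else if even (j - 1) then bd N1 (q (j - 1)) else bd N2 (q (j - 1)))" for j
  have G1: "G (Suc j) = (if even j then bd N1 (q j) else bd N2 (q j))" for j by (simp add: G_def)
  have G2: "G j = (if even j then bd N2 (q j) else bd N1 (q j))" for j
  proof (cases j)
    case 0
    then show ?thesis by (simp add: G_def q)
  next
    case (Suc i)
    then show ?thesis using step[of N1 N2 "q i"] step[of N2 N1 "q i"] q(5)[of i] qS[of i] by (auto simp: G1)
  qed
  define xs where "xs = map (\<lambda>j. (q j, G (Suc j))) [0..<m]"
  have nodes: "q i \<in> contraction_nodes L \<mu>" for i using q(5)[of i] Q0 by (auto simp: Q_def)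
  have xs0: "xs \<noteq> []" "length xs = m" using q by (auto simp: xs_def)
  have hd: "fst (hd xs) = a" using q by (simp add: xs_def hd_map)
  have ch: "chain ?H xs a"
    unfolding chain_nth
  proof (intro allI impI conjI)
    fix i assume i: "i < length xs"
    then have xi: "xs ! i = (q i, G (Suc i))" using xs0 by (simp add: xs_def)
    have nx: "(map fst xs @ [a]) ! Suc i = q (Suc i)"
    proof (cases "Suc i = m")
      case True
      then show ?thesis using xs0 q by (simp add: nth_append)
    next
      case False
      then show ?thesis using xs0 i by (simp add: nth_append xs_def)
    qed
    have s: "G (Suc i) \<in> mg_edges ?H \<and> mg_ends ?H (G (Suc i)) = {q i, q (Suc i)}"
      using step[of N1 N2 "q i"] step[of N2 N1 "q i"] q(5)[of i] qS[of i] by (auto simp: G1)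
    then show "fst (xs ! i) \<in> mg_nodes ?H" "snd (xs ! i) \<in> mg_edges ?H"
      "mg_ends ?H (snd (xs ! i)) = {fst (xs ! i), (map fst xs @ [a]) ! Suc i}"
      using nodes xi nx by (auto simp: con_simps)
  qed
  \<comment> \<open>At odd positions the walk uses edges of \<open>N2\<close>, so the edge
    \<open>bd N1 a\<close>, which is not in \<open>N2\<close>, occurs only with positive
    sign.\<close>
  have chi0: "chi (map snd xs) (bd N1 a) \<noteq> 0"
  proof -
    have ms: "map snd xs = map (\<lambda>j. G (Suc j)) [0..<m]" by (simp add: xs_def comp_def)
    have "chi (map snd xs) (bd N1 a) = (\<Sum>i<m. (-1) ^ i * of_bool (G (Suc i) = bd N1 a))"
      unfolding chi_def alt_conv_sum ms by simp
    moreover have "(1::int) \<le> (\<Sum>i<m. (-1) ^ i * of_bool (G (Suc i) = bd N1 a))"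
    proof -
      have "0 \<le> (-1::int) ^ i * of_bool (G (Suc i) = bd N1 a)" if "i < m" for i
      proof (cases "even i")
        case False
        then have "G (Suc i) \<in> N2" using bd(1)[OF Qt NF(2), of "q i"] q(5)[of i] by (simp add: G1 Q_def)
        moreover have "bd N1 a \<notin> N2" using step[of N1 N2 a] a by blast
        ultimately show ?thesis by auto
      qed simp
      then have "(-1::int) ^ 0 * of_bool (G (Suc 0) = bd N1 a) \<le> (\<Sum>i<m. (-1) ^ i * of_bool (G (Suc i) = bd N1 a))"
        using q(2) by (intro member_le_sum) auto
      then show ?thesis by (simp add: G1 q(1))
    qed
    ultimately show ?thesis by linarith
  qed
  have circ: "circuit ?H xs"
    unfolding circuit_def using xs0 q(3) ch hd chi0 by (auto simp: fun_eq_iff)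
  define P where "P = \<Union>(q ` {..<m})"
  have dj: "\<And>i j. i < m \<Longrightarrow> j < m \<Longrightarrow> i \<noteq> j \<Longrightarrow> q i \<inter> q j = {}"
    and cP: "card P = (\<Sum>i<m. card (q i))"
    using card_UN_nodes[OF L q(6) nodes] by (auto simp: P_def)
  have PD: "P \<subseteq> D" using q(5) Q0(2) by (auto simp: P_def Q_def)
  have "D \<subseteq> V" using Q0 nodesD(1) flpD(5)[OF L] by blast
  then have finD: "finite D" using fin(1) finite_subset by blast
  have "nwt ?H xs = card P"
    unfolding nwt_def xs_def cP con_simps by (simp add: comp_def sum_list_sum_nth atLeast0LessThan)
  then have wt: "real (nwt ?H xs) \<le> \<nu>" using card_mono[OF finD PD] Q0(3) by linarith
  have lift: "lift F L \<mu> (map snd xs) g = hl N1 P g - hl N2 P g" for g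
  proof -
    have "snd (last xs) = G m" using q(2) by (cases m) (simp_all add: xs_def)
    moreover have "G m = G 0" using G2[of m] q by (simp add: G_def)
    ultimately have "lift F L \<mu> (map snd xs) g = vsum (\<lambda>e u. hl (rep F e) u g) (G 0) xs"
      using lift_vsum[OF L \<mu> circ] by simp
    also have "\<dots> = (\<Sum>j<m. (-1) ^ j * (hl (rep F (G (Suc j))) (q j) g - hl (rep F (G j)) (q j) g))"
      unfolding xs_def by (rule vsum_index)
    also have "\<dots> = (\<Sum>j<m. hl N1 (q j) g - hl N2 (q j) g)"
    proof (intro sum.cong refl)
      fix j
      note h = rep_hl[OF L contr NF(1) nodes[of j]] rep_hl[OF L contr NF(2) nodes[of j]]
      show "(-1) ^ j * (hl (rep F (G (Suc j))) (q j) g - hl (rep F (G j)) (q j) g) = hl N1 (q j) g - hl N2 (q j) g"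
        unfolding G1 unfolding G2[of j] using h by (cases "even j") auto
    qed
    also have "\<dots> = hl N1 P g - hl N2 P g"
      unfolding P_def using hl_UN[OF NE(1), of "{..<m}" q g] hl_UN[OF NE(2), of "{..<m}" q g] dj
      by (simp add: sum_subtractf)
    finally show ?thesis .
  qed
  \<comment> \<open>The orbit is closed under both partner maps: one leads to the next node and the
    other to the previous one. So no edge of either matching leaves \<open>P\<close>.\<close>
  have closed: "g \<subseteq> P \<or> g \<inter> P = {}" if g: "g \<in> N1 \<union> N2" for g
  proof (rule disjCI)
    assume "g \<inter> P \<noteq> {}"
    then obtain i where i: "i < m" "g \<inter> q i \<noteq> {}" by (auto simp: P_def)
    have qi: "q i \<in> Q0" "q i \<in> Q" using q(5)[of i] by (auto simp: Q_def)
    have clP: "p N1 (q i) \<subseteq> P \<and> p N2 (q i) \<subseteq> P"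
    proof -
      have nxt: "q (Suc i) \<in> q ` {..<m}"
      proof (cases "Suc i = m")
        case True
        then show ?thesis using q by (metis imageI lessThan_iff)
      next
        case False
        then show ?thesis using i by auto
      qed
      have prv: "\<exists>k<m. q (Suc k) = q i \<and> even k \<noteq> even i"
      proof (cases i)
        case 0
        then show ?thesis using q by (intro exI[of _ "m - 1"]) auto
      next
        case (Suc k)
        then show ?thesis using i by (intro exI[of _ k]) auto
      qed
      then obtain k where k: "k < m" "q (Suc k) = q i" "even k \<noteq> even i" by blast
      have "q k \<in> q ` {..<m}" using k by auto
      moreover have "q k = (if even k then p N1 (q i) else p N2 (q i))"
        using qS[of k] k P1[OF q(5)[of k]] P2[OF q(5)[of k]] by auto
      ultimately show ?thesis using nxt qS[of i] k(3) by (cases "even i") (auto simp: P_def)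
    qed
    have "g \<subseteq> q i \<or> g = bd N1 (q i) \<or> g = bd N2 (q i)"
      using g touching_cases[OF Qt[OF qi(1)] NF(1) _ i(2)] touching_cases[OF Qt[OF qi(1)] NF(2) _ i(2)] by blast
    moreover have "bd N1 (q i) \<subseteq> q i \<union> p N1 (q i)"
    proof (rule edge_ends(5)[OF L \<mu>])
      show "bd N1 (q i) \<in> mg_edges ?H" "mg_ends ?H (bd N1 (q i)) = {q i, p N1 (q i)}"
        using step[of N1 N2 "q i"] qi(2) by simp_all
    qed
    moreover have "bd N2 (q i) \<subseteq> q i \<union> p N2 (q i)"
    proof (rule edge_ends(5)[OF L \<mu>])
      show "bd N2 (q i) \<in> mg_edges ?H" "mg_ends ?H (bd N2 (q i)) = {q i, p N2 (q i)}"
        using step[of N2 N1 "q i"] qi(2) by simp_all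
    qed
    moreover have "q i \<subseteq> P" using i by (auto simp: P_def)
    ultimately show "g \<subseteq> P" using clP by blast
  qed
  \<comment> \<open>On \<open>P\<close> both end points of every matching edge are counted, hence
    the factor 2 between the lift and the difference of \<open>N1\<close> and
    \<open>N3\<close>.\<close>
  define N3 where "N3 = swap_on P N1 N2"
  have N3: "N3 \<in> PM F'" unfolding N3_def using closed by (intro swap_in_face[OF F'(1) N]) blast
  have eq: "real_of_int (lift F L \<mu> (map snd xs) g) = 2 * (indicator N1 g - indicator N3 g)" for g
  proof (cases "g \<inter> P = {}")
    case True
    then show ?thesis unfolding lift by (auto simp: hl_def N3_def swap_on_def indicator_def)
  next
    case False
    then have "card (g \<inter> P) = 2" if "g \<in> N1 \<union> N2"
      using closed[OF that] fin(4) NE that by (metis Int_absorb2 Un_iff subsetD)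
    then show ?thesis unfolding lift using False by (auto simp: hl_def N3_def swap_on_def indicator_def)
  qed
  have "(\<lambda>g. 2 * (indicator N1 g - indicator N3 g)) \<in> face_dir V E F'"
    by (rule dir_scale[OF diff_in_dir[OF PM_D(2)[OF N(1)] PM_D(2)[OF N3] face_polytope[OF F'(1)]]])
  with kill[OF circ wt, unfolded eq] show False by (rule notE)
qed

end

section \<open>Alternating paths through a node\<close>

lemma alternating_orbit_closed:
  fixes p q :: "'b \<Rightarrow> 'b"
  assumes p: "\<And>x. x \<in> Q \<Longrightarrow> p (p x) = x" and q: "\<And>x. x \<in> Q \<Longrightarrow> q (q x) = x"
    and v: "0 < m" "even m" "v m = v 0" "\<And>i. v i \<in> Q"
      "\<And>i. v (Suc i) = (if even i then p (v i) else q (v i))"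
    and i: "i < m"
  shows "p (v i) \<in> v ` {..<m}" "q (v i) \<in> v ` {..<m}"
proof -
  have nxt: "v (Suc i) \<in> v ` {..<m}"
  proof (cases "Suc i = m")
    case True
    then show ?thesis using v by (metis imageI lessThan_iff)
  next
    case False
    then show ?thesis using i by auto
  qed
  have "\<exists>k<m. v (Suc k) = v i \<and> even k \<noteq> even i"
  proof (cases i)
    case 0
    then show ?thesis using v by (intro exI[of _ "m - 1"]) auto
  next
    case (Suc k)
    then show ?thesis using i by (intro exI[of _ k]) auto
  qed
  then obtain k where k: "k < m" "v (Suc k) = v i" "even k \<noteq> even i" by blast
  have "v k \<in> v ` {..<m}" using k by auto
  moreover have "v k = (if even k then p (v i) else q (v i))"
    using v(5)[of k] k p[OF v(4)[of k]] q[OF v(4)[of k]] by auto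
  ultimately show "p (v i) \<in> v ` {..<m}" "q (v i) \<in> v ` {..<m}"
    using nxt v(5)[of i] k(3) by (cases "even i"; auto)+
qed

lemma vsum_edge_independent: "vsum (\<lambda>e u. c u) e0 xs = 0"
  by (induction xs arbitrary: e0) auto

lemma sum_alt: "(\<Sum>g\<in>A. alt (f g) es) = alt (\<lambda>e. \<Sum>g\<in>A. f g e) es"
  by (induction es) (auto simp: sum_subtractf)

text \<open>\<open>pc e1 U e2\<close> is to be a walk inside \<open>U\<close> that replaces a visit
  of \<open>U\<close> entered by \<open>e1\<close> and left by \<open>e2\<close>.\<close>

fun expand :: "('e \<Rightarrow> 'm \<Rightarrow> 'e \<Rightarrow> ('n \<times> 'e) list) \<Rightarrow> 'e \<Rightarrow> ('m \<times> 'e) list \<Rightarrow> ('n \<times> 'e) list" where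
  "expand pc e0 [] = []"
| "expand pc e0 (x # xs) = pc e0 (fst x) (snd x) @ expand pc (snd x) xs"

context sgraph
begin

lemma cut_one_end: "g \<in> cut E S \<Longrightarrow> a \<in> g \<inter> S \<Longrightarrow> b \<in> g \<inter> S \<Longrightarrow> a = b"
proof -
  assume "g \<in> cut E S" and ab: "a \<in> g \<inter> S" "b \<in> g \<inter> S"
  then have "card (g \<inter> S) = 1" by (simp add: cut_def)
  then obtain x where x: "g \<inter> S = {x}" by (rule card_1_singletonE)
  show "a = b" using ab[unfolded x] by simp
qed

text \<open>As in \<open>region_agree\<close>, but along the orbit through an additional node \<open>None\<close> that stands for the
  complement of \<open>U\<close>: it leads through \<open>U\<close> from \<open>e1\<close> to \<open>e2\<close>.\<close>

lemma path_piece: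
  assumes L: "face_laminar_pair V E F L" and \<mu>: "1 \<le> \<mu>"
    and contr: "\<And>S. S \<in> L \<Longrightarrow> real (card S) \<le> \<mu> \<Longrightarrow> contractible V E F S"
    and F2: "pm_face V E F2" "F2 \<subseteq> F"
    and U: "contractible V E F2 U"
    and cover: "\<And>v. v \<in> U \<Longrightarrow> \<exists>q\<in>contraction_nodes L \<mu>. v \<in> q \<and> q \<subseteq> U"
    and big: "\<And>T. T \<in> L \<Longrightarrow> \<mu> < real (card T) \<Longrightarrow> U \<subseteq> T \<or> U \<inter> T = {}"
    and N: "N1 \<in> PM F2" "N2 \<in> PM F2"
    and e: "e1 \<in> N1" "e1 \<in> cut E U" "e2 \<in> N2" "e2 \<in> cut E U"
  shows "\<exists>xs. xs \<noteq> [] \<and> odd (length xs) \<and> snd (last xs) = e2 \<and>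
    chain (contraction E F L \<mu>) (butlast xs) (fst (last xs)) \<and>
    fst ` set xs \<subseteq> {q \<in> contraction_nodes L \<mu>. q \<subseteq> U} \<and> e1 \<inter> fst (hd xs) \<noteq> {} \<and> e2 \<inter> fst (last xs) \<noteq> {} \<and>
    (\<forall>x\<in>set (butlast xs). snd x \<subseteq> U) \<and> nwt (contraction E F L \<mu>) xs \<le> card U \<and>
    (\<forall>g. vsum (\<lambda>e u. hl (rep F e) u g) e1 xs = hl N2 U g - hl N1 U g)"
proof -
  let ?H = "contraction E F L \<mu>"
  have NF: "N1 \<in> PM F" "N2 \<in> PM F" using N matchings_mono[OF F2(2)] by blast+
  have NE: "N1 \<subseteq> E" "N2 \<subseteq> E" using PM_D(3) N by blast+
  have Ut: "U \<in> tight F2" using U by (simp add: contractible_def)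
  have UV: "U \<subseteq> V" using Ut by (auto simp: face_tight_def odd_sets_def)
  have e12: "e1 = bd N1 U" "e2 = bd N2 U" using bd(3)[OF Ut N(1) e(1,2)] bd(3)[OF Ut N(2) e(3,4)] by auto
  define Q0 where "Q0 = {q \<in> contraction_nodes L \<mu>. q \<subseteq> U}"
  have Qn: "q \<in> contraction_nodes L \<mu>" "q \<subseteq> U" if "q \<in> Q0" for q using that by (auto simp: Q0_def)
  have Qt: "q \<in> tight F" if "q \<in> Q0" for q using Qn(1)[OF that] nodesD(1) flpD(4)[OF L] by blast
  have Qex: "\<exists>q\<in>Q0. v \<in> q" if "v \<in> U" for v using cover[OF that] by (auto simp: Q0_def)
  have "Q0 \<subseteq> L" using nodesD(1) by (auto simp: Q0_def)
  then have finQ0: "finite Q0" using flpD(8)[OF L] finite_subset by blast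
  \<comment> \<open>\<open>None\<close> is the partner of the node in which the boundary edge of
    \<open>U\<close> ends; every other node has its partner at the other end of its boundary edge
    inside \<open>U\<close>.\<close>
  define p where "p N x = (case x of None \<Rightarrow> Some (SOME q. q \<in> Q0 \<and> bd N U \<inter> q \<noteq> {})
    | Some q \<Rightarrow> (if bd N q = bd N U then None else Some (SOME W. W \<in> Q0 \<and> W \<noteq> q \<and> bd N q \<inter> W \<noteq> {})))" for N x
  have stepN: "\<exists>q\<in>Q0. p N None = Some q \<and> bd N q = bd N U \<and> bd N U \<inter> q \<noteq> {}" if NN: "N = N1 \<or> N = N2" for N
  proof -
    have N2: "N \<in> PM F2" "N \<in> PM F" using NN N NF by auto
    note b = bd[OF Ut N2(1)]
    have bE: "bd N U \<in> E" using b(2) by (simp add: cut_def)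
    have bU: "bd N U \<inter> U \<noteq> {}" "\<not> bd N U \<subseteq> U" using b(2) mem_cut[OF bE] by auto
    then obtain z where "z \<in> bd N U" "z \<in> U" by blast
    then have ex: "\<exists>q. q \<in> Q0 \<and> bd N U \<inter> q \<noteq> {}" using Qex by blast
    define q where "q = (SOME q. q \<in> Q0 \<and> bd N U \<inter> q \<noteq> {})"
    have q: "p N None = Some q" "q \<in> Q0" "bd N U \<inter> q \<noteq> {}"
      using someI_ex[OF ex] by (simp_all add: p_def q_def)
    have "bd N U \<in> cut E q" unfolding mem_cut[OF bE] using q bU Qn(2) by blast
    then have "bd N q = bd N U" using bd(3)[OF Qt[OF q(2)] N2(2) b(1)] by simp
    then show ?thesis using q by blast
  qed
  \<comment> \<open>The boundary edge of \<open>U\<close> has only one end point in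
    \<open>U\<close>, so only one node can have it as boundary edge; hence \<open>p N\<close> is an
    involution at \<open>None\<close> as well.\<close>
  have conv: "p N None = Some q" if NN: "N = N1 \<or> N = N2" and q: "q \<in> Q0" "bd N q = bd N U" for N q
  proof -
    have N2: "N \<in> PM F2" "N \<in> PM F" using NN N NF by auto
    obtain r where r: "r \<in> Q0" "p N None = Some r" "bd N U \<inter> r \<noteq> {}" using stepN[OF NN] by blast
    have bE: "bd N U \<in> E" using bd(2)[OF Ut N2(1)] by (simp add: cut_def)
    have "bd N U \<in> cut E q" using bd(2)[OF Qt[OF q(1)] N2(2)] q(2) by simp
    then have "bd N U \<inter> q \<noteq> {}" using mem_cut[OF bE] by blast
    then obtain a b where ab: "a \<in> bd N U \<inter> q" "b \<in> bd N U \<inter> r" using r by blast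
    then have "a = b" using cut_one_end[OF bd(2)[OF Ut N2(1)], of a b] Qn(2) q(1) r(1) by blast
    then have "q = r" using node_unique[OF L Qn(1)[OF q(1)] Qn(1)[OF r(1)]] ab by blast
    then show ?thesis using r by simp
  qed
  have stepS: "\<exists>W\<in>Q0. p N (Some q) = Some W \<and> W \<noteq> q \<and> bd N W = bd N q \<and> bd N q \<in> mg_edges ?H \<and>
      mg_ends ?H (bd N q) = {q, W} \<and> bd N q \<subseteq> U \<and> bd N q \<subseteq> q \<union> W \<and> p N (Some W) = Some q"
    if NN: "N = N1 \<or> N = N2" and q: "q \<in> Q0" "bd N q \<noteq> bd N U" for N q
  proof -
    have N2: "N \<in> PM F2" "N \<in> PM F" using NN N NF by auto
    note b = bd[OF Qt[OF q(1)] N2(2)]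
    have bE: "bd N q \<in> E" using b(2) by (simp add: cut_def)
    have bq: "bd N q \<inter> q \<noteq> {}" "\<not> bd N q \<subseteq> q" using b(2) mem_cut[OF bE] by auto
    have "bd N q \<inter> U \<noteq> {}" using bq Qn(2)[OF q(1)] by blast
    then have bU: "bd N q \<subseteq> U" using touching_cases[OF Ut N2(1) b(1)] q(2) by blast
    then obtain z where z: "z \<in> bd N q" "z \<notin> q" "z \<in> U" using bq by blast
    then obtain W0 where "W0 \<in> Q0" "z \<in> W0" using Qex by blast
    then have ex: "\<exists>W. W \<in> Q0 \<and> W \<noteq> q \<and> bd N q \<inter> W \<noteq> {}" using z by blast
    define W where "W = (SOME W. W \<in> Q0 \<and> W \<noteq> q \<and> bd N q \<inter> W \<noteq> {})"
    have W: "W \<in> Q0" "W \<noteq> q" "bd N q \<inter> W \<noteq> {}" "p N (Some q) = Some W"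
      using someI_ex[OF ex] q(2) by (simp_all add: p_def W_def)
    note en = ends_eq[OF L bE Qn(1)[OF q(1)] Qn(1)[OF W(1)] W(2)[symmetric] bq(1) W(3)]
    have bW: "bd N W = bd N q" using bd(3)[OF Qt[OF W(1)] N2(2) b(1) en(4)] by simp
    have ex': "\<exists>S. S \<in> Q0 \<and> S \<noteq> W \<and> bd N W \<inter> S \<noteq> {}" using q(1) W(2) bq(1) bW by auto
    define S where "S = (SOME S. S \<in> Q0 \<and> S \<noteq> W \<and> bd N W \<inter> S \<noteq> {})"
    have S: "S \<in> Q0" "S \<noteq> W" "bd N W \<inter> S \<noteq> {}" "p N (Some W) = Some S"
      using someI_ex[OF ex'] q(2) bW by (simp_all add: p_def S_def)
    have "S \<in> mg_ends ?H (bd N q)" using S Qn(1) bW by (auto simp: con_simps)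
    then have "S = q" using en(1) S(2) by blast
    moreover have "bd N q \<in> mg_edges ?H"
      unfolding con_simps
    proof (intro conjI ballI impI)
      show "bd N q \<in> supp F" using b(1) matching_in_supp[OF N2(2)] by blast
      fix T assume "T \<in> L" "\<mu> < real (card T)"
      then show "bd N q \<notin> cut E T" using big[of T] bU mem_cut[OF bE] by blast
    next
      fix S assume "S \<in> contraction_nodes L \<mu>"
      then show "\<not> bd N q \<subseteq> S" using node_unique[OF L _ Qn(1)[OF q(1)], of S] bq by blast
    qed
    ultimately show ?thesis using W bW en(1,2) bU S(4) by blast
  qed
  define Qo where "Qo = insert None (Some ` Q0)"
  have finQo: "finite Qo" using finQ0 by (simp add: Qo_def)
  have inv: "p N x \<in> Qo \<and> p N (p N x) = x \<and> p N x \<noteq> x" if NN: "N = N1 \<or> N = N2" and x: "x \<in> Qo" for N x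
  proof (cases x)
    case None
    obtain q where q: "q \<in> Q0" "p N None = Some q" "bd N q = bd N U" using stepN[OF NN] by blast
    then have "p N (Some q) = None" by (simp add: p_def)
    then show ?thesis using None q by (simp add: Qo_def)
  next
    case (Some q)
    then have q: "q \<in> Q0" using x by (auto simp: Qo_def)
    show ?thesis
    proof (cases "bd N q = bd N U")
      case True
      then have "p N (Some q) = None" by (simp add: p_def)
      then show ?thesis using Some conv[OF NN q True] by (simp add: Qo_def)
    next
      case False
      then show ?thesis using stepS[OF NN q] Some by (auto simp: Qo_def)
    qed
  qed
  have inv1: "p N1 x \<in> Qo \<and> p N1 (p N1 x) = x \<and> p N1 x \<noteq> x" if "x \<in> Qo" for x using inv that by blast
  have inv2: "p N2 x \<in> Qo \<and> p N2 (p N2 x) = x \<and> p N2 x \<noteq> x" if "x \<in> Qo" for x using inv that by blast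
  have NQ: "None \<in> Qo" by (simp add: Qo_def)
  obtain v m where v: "v 0 = None" "0 < m" "even m" "v m = None" "\<And>i. v i \<in> Qo" "inj_on v {..<m}"
    and vS: "\<And>i. v (Suc i) = (if even i then p N1 (v i) else p N2 (v i))"
    using alternating_orbit[OF finQo inv1 inv2 NQ] by blast
  obtain k where k: "m = Suc k" using v(2) by (cases m) auto
  have kodd: "odd k" using v(3) k by simp
  define q where "q j = the (v (Suc j))" for j
  have vq: "v (Suc j) = Some (q j)" if "j < k" for j
  proof -
    have "v (Suc j) \<noteq> None" using inj_onD[OF v(6), of "Suc j" 0] v(1,2) that k by auto
    then show ?thesis by (simp add: q_def)
  qed
  have qQ: "q j \<in> Q0" if "j < k" for j using v(5)[of "Suc j"] vq[OF that] by (auto simp: Qo_def)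
  have injq: "inj_on q {..<k}"
  proof (rule inj_onI)
    fix i j assume ij: "i \<in> {..<k}" "j \<in> {..<k}" "q i = q j"
    then have "v (Suc i) = v (Suc j)" using vq by simp
    then show "i = j" using inj_onD[OF v(6), of "Suc i" "Suc j"] ij k by auto
  qed
  \<comment> \<open>The orbit starts at \<open>None\<close>, so the indices are shifted by one: the
    walk enters \<open>q j\<close> along \<open>N1\<close> and leaves it along \<open>N2\<close> for
    even \<open>j\<close>, and conversely for odd \<open>j\<close>.\<close>
  define G where "G j = (if j = 0 then e1 else if even (j - 1) then bd N2 (q (j - 1)) else bd N1 (q (j - 1)))" for j
  have G0: "G 0 = e1" by (simp add: G_def)
  have G1: "G (Suc j) = (if even j then bd N2 (q j) else bd N1 (q j))" for j by (simp add: G_def)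
  have conn: "G (Suc i) \<in> mg_edges ?H \<and> mg_ends ?H (G (Suc i)) = {q i, q (Suc i)} \<and> G (Suc i) \<subseteq> U \<and>
      G (Suc i) = (if even i then bd N2 (q (Suc i)) else bd N1 (q (Suc i)))" if i: "Suc i < k" for i
  proof -
    define M where "M = (if even i then N2 else N1)"
    have MM: "M = N1 \<or> M = N2" by (simp add: M_def)
    have "v (Suc (Suc i)) = p M (Some (q i))" using vS[of "Suc i"] vq[of i] i by (simp add: M_def)
    then have pq: "p M (Some (q i)) = Some (q (Suc i))" using vq[OF i] by simp
    then have "bd M (q i) \<noteq> bd M U" by (auto simp: p_def split: if_splits)
    from stepS[OF MM qQ this] i pq show ?thesis unfolding G1 M_def by auto
  qed
  have q0: "bd N1 (q 0) = e1 \<and> e1 \<inter> q 0 \<noteq> {}"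
  proof -
    have "Some (q 0) = p N1 None" using vS[of 0] vq[of 0] kodd v(1) by (simp add: odd_pos)
    moreover obtain r where "p N1 None = Some r" "bd N1 r = bd N1 U" "bd N1 U \<inter> r \<noteq> {}"
      using stepN[of N1] by blast
    ultimately show ?thesis unfolding e12(1) by simp
  qed
  have qk: "bd N2 (q (k - 1)) = e2 \<and> e2 \<inter> q (k - 1) \<noteq> {} \<and> p N2 None = Some (q (k - 1))"
  proof -
    have k0: "0 < k" using kodd by (simp add: odd_pos)
    have "v k = Some (q (k - 1))" using vq[of "k - 1"] k0 by simp
    moreover have "v (Suc k) = p N2 (v k)" using vS[of k] kodd by simp
    ultimately have "p N2 (Some (q (k - 1))) = None" using v(4) k by simp
    then have n: "p N2 None = Some (q (k - 1))" using inv2[of "Some (q (k - 1))"] qQ[of "k - 1"] k0 by (auto simp: Qo_def)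
    moreover obtain r where "p N2 None = Some r" "bd N2 r = bd N2 U" "bd N2 U \<inter> r \<noteq> {}"
      using stepN[of N2] by blast
    ultimately show ?thesis unfolding e12(2) by simp
  qed
  have G2: "G j = (if even j then bd N1 (q j) else bd N2 (q j))" if "j < k" for j
  proof (cases j)
    case 0
    then show ?thesis using q0 G0 by simp
  next
    case (Suc i)
    then show ?thesis using conn[of i] that by auto
  qed
  define xs where "xs = map (\<lambda>j. (q j, G (Suc j))) [0..<k]"
  have k0: "0 < k" using kodd by (simp add: odd_pos)
  then obtain k' where k': "k = Suc k'" by (cases k) auto
  have xs: "xs = map (\<lambda>j. (q j, G (Suc j))) [0..<k'] @ [(q k', e2)]"
    using qk kodd by (simp add: xs_def k' G1)
  have len: "xs \<noteq> []" "length xs = k" by (simp_all add: xs_def k')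
  have bl: "butlast xs = map (\<lambda>j. (q j, G (Suc j))) [0..<k']" "last xs = (q k', e2)" by (simp_all add: xs)
  have hd: "fst (hd xs) = q 0" by (simp add: xs_def k' hd_map upt_conv_Cons del: upt_Suc)
  have ch: "chain ?H (butlast xs) (fst (last xs))"
    unfolding chain_nth bl
  proof (intro allI impI)
    fix i assume "i < length (map (\<lambda>j. (q j, G (Suc j))) [0..<k'])"
    then have i: "i < k'" by simp
    have nx: "(map fst (map (\<lambda>j. (q j, G (Suc j))) [0..<k']) @ [fst (q k', e2)]) ! Suc i = q (Suc i)"
    proof (cases "Suc i = k'")
      case True
      then show ?thesis by (simp add: nth_append)
    next
      case False
      then show ?thesis using i by (simp add: nth_append)
    qed
    have ni: "q i \<in> contraction_nodes L \<mu>" using Qn(1)[OF qQ[of i]] i k' by simp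
    have "Suc i < k" using i k' by simp
    then have c: "G (Suc i) \<in> mg_edges ?H" "mg_ends ?H (G (Suc i)) = {q i, q (Suc i)}" using conn by blast+
    show "fst (map (\<lambda>j. (q j, G (Suc j))) [0..<k'] ! i) \<in> mg_nodes ?H \<and>
        snd (map (\<lambda>j. (q j, G (Suc j))) [0..<k'] ! i) \<in> mg_edges ?H \<and>
        mg_ends ?H (snd (map (\<lambda>j. (q j, G (Suc j))) [0..<k'] ! i)) =
        {fst (map (\<lambda>j. (q j, G (Suc j))) [0..<k'] ! i),
         (map fst (map (\<lambda>j. (q j, G (Suc j))) [0..<k']) @ [fst (q k', e2)]) ! Suc i}"
      unfolding nx using i ni c by (simp add: con_simps(1))
  qed
  have inU: "\<forall>x\<in>set (butlast xs). snd x \<subseteq> U" 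
  proof
    fix x assume "x \<in> set (butlast xs)"
    then obtain i where i: "i < k'" "x = (q i, G (Suc i))" by (auto simp: bl)
    then have "Suc i < k" using k' by simp
    then have "G (Suc i) \<subseteq> U" using conn by blast
    then show "snd x \<subseteq> U" using i by simp
  qed
  define P where "P = \<Union>(q ` {..<k})"
  have nodesq: "q i \<in> contraction_nodes L \<mu>" if "i < k" for i using Qn(1)[OF qQ[OF that]] .
  have dj: "\<And>i j. i < k \<Longrightarrow> j < k \<Longrightarrow> i \<noteq> j \<Longrightarrow> q i \<inter> q j = {}"
    and cP: "card P = (\<Sum>i<k. card (q i))"
    using card_UN_nodes[OF L injq nodesq] by (auto simp: P_def)
  have PU: "P \<subseteq> U" using qQ Qn(2) by (auto simp: P_def)
  have "nwt ?H xs = card P"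
    unfolding nwt_def xs_def cP con_simps by (simp add: comp_def sum_list_sum_nth atLeast0LessThan)
  also have "\<dots> \<le> card U" using PU UV fin(1) finite_subset by (metis card_mono)
  finally have wt: "nwt ?H xs \<le> card U" .
  define D where "D = U - P"
  have closed: "g \<subseteq> D" if g: "g \<in> N1 \<union> N2" "g \<inter> D \<noteq> {}" for g
  proof -
    obtain M where M: "M = N1 \<or> M = N2" "g \<in> M" using g(1) by blast
    have MF: "M \<in> PM F" using M NF by blast
    have off: "r \<subseteq> D" if "r \<in> Q0" "Some r \<notin> v ` {..<m}" for r
    proof -
      have "r \<inter> q j = {}" if "j < k" for j
      proof (rule ccontr)
        assume "r \<inter> q j \<noteq> {}"
        then have "r = q j" using node_unique[OF L Qn(1)[OF \<open>r \<in> Q0\<close>] nodesq[OF that]] by blast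
        then have "Some r = v (Suc j)" "Suc j < m" using vq[OF that] that k by auto
        then show False using \<open>Some r \<notin> v ` {..<m}\<close> by blast
      qed
      then show ?thesis using Qn(2)[OF that(1)] by (auto simp: D_def P_def)
    qed
    have cl: "p M (v i) \<in> v ` {..<m}" if "i < m" for i
      using alternating_orbit_closed[of Qo "p N1" "p N2" m v i] inv1 inv2 v vS that M by auto
    obtain z where z: "z \<in> g" "z \<in> U" "z \<notin> P" using g(2) by (auto simp: D_def)
    obtain r where r: "r \<in> Q0" "z \<in> r" using Qex z by blast
    have rP: "Some r \<notin> v ` {..<m}"
    proof
      assume "Some r \<in> v ` {..<m}"
      then obtain i where i: "i < m" "Some r = v i" by auto
      then obtain j where j: "i = Suc j" using v(1) by (cases i) auto
      then have "q j = r" "j < k" using i vq[of j] k by auto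
      then show False using r z by (auto simp: P_def)
    qed
    have gr: "g \<inter> r \<noteq> {}" using r z by blast
    show ?thesis
    proof (cases "g \<subseteq> r")
      case True
      then show ?thesis using off[OF r(1) rP] by blast
    next
      case False
      then have gb: "g = bd M r" using touching_cases[OF Qt[OF r(1)] MF M(2) gr] by blast
      have "bd M r \<noteq> bd M U"
      proof
        assume "bd M r = bd M U"
        then have "p M None = Some r" by (rule conv[OF M(1) r(1)])
        then show False using cl[of 0] v rP by auto
      qed
      from stepS[OF M(1) r(1) this] obtain W where W: "W \<in> Q0" "bd M r \<subseteq> r \<union> W" "p M (Some W) = Some r" by blast
      have "Some W \<notin> v ` {..<m}"
      proof
        assume "Some W \<in> v ` {..<m}"
        then obtain i where "i < m" "Some W = v i" by auto
        then show False using cl[of i] W(3) rP by auto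
      qed
      then show ?thesis using gb W(2) off[OF W(1)] off[OF r(1) rP] by blast
    qed
  qed
  \<comment> \<open>The part of \<open>U\<close> off the path is closed under both matchings.
    Exchanging them there keeps \<open>e1\<close>, so the contractibility of \<open>U\<close> forces
    them to agree on it. Thus the nodes of the path account for the whole difference on
    \<open>U\<close>.\<close>
  have touch: "touching N1 D = touching N2 D"
  proof -
    define N3 where "N3 = swap_on D N1 N2"
    have N3: "N3 \<in> PM F2" unfolding N3_def using closed by (intro swap_in_face[OF F2(1) N]) blast
    have eE: "e1 \<in> E" using e(2) by (simp add: cut_def)
    have "\<not> e1 \<subseteq> D" using e(2) mem_cut[OF eE] by (auto simp: D_def)
    then have "e1 \<inter> D = {}" using closed[of e1] e(1) by blast
    then have "e1 \<in> N3" using e(1) by (simp add: N3_def swap_on_def)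
    then have t: "touching N1 U = touching N3 U" using contractible_touching[OF U N(1) N3 e(1) _ e(2)] by blast
    have DU: "D \<subseteq> U" by (auto simp: D_def)
    have "g \<in> N1 \<longleftrightarrow> g \<in> N2" if g: "g \<inter> D \<noteq> {}" for g
    proof -
      have "g \<inter> U \<noteq> {}" using g DU by blast
      then have "g \<in> N1 \<longleftrightarrow> g \<in> N3" using t unfolding touching_def by blast
      also have "g \<in> N3 \<longleftrightarrow> g \<in> N2" using g by (auto simp: N3_def swap_on_def)
      finally show ?thesis .
    qed
    then show ?thesis unfolding touching_def by blast
  qed
  have vs: "vsum (\<lambda>e u. hl (rep F e) u g) e1 xs = hl N2 U g - hl N1 U g" for g
  proof -
    have "vsum (\<lambda>e u. hl (rep F e) u g) e1 xs =
      (\<Sum>j<k. (-1) ^ j * (hl (rep F (G (Suc j))) (q j) g - hl (rep F (G j)) (q j) g))"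
      using vsum_index[of "\<lambda>e u. hl (rep F e) u g" G q k] by (simp add: xs_def G0)
    also have "\<dots> = (\<Sum>j<k. hl N2 (q j) g - hl N1 (q j) g)"
    proof (intro sum.cong refl)
      fix j assume "j \<in> {..<k}"
      then have j: "j < k" by simp
      note h = rep_hl[OF L contr NF(1) nodesq[OF j]] rep_hl[OF L contr NF(2) nodesq[OF j]]
      show "(-1) ^ j * (hl (rep F (G (Suc j))) (q j) g - hl (rep F (G j)) (q j) g) = hl N2 (q j) g - hl N1 (q j) g"
        unfolding G1 unfolding G2[OF j] using h by (cases "even j") auto
    qed
    also have "\<dots> = hl N2 P g - hl N1 P g"
      unfolding P_def using hl_UN[OF NE(1), of "{..<k}" q g] hl_UN[OF NE(2), of "{..<k}" q g] dj
      by (simp add: sum_subtractf)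
    also have "\<dots> = hl N2 U g - hl N1 U g"
    proof -
      have "U = P \<union> D" "P \<inter> D = {}" using PU by (auto simp: D_def)
      then have "hl N1 U g = hl N1 P g + hl N1 D g" "hl N2 U g = hl N2 P g + hl N2 D g"
        using hl_Un[OF NE(1)] hl_Un[OF NE(2)] by metis+
      then show ?thesis using hl_touching[OF touch] by simp
    qed
    finally show ?thesis .
  qed
  have nod: "fst ` set xs \<subseteq> {q \<in> contraction_nodes L \<mu>. q \<subseteq> U}" 
  proof
    fix r assume "r \<in> fst ` set xs"
    then obtain j where "j < k" "r = q j" by (auto simp: xs_def)
    then show "r \<in> {q \<in> contraction_nodes L \<mu>. q \<subseteq> U}" using qQ[of j] by (simp add: Q0_def)
  qed
  show ?thesis
    using len kodd bl(2) ch nod q0 qk inU wt vs hd k' by (intro exI[of _ xs]) simp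
qed

text \<open>By \<open>dir_if_laminar\<close> only cuts of members \<open>S\<close> of
  \<open>L\<close> have to be checked. There an edge of the walk contributes 2 for each end node
  that contains \<open>S\<close>. This amount depends on the node but not on the edge, so it cancels
  along a closed walk of even length.\<close>

lemma lift_in_dir:
  assumes L: "face_laminar_pair V E F L" and \<mu>: "1 \<le> \<mu>" and max: "maximal_laminar_subset (tight F) L"
    and xs: "circuit (contraction E F L \<mu>) xs"
  shows "(\<lambda>g. real_of_int (lift F L \<mu> (map snd xs) g)) \<in> face_dir V E F"
proof (rule dir_if_laminar[OF flpD(1)[OF L] max])
  let ?H = "contraction E F L \<mu>"
  have ch: "chain ?H xs (fst (hd xs))" "xs \<noteq> []" "even (length xs)" using xs by (auto simp: circuit_def)
  have es: "set (map snd xs) \<subseteq> mg_edges ?H" using chain_edges[OF ch(1)] by simp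
  have repF: "rep F e \<in> PM F \<and> e \<in> rep F e" if "e \<in> mg_edges ?H" for e
    using rep[OF flpD(1)[OF L], of e] that by (simp add: con_simps)
  fix g assume g: "g \<notin> supp F"
  have "alt (\<lambda>e. hl (rep F e) (\<Union>(mg_ends ?H e)) g) es = 0" if "set es \<subseteq> mg_edges ?H" for es
    using that
  proof (induction es)
    case (Cons e es)
    then have "g \<notin> rep F e" using repF matching_in_supp g by auto
    then show ?case using Cons by (simp add: hl_def)
  qed simp
  then show "real_of_int (lift F L \<mu> (map snd xs) g) = 0" using es by (simp add: lift_def)
next
  let ?H = "contraction E F L \<mu>"
  have ch: "chain ?H xs (fst (hd xs))" "xs \<noteq> []" "even (length xs)" using xs by (auto simp: circuit_def)
  fix S assume S: "S \<in> L"
  have St: "S \<in> tight F" using S flpD(4)[OF L] by blast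
  define B where "B u = 2 * (of_bool (S \<subseteq> u) :: int)" for u
  \<comment> \<open>The matching through \<open>e\<close> has one edge in the cut of
    \<open>S\<close>. If an end node contains \<open>S\<close>, this edge lies in the union of the
    two end nodes: it stays in that node or is \<open>e\<close>. Otherwise it meets neither end
    node, as a small \<open>S\<close> is disjoint from both and \<open>e\<close> crosses no large
    \<open>S\<close>.\<close>
  have one: "(\<Sum>g\<in>cut E S. hl (rep F e) (\<Union>(mg_ends ?H e)) g) = B u + B w"
    if e: "e \<in> mg_edges ?H" and uw: "mg_ends ?H e = {u, w}" for e u w
  proof -
    have esupp: "e \<in> supp F" using e by (simp add: con_simps)
    define N where "N = rep F e"
    have N: "N \<in> PM F" "e \<in> N" using rep[OF flpD(1)[OF L] esupp] by (auto simp: N_def)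
    note ee = edge_ends[OF L \<mu> e uw]
    have ut: "u \<in> tight F" "w \<in> tight F" using ee(1,2) nodesD(1) flpD(4)[OF L] by blast+
    have be: "bd N u = e" "bd N w = e" using bd(3)[OF ut(1) N ee(6)] bd(3)[OF ut(2) N ee(7)] by auto
    note b = bd[OF St N(1)]
    have bE: "bd N S \<in> E" using b(2) by (simp add: cut_def)
    have bS: "bd N S \<inter> S \<noteq> {}" "\<not> bd N S \<subseteq> S" using b(2) mem_cut[OF bE] by auto
    have "(\<Sum>g\<in>cut E S. hl N (u \<union> w) g) = (\<Sum>g\<in>{bd N S}. hl N (u \<union> w) g)"
    proof (rule sum.mono_neutral_right)
      show "{bd N S} \<subseteq> cut E S" using b(2) by simp
      show "\<forall>g\<in>cut E S - {bd N S}. hl N (u \<union> w) g = 0"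
      proof
        fix g assume "g \<in> cut E S - {bd N S}"
        then have "g \<notin> N" using b(3)[of g] by blast
        then show "hl N (u \<union> w) g = 0" by (simp add: hl_def)
      qed
    qed simp
    also have "\<dots> = int (card (bd N S \<inter> (u \<union> w)))" using b(1) by (simp add: hl_def)
    finally have sum: "(\<Sum>g\<in>cut E S. hl (rep F e) (\<Union>(mg_ends ?H e)) g) = int (card (bd N S \<inter> (u \<union> w)))"
      unfolding uw N_def by simp
    have tu: "bd N S \<subseteq> u \<or> bd N S = e" if "bd N S \<inter> u \<noteq> {}"
      using touching_cases[OF ut(1) N(1) b(1) that] be by simp
    have tw: "bd N S \<subseteq> w \<or> bd N S = e" if "bd N S \<inter> w \<noteq> {}"
      using touching_cases[OF ut(2) N(1) b(1) that] be by simp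
    show ?thesis
    proof (cases "S \<subseteq> u \<or> S \<subseteq> w")
      case True
      then have "bd N S \<subseteq> u \<union> w" using tu tw bS(1) ee(5) by blast
      then have "card (bd N S \<inter> (u \<union> w)) = 2" using fin(4)[OF bE] by (simp add: Int_absorb2)
      moreover have "\<not> (S \<subseteq> u \<and> S \<subseteq> w)" using ee(4) flpD(6)[OF L S] by blast
      ultimately show ?thesis unfolding sum B_def using True by auto
    next
      case False
      have "bd N S \<inter> (u \<union> w) = {}"
      proof (cases "real (card S) \<le> \<mu>")
        case True
        then have "S \<inter> u = {}" "S \<inter> w = {}"
          using node_small[OF L ee(1) S] node_small[OF L ee(2) S] False by blast+
        then show ?thesis using tu tw bS(1) ee(5) by blast
      next
        case big: False
        then have "S \<inter> u = {} \<or> u \<subseteq> S" "S \<inter> w = {} \<or> w \<subseteq> S" "e \<notin> cut E S"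
          using node_big[OF L ee(1) S] node_big[OF L ee(2) S] e S by (auto simp: con_simps)
        then show ?thesis using tu tw bS b(2) by blast
      qed
      then show ?thesis unfolding sum B_def using False by auto
    qed
  qed
  have "alt (\<lambda>e. \<Sum>g\<in>cut E S. hl (rep F e) (\<Union>(mg_ends ?H e)) g) (map snd ys) = esum (\<lambda>e u. B u) ys v"
    if "chain ?H ys v" for ys v
    using that
  proof (induction ys)
    case (Cons y ys)
    then show ?case using one[of "snd y" "fst y" "hdn ys v"] by simp
  qed simp
  from this[OF ch(1)] have "(\<Sum>g\<in>cut E S. lift F L \<mu> (map snd xs) g) = esum (\<lambda>e u. B u) xs (fst (hd xs))"
    by (simp add: lift_def sum_alt)
  also have "\<dots> = 0" using esum_closed[OF ch(2,3)] vsum_edge_independent by metis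
  finally show "(\<Sum>g\<in>cut E S. real_of_int (lift F L \<mu> (map snd xs) g)) = 0"
    by (metis of_int_0 of_int_sum)
qed


section \<open>Expanding the circuits of a refined contraction\<close>

lemma refined_cover:
  assumes L: "face_laminar_pair V E F L" and \<mu>: "1 \<le> \<mu>" and L2: "face_laminar_pair V E F2 L2" "L \<subseteq> L2"
    and U: "U \<in> contraction_nodes L2 \<mu>" and v: "v \<in> U"
  shows "\<exists>q\<in>contraction_nodes L \<mu>. v \<in> q \<and> q \<subseteq> U"
proof -
  have "v \<in> V" using v flpD(5)[OF L2(1) nodesD(1)[OF U]] by blast
  then obtain q where q: "q \<in> contraction_nodes L \<mu>" "v \<in> q" using node_of[OF L \<mu>] by blast
  have "q \<inter> U = {} \<or> q \<subseteq> U" using node_small[OF L2(1) U _ nodesD(2)[OF q(1)]] nodesD(1)[OF q(1)] L2(2) by blast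
  then show ?thesis using q v by blast
qed

lemma refined_edge:
  assumes L2: "face_laminar_pair V E F2 L2" "L \<subseteq> L2" and F2: "F2 \<subseteq> F"
    and e: "e \<in> mg_edges (contraction E F2 L2 \<mu>)"
  shows "e \<in> mg_edges (contraction E F L \<mu>)"
proof -
  have "\<not> e \<subseteq> S" if S: "S \<in> contraction_nodes L \<mu>" for S
  proof
    assume "e \<subseteq> S"
    have "S \<in> L2" using nodesD(1)[OF S] L2(2) by blast
    from node_superset[OF L2(1) this nodesD(2)[OF S]] obtain W where "W \<in> contraction_nodes L2 \<mu>" "S \<subseteq> W" by blast
    then show False using e \<open>e \<subseteq> S\<close> unfolding con_simps by blast
  qed
  then show ?thesis using e face_supp_mono[OF F2, of E] L2(2) unfolding con_simps by blast
qed

text \<open>Nodes for \<open>L2\<close> are unions of nodes for \<open>L\<close>, and each visit is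
  replaced by the path from \<open>path_piece\<close>. Odd length of the pieces keeps all signs, and
  a piece weighs no more than its node. The added edges lie inside nodes for \<open>L2\<close>, so
  the edges of the given circuit keep their coefficients and the expanded walk is again a
  circuit.\<close>

lemma expand_circuit:
  assumes L: "face_laminar_pair V E F L" and \<mu>: "1 \<le> \<mu>"
    and contr: "\<And>S. S \<in> L \<Longrightarrow> real (card S) \<le> \<mu> \<Longrightarrow> contractible V E F S"
    and L2: "face_laminar_pair V E F2 L2" "L \<subseteq> L2" and F2: "F2 \<subseteq> F"
    and contr2: "\<And>S. S \<in> L2 \<Longrightarrow> real (card S) \<le> \<mu> \<Longrightarrow> contractible V E F2 S"
    and circ: "circuit (contraction E F2 L2 \<mu>) xs"
  shows "\<exists>ys. circuit (contraction E F L \<mu>) ys \<and>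
    nwt (contraction E F L \<mu>) ys \<le> nwt (contraction E F2 L2 \<mu>) xs \<and>
    (\<forall>g. lift F L \<mu> (map snd ys) g = lift F2 L2 \<mu> (map snd xs) g)"
proof -
  let ?H = "contraction E F L \<mu>" and ?H2 = "contraction E F2 L2 \<mu>"
  have F2f: "pm_face V E F2" by (rule flpD(1)[OF L2(1)])
  define piece where "piece e1 U e2 ps \<longleftrightarrow> ps \<noteq> [] \<and> odd (length ps) \<and> snd (last ps) = e2 \<and>
    chain ?H (butlast ps) (fst (last ps)) \<and>
    fst ` set ps \<subseteq> {q \<in> contraction_nodes L \<mu>. q \<subseteq> U} \<and> e1 \<inter> fst (hd ps) \<noteq> {} \<and> e2 \<inter> fst (last ps) \<noteq> {} \<and>
    (\<forall>x\<in>set (butlast ps). snd x \<subseteq> U) \<and> nwt ?H ps \<le> card U \<and>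
    (\<forall>g. vsum (\<lambda>e u. hl (rep F e) u g) e1 ps = hl (rep F2 e2) U g - hl (rep F2 e1) U g)" for e1 U e2 ps
  define pc where "pc e1 U e2 = (SOME ps. piece e1 U e2 ps)" for e1 U e2
  have pc: "piece e1 U e2 (pc e1 U e2)"
    if U: "U \<in> contraction_nodes L2 \<mu>" and e: "e1 \<in> supp F2" "e2 \<in> supp F2" "e1 \<in> cut E U" "e2 \<in> cut E U" for e1 U e2
  proof -
    have "\<exists>ps. piece e1 U e2 ps"
      unfolding piece_def
    proof (rule path_piece[OF L \<mu> contr F2f F2 contr2[OF nodesD(1,2)[OF U]] refined_cover[OF L \<mu> L2 U]])
      fix T assume "T \<in> L" "\<mu> < real (card T)"
      then have "T \<inter> U = {} \<or> U \<subseteq> T" using node_big[OF L2(1) U] L2(2) by blast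
      then show "U \<subseteq> T \<or> U \<inter> T = {}" by blast
    qed (use rep[OF F2f e(1)] rep[OF F2f e(2)] e in auto)
    then show ?thesis unfolding pc_def by (rule someI_ex)
  qed
  \<comment> \<open>Here \<open>e0\<close> is the edge by which \<open>ys\<close> is entered, and
    \<open>w\<close> is the old node inside \<open>v\<close> at which the expanded walk is to
    end.\<close>
  have main: "chain ?H (expand pc e0 ys) w \<and>
      hdn (expand pc e0 ys) w \<in> contraction_nodes L \<mu> \<and> hdn (expand pc e0 ys) w \<subseteq> hdn ys v \<and>
      e0 \<inter> hdn (expand pc e0 ys) w \<noteq> {} \<and>
      (\<forall>g. vsum (\<lambda>e u. hl (rep F e) u g) e0 (expand pc e0 ys) = vsum (\<lambda>e u. hl (rep F2 e) u g) e0 ys) \<and>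
      nwt ?H (expand pc e0 ys) \<le> nwt ?H2 ys \<and>
      even (length (expand pc e0 ys)) = even (length ys) \<and>
      laste (expand pc e0 ys) e0 = laste ys e0 \<and> (ys \<noteq> [] \<longrightarrow> expand pc e0 ys \<noteq> []) \<and>
      (\<forall>f. (\<forall>U\<in>contraction_nodes L2 \<mu>. \<not> f \<subseteq> U) \<longrightarrow> chi (map snd (expand pc e0 ys)) f = chi (map snd ys) f)"
    if "chain ?H2 ys v" "e0 \<in> supp F2" "e0 \<in> cut E (hdn ys v)"
      "w \<in> contraction_nodes L \<mu>" "w \<subseteq> v" "laste ys e0 \<inter> w \<noteq> {}" for ys e0 v w
    using that
  proof (induction ys arbitrary: e0)
    case Nil
    then show ?case by simp
  next
    case (Cons x ys)
    define U where "U = fst x"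
    define e where "e = snd x"
    have x: "U \<in> contraction_nodes L2 \<mu>" "e \<in> mg_edges ?H2" "mg_ends ?H2 e = {U, hdn ys v}" "chain ?H2 ys v"
      using Cons.prems(1) by (auto simp: U_def e_def con_simps(1))
    note en = edge_ends[OF L2(1) \<mu> x(2,3)]
    have es: "e \<in> supp F2" using x(2) by (simp add: con_simps)
    have e0U: "e0 \<in> cut E U" using Cons.prems(3) by (simp add: U_def)
    define ps where "ps = pc e0 U e"
    define rest where "rest = expand pc e ys"
    have exp: "expand pc e0 (x # ys) = ps @ rest" by (simp add: ps_def rest_def U_def e_def)
    have P: "piece e0 U e ps" unfolding ps_def by (rule pc[OF x(1) Cons.prems(2) es e0U en(6)])
    have "laste ys e \<inter> w \<noteq> {}" using Cons.prems(6) by (simp add: e_def)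
    note IH = Cons.IH[OF x(4) es en(7) Cons.prems(4,5) this, folded rest_def]
    define w' where "w' = hdn rest w"
    have w': "w' \<in> contraction_nodes L \<mu>" "w' \<subseteq> hdn ys v" "e \<inter> w' \<noteq> {}" using IH by (auto simp: w'_def)
    have ps: "ps \<noteq> []" "odd (length ps)" "snd (last ps) = e" "chain ?H (butlast ps) (fst (last ps))"
      "fst ` set ps \<subseteq> {q \<in> contraction_nodes L \<mu>. q \<subseteq> U}" "e0 \<inter> fst (hd ps) \<noteq> {}" "e \<inter> fst (last ps) \<noteq> {}"
      "\<forall>x\<in>set (butlast ps). snd x \<subseteq> U" "nwt ?H ps \<le> card U"
      "\<And>g. vsum (\<lambda>e u. hl (rep F e) u g) e0 ps = hl (rep F2 e) U g - hl (rep F2 e0) U g"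
      using P by (auto simp: piece_def)
    have lastps: "fst (last ps) \<in> contraction_nodes L \<mu>" "fst (last ps) \<subseteq> U"
      using ps(5) last_in_set[OF ps(1)] by auto
    have hdps: "fst (hd ps) \<in> contraction_nodes L \<mu>" "fst (hd ps) \<subseteq> U"
      using ps(5) hd_in_set[OF ps(1)] by auto
    have eE: "e \<in> E" using supp_E[OF es] .
    have "fst (last ps) \<noteq> w'"
      using lastps w' en(4) flpD(6)[OF L nodesD(1)[OF lastps(1)]] by blast
    then have "mg_ends ?H e = {fst (last ps), w'}"
      using ends_eq(1)[OF L eE lastps(1) w'(1) _ ps(7) w'(3)] by blast
    then have "chain ?H [last ps] w'" using ps(3) lastps refined_edge[OF L2 F2 x(2)] by (simp add: con_simps(1))
    then have "chain ?H (butlast ps @ [last ps]) w'" using ps(4) by (simp add: chain_append)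
    then have chps: "chain ?H ps w'" using ps(1) by simp
    have c1: "chain ?H (ps @ rest) w" using chps IH by (simp add: chain_append w'_def)
    have c2: "hdn (ps @ rest) w = fst (hd ps)" using ps(1) by (simp add: hdn_nonempty)
    have lp: "laste ps e0 = e" using ps(1,3) by (simp add: laste_last)
    have c3: "vsum (\<lambda>e u. hl (rep F e) u g) e0 (ps @ rest) = vsum (\<lambda>e u. hl (rep F2 e) u g) e0 (x # ys)" for g
      using IH ps(2) by (simp add: vsum_append lp ps(10) U_def[symmetric] e_def[symmetric])
    have c4: "nwt ?H (ps @ rest) \<le> nwt ?H2 (x # ys)"
      using IH ps(9) by (simp add: U_def con_simps(3))
    have c5: "even (length (ps @ rest)) = even (length (x # ys))" using IH ps(2) by simp
    have c6: "laste (ps @ rest) e0 = laste (x # ys) e0" using IH by (simp add: laste_append lp e_def)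
    have c7: "chi (map snd (ps @ rest)) f = chi (map snd (x # ys)) f"
      if f: "\<forall>U\<in>contraction_nodes L2 \<mu>. \<not> f \<subseteq> U" for f
    proof -
      have "f \<notin> set (map snd (butlast ps))" using ps(8) f x(1) by auto
      then have z: "chi (map snd (butlast ps)) f = 0" by (rule chi_notin)
      have "map snd ps = map snd (butlast ps) @ [e]"
        using ps(1,3) by (metis append_butlast_last_id list.simps(8,9) map_append)
      moreover have "even (length (butlast ps))" using ps(1,2) by simp
      ultimately have "chi (map snd ps) f = of_bool (e = f)"
        using z by (simp add: chi_append) (simp add: chi_def)
      then show ?thesis using IH f ps(2) by (simp add: chi_append) (simp add: chi_def e_def)
    qed
    show ?case unfolding exp using c1 c2 c3 c4 c5 c6 c7 hdps ps(1,6) by (simp add: U_def)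
  qed
  have xs: "xs \<noteq> []" "even (length xs)" "chain ?H2 xs (fst (hd xs))" "chi (map snd xs) \<noteq> (\<lambda>_. 0)"
    using circ by (auto simp: circuit_def)
  define e0 where "e0 = snd (last xs)"
  define v where "v = fst (hd xs)"
  have "chain ?H2 (butlast xs @ [last xs]) v" using xs(1,3) by (simp add: v_def)
  then have l: "e0 \<in> mg_edges ?H2" "mg_ends ?H2 e0 = {fst (last xs), v}" by (auto simp: chain_append e0_def)
  note en0 = edge_ends[OF L2(1) \<mu> l]
  have e0s: "e0 \<in> supp F2" using l(1) by (simp add: con_simps)
  have hv: "hdn xs v = v" using xs(1) by (simp add: hdn_nonempty v_def)
  have le0: "laste xs e0 = e0" using xs(1) by (simp add: laste_last e0_def)
  obtain x ys where xc: "xs = x # ys" using xs(1) by (cases xs) auto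
  have x: "fst x = v" "snd x \<in> mg_edges ?H2" "mg_ends ?H2 (snd x) = {v, hdn ys v}"
    using xs(3) by (auto simp: xc v_def)
  have "piece e0 v (snd x) (pc e0 v (snd x))"
    using pc[OF en0(2) e0s _ en0(7) edge_ends(6)[OF L2(1) \<mu> x(2,3)]] x(2) by (simp add: con_simps)
  then have p: "pc e0 v (snd x) \<noteq> []" "fst ` set (pc e0 v (snd x)) \<subseteq> {q \<in> contraction_nodes L \<mu>. q \<subseteq> v}"
    "e0 \<inter> fst (hd (pc e0 v (snd x))) \<noteq> {}" by (auto simp: piece_def)
  \<comment> \<open>The first node of the first piece is chosen as the end in advance, so that the
    expanded walk closes up.\<close>
  define w where "w = fst (hd (pc e0 v (snd x)))"
  define zs where "zs = expand pc e0 xs"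
  have w: "w \<in> contraction_nodes L \<mu>" "w \<subseteq> v" "laste xs e0 \<inter> w \<noteq> {}"
    using p(3) subsetD[OF p(2) imageI[OF hd_in_set[OF p(1)]]] by (simp_all add: w_def le0)
  have hz: "fst (hd zs) = w" "zs \<noteq> []" using p(1) by (auto simp: zs_def xc x(1) w_def)
  have e0v: "e0 \<in> cut E (hdn xs v)" using en0(7) hv by simp
  note M = main[OF xs(3)[folded v_def] e0s e0v w, folded zs_def]
  have lz: "snd (last zs) = e0" using M hz(2) le0 by (metis laste_last)
  obtain f where f: "chi (map snd xs) f \<noteq> 0" using xs(4) by auto
  then have "f \<in> set (map snd xs)" using chi_notin by metis
  then have "f \<in> mg_edges ?H2" using chain_edges[OF xs(3)] by auto
  then have "\<forall>U\<in>contraction_nodes L2 \<mu>. \<not> f \<subseteq> U" by (simp add: con_simps)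
  then have "chi (map snd zs) f \<noteq> 0" using M f by simp
  then have "chi (map snd zs) \<noteq> (\<lambda>_. 0)" by auto
  then have cz: "circuit ?H zs" unfolding circuit_def using M hz xs(2) by simp
  have "lift F L \<mu> (map snd zs) g = lift F2 L2 \<mu> (map snd xs) g" for g
    using lift_vsum[OF L \<mu> cz, of g] lift_vsum[OF L2(1) \<mu> circ, of g] M lz by (simp add: e0_def)
  then show ?thesis using cz M by blast
qed

section \<open>Removing short circuits by one weight function\<close>

lemma card_E: "2 * card E \<le> card V ^ 2"
proof -
  have "E \<subseteq> {e. e \<subseteq> V \<and> card e = 2}" using fin by auto
  then have "card E \<le> card {e. e \<subseteq> V \<and> card e = 2}" using fin(1) by (intro card_mono) auto
  also have "\<dots> = card V choose 2" by (rule n_subsets[OF fin(1)])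
  also have "\<dots> = card V * (card V - 1) div 2" by (rule choose_two)
  finally have "2 * card E \<le> card V * (card V - 1)" by linarith
  also have "\<dots> \<le> card V ^ 2" by (simp add: power2_eq_square)
  finally show ?thesis .
qed

lemma separate:
  fixes Y :: "('a set \<Rightarrow> int) set"
  assumes F: "pm_face V E F" and n: "32 \<le> card V" and num: "bij_betw num E {1..card E}"
    and Y: "finite Y" "card Y \<le> card V ^ 16"
    and nz: "\<And>y. y \<in> Y \<Longrightarrow> \<exists>e\<in>E. y e \<noteq> 0"
    and bd: "\<And>y e. y \<in> Y \<Longrightarrow> e \<in> E \<Longrightarrow> \<bar>y e\<bar> \<le> 4 * int (card V) ^ 2"
  shows "\<exists>w\<in>weights (card V) num. \<forall>y\<in>Y.
    (\<lambda>g. real_of_int (y g)) \<notin> face_dir V E (face_Min E F (\<lambda>e. real_of_int (w e)))"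
proof -
  have cE: "card E \<le> card V ^ 2" and n9: "9 \<le> card V" using card_E n by linarith+
  have "\<exists>w\<in>weights (card V) num. \<forall>y\<in>Y. (\<Sum>e\<in>E. w e * y e) \<noteq> 0"
    by (rule ex_separating_weight[OF num cE n9 Y]) (use nz bd in auto)
  then obtain w where w: "w \<in> weights (card V) num" "\<And>y. y \<in> Y \<Longrightarrow> (\<Sum>e\<in>E. w e * y e) \<noteq> 0"
    by blast
  have V: "V \<noteq> {}" using n by auto
  have "(\<lambda>g. real_of_int (y g)) \<notin> face_dir V E (face_Min E F (\<lambda>e. real_of_int (w e)))" if "y \<in> Y" for y
  proof
    assume "(\<lambda>g. real_of_int (y g)) \<in> face_dir V E (face_Min E F (\<lambda>e. real_of_int (w e)))"
    from inner_dir_zero[OF F V this] have "real_of_int (\<Sum>e\<in>E. w e * y e) = 0" by (simp add: inner_on_def)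
    then show False using w(2)[OF that] by (simp only: of_int_eq_0_iff)
  qed
  then show ?thesis using w(1) by blast
qed

lemma length_le_nwt:
  assumes L: "face_laminar_pair V E F L" and "chain (contraction E F' L \<mu>) xs v"
  shows "length xs \<le> nwt (contraction E F' L \<mu>) xs"
  using assms(2)
proof (induction xs)
  case (Cons x xs)
  then have x: "fst x \<in> L" using nodesD(1) by (auto simp: con_simps)
  then have "card (fst x) \<noteq> 0" using flpD(6,7)[OF L] by simp
  then show ?case using Cons by (simp add: con_simps(3))
qed simp

text \<open>Since lifts are linear in alternating indicators, \<open>card_chi_circuits_le\<close>
  bounds their number: eight powers of at most \<open>(2 * n ^ 2) ^ 7\<close> add up to
  \<open>1024 * n ^ 14\<close>, which is at most \<open>n ^ 16\<close> from \<open>n = 32\<close>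
  on. A lift is nonzero because it equals twice the alternating indicator at every edge of the
  contraction. Its entries are at most twice the length of the circuit, and the length is at most
  its weight.\<close>

lemma kill_round:
  assumes L: "face_laminar_pair V E F L" and \<mu>: "1 \<le> \<mu>"
    and n: "32 \<le> card V" and num: "bij_betw num E {1..card E}"
    and l: "0 < l" "l \<le> real (card V)"
    and short: "\<And>xs. circuit (contraction E F L \<mu>) xs \<Longrightarrow> l < real (nwt (contraction E F L \<mu>) xs)"
  shows "\<exists>w\<in>weights (card V) num. \<forall>xs. circuit (contraction E F L \<mu>) xs \<longrightarrow>
    real (nwt (contraction E F L \<mu>) xs) \<le> 2 * l \<longrightarrow>
    (\<lambda>g. real_of_int (lift F L \<mu> (map snd xs) g)) \<notin> face_dir V E (face_Min E F (\<lambda>e. real_of_int (w e)))"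
proof -
  let ?H = "contraction E F L \<mu>"
  have edgesE: "mg_edges ?H \<subseteq> E" using supp_E by (auto simp: con_simps)
  then have finH: "finite (mg_edges ?H)" "card (mg_edges ?H) \<le> card E"
    using fin(2) finite_subset by (auto intro: card_mono)
  define X where "X = {chi (map snd xs) | xs. circuit ?H xs \<and> real (nwt ?H xs) \<le> 2 * l}"
  have X: "finite X" "card X \<le> (\<Sum>i\<le>7. (4 * card (mg_edges ?H)) ^ i)"
    using card_chi_circuits_le[OF finH(1) l(1) short] by (auto simp: X_def)
  define K where "K e g = hl (rep F e) (\<Union>(mg_ends ?H e)) g" for e g
  define Y where "Y = {lift F L \<mu> (map snd xs) | xs. circuit ?H xs \<and> real (nwt ?H xs) \<le> 2 * l}"
  have setE: "set (map snd xs) \<subseteq> E" "set (map snd xs) \<subseteq> mg_edges ?H" if "circuit ?H xs" for xs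
  proof -
    show "set (map snd xs) \<subseteq> mg_edges ?H" using chain_edges[of ?H xs] that by (auto simp: circuit_def)
    then show "set (map snd xs) \<subseteq> E" using edgesE by blast
  qed
  have "lift F L \<mu> (map snd xs) = (\<lambda>g. \<Sum>e\<in>E. chi (map snd xs) e * K e g)" if "circuit ?H xs" for xs
    using alt_chi[OF fin(2) setE(1)[OF that], of "\<lambda>e. K e _"] by (auto simp: lift_def K_def)
  then have "Y \<subseteq> (\<lambda>c g. \<Sum>e\<in>E. c e * K e g) ` X" by (auto simp: Y_def X_def)
  then have Y: "finite Y" "card Y \<le> card X"
    using X(1) by (auto intro: finite_subset surj_card_le)
  have "card Y \<le> card V ^ 16"
  proof -
    have "card Y \<le> (\<Sum>i\<le>7::nat. (4 * card (mg_edges ?H)) ^ i)" using Y X by linarith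
    also have "\<dots> \<le> (\<Sum>i\<le>7::nat. (2 * card V ^ 2) ^ 7)"
    proof (rule sum_mono)
      fix i :: nat assume "i \<in> {..7}"
      have "(4 * card (mg_edges ?H)) ^ i \<le> (2 * card V ^ 2) ^ i"
        using card_E finH(2) by (intro power_mono) auto
      also have "\<dots> \<le> (2 * card V ^ 2) ^ 7"
        using n \<open>i \<in> {..7}\<close> by (intro power_increasing) auto
      finally show "(4 * card (mg_edges ?H)) ^ i \<le> (2 * card V ^ 2) ^ 7" .
    qed
    also have "\<dots> = 1024 * card V ^ 14" by (simp add: power_mult_distrib power_mult[symmetric])
    also have "\<dots> \<le> (card V * card V) * card V ^ 14"
    proof (rule mult_right_mono)
      have "32 * 32 \<le> card V * card V" using n by (intro mult_mono) auto
      then show "1024 \<le> card V * card V" by simp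
    qed simp
    also have "\<dots> = card V ^ 16" by (simp add: power_add[symmetric] flip: power2_eq_square)
    finally show ?thesis .
  qed
  moreover have "\<exists>e\<in>E. y e \<noteq> 0" if y: "y \<in> Y" for y
  proof -
    obtain xs where xs: "circuit ?H xs" "y = lift F L \<mu> (map snd xs)" using y by (auto simp: Y_def)
    obtain f where f: "chi (map snd xs) f \<noteq> 0" using xs(1) by (auto simp: circuit_def)
    then have "f \<in> set (map snd xs)" using chi_notin by metis
    then have fH: "f \<in> mg_edges ?H" using setE[OF xs(1)] by blast
    \<comment> \<open>A contraction edge that meets an end node of \<open>e\<close> lies in the cut
      of that node, where \<open>e\<close> is the only edge of the matching.\<close>
    have "hl (rep F e) (\<Union>(mg_ends ?H e)) f = 2 * of_bool (e = f)" if e: "e \<in> mg_edges ?H" "mg_ends ?H e = {u, w}" for e u w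
    proof -
      have esupp: "e \<in> supp F" using e by (simp add: con_simps)
      note r = rep[OF flpD(1)[OF L] esupp]
      note ee = edge_ends[OF L \<mu> e]
      have fE: "f \<in> E" using fH edgesE by blast
      show ?thesis
      proof (cases "e = f")
        case True
        then have "f \<inter> (u \<union> w) = f" using ee(5) by blast
        then show ?thesis using True r e(2) fin(4)[OF fE] by (simp add: hl_def)
      next
        case False
        have "f \<inter> u = {} \<and> f \<inter> w = {}" if fr: "f \<in> rep F e"
        proof -
          have "x \<in> tight F \<Longrightarrow> e \<in> cut E x \<Longrightarrow> x \<in> contraction_nodes L \<mu> \<Longrightarrow> f \<inter> x = {}" for x
          proof (rule ccontr)
            assume x: "x \<in> tight F" "e \<in> cut E x" "x \<in> contraction_nodes L \<mu>" "f \<inter> x \<noteq> {}"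
            have "\<not> f \<subseteq> x" using fH x(3) by (simp add: con_simps)
            then have "f \<in> cut E x" using mem_cut[OF fE] x(4) by blast
            then have "f = e" using bd(3)[OF x(1) conjunct1[OF r] fr] bd(3)[OF x(1) conjunct1[OF r] conjunct2[OF r] x(2)] by simp
            then show False using False by simp
          qed
          then show ?thesis using ee(1,2,6,7) nodesD(1) flpD(4)[OF L] by blast
        qed
        then show ?thesis using False e(2) by (auto simp: hl_def Int_Un_distrib)
      qed
    qed
    then have "alt (\<lambda>e. hl (rep F e) (\<Union>(mg_ends ?H e)) f) (map snd ys) = 2 * chi (map snd ys) f" if "chain ?H ys v" for ys v
      using that by (induction ys) (auto simp: chi_def)
    then have "y f = 2 * chi (map snd xs) f" using xs by (auto simp: lift_def circuit_def)
    then have "y f \<noteq> 0" using f by simp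
    then show ?thesis using fH edgesE by blast
  qed
  moreover have "\<bar>y e\<bar> \<le> 4 * int (card V) ^ 2" if y: "y \<in> Y" for y e
  proof -
    obtain xs where xs: "circuit ?H xs" "y = lift F L \<mu> (map snd xs)" "real (nwt ?H xs) \<le> 2 * l" using y by (auto simp: Y_def)
    have hle: "\<bar>hl N U g\<bar> \<le> 2" if "N \<subseteq> E" for N U g
    proof (cases "g \<in> N")
      case True
      then have "card g = 2" using fin(4) that by blast
      then have "card (g \<inter> U) \<le> 2" using card_mono[of g "g \<inter> U"] by (metis card.infinite inf_le1 zero_neq_numeral)
      then show ?thesis using True by (simp add: hl_def)
    qed (simp add: hl_def)
    have "\<bar>alt (\<lambda>e. hl (rep F e) (\<Union>(mg_ends ?H e)) g) es\<bar> \<le> int (length es) * 2" if "set es \<subseteq> mg_edges ?H" for es g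
      using that
    proof (induction es)
      case (Cons e es)
      then have "rep F e \<subseteq> E" using rep[OF flpD(1)[OF L], of e] PM_D(3) by (auto simp: con_simps)
      then show ?case using Cons hle[of "rep F e" "\<Union>(mg_ends ?H e)" g] by simp
    qed simp
    from this[OF setE(2)[OF xs(1)]] have "\<bar>y e\<bar> \<le> int (length xs) * 2" by (simp add: xs(2) lift_def)
    moreover have "length xs \<le> nwt ?H xs" using xs(1) length_le_nwt[OF L] by (auto simp: circuit_def)
    moreover have "nwt ?H xs \<le> 2 * card V" using xs(3) l by linarith
    ultimately have "\<bar>y e\<bar> \<le> 4 * int (card V)" by linarith
    also have "\<dots> \<le> 4 * int (card V) ^ 2" using n by (simp add: power2_eq_square)
    finally show ?thesis .
  qed
  ultimately have "\<exists>w\<in>weights (card V) num. \<forall>y\<in>Y.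
    (\<lambda>g. real_of_int (y g)) \<notin> face_dir V E (face_Min E F (\<lambda>e. real_of_int (w e)))"
    by (intro separate[OF flpD(1)[OF L] n num Y(1)])
  then show ?thesis unfolding Y_def by blast
qed

end

section \<open>Doubling along chains of tight sets\<close>

lemma ex_chain_level:
  assumes "finite C" "\<And>X Y. X \<in> C \<Longrightarrow> Y \<in> C \<Longrightarrow> X \<subseteq> Y \<or> Y \<subseteq> X" "\<And>X. X \<in> C \<Longrightarrow> finite X"
    and "1 \<le> j" "j \<le> card C"
  shows "\<exists>X\<in>C. card {Y\<in>C. Y \<subseteq> X} = j"
  using assms
proof (induction "card C" arbitrary: C)
  case 0
  then show ?case by simp
next
  case (Suc n)
  have "C \<noteq> {}" using Suc by auto
  then have "Max (card ` C) \<in> card ` C" using Suc.prems(1) by (intro Max_in) auto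
  then obtain M where M0: "M \<in> C" "card M = Max (card ` C)" by (metis imageE)
  then have M: "M \<in> C" "\<And>Y. Y \<in> C \<Longrightarrow> card Y \<le> card M" using Suc.prems(1) by auto
  have top: "Y \<subseteq> M" if "Y \<in> C" for Y
    using Suc.prems(2)[OF M(1) that] Suc.prems(3)[OF that] M(2)[OF that] card_subset_eq[of Y M] card_mono[of Y M] by (metis le_antisym order_refl)
  show ?case
  proof (cases "j = card C")
    case True
    have "{Y\<in>C. Y \<subseteq> M} = C" using top by blast
    then show ?thesis using M(1) True by (intro bexI[of _ M]) simp_all
  next
    case False
    define D where "D = C - {M}"
    have D: "finite D" "card D = n" "D \<subseteq> C" using Suc.prems(1) Suc.hyps(2) M by (auto simp: D_def)
    have "j \<le> card D" using False Suc.prems(5) Suc.hyps(2) D by simp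
    then obtain X where X: "X \<in> D" "card {Y\<in>D. Y \<subseteq> X} = j"
      using Suc.hyps(1)[of D] D Suc.prems by (metis subsetD)
    have "{Y\<in>D. Y \<subseteq> X} = {Y\<in>C. Y \<subseteq> X}"
    proof -
      have "\<not> M \<subseteq> X" using X(1) top[of X] by (auto simp: D_def)
      then show ?thesis by (auto simp: D_def)
    qed
    then show ?thesis using X D by auto
  qed
qed

lemma card_image_le_if_determined:
  assumes "finite (s ` W)" "\<And>a b. a \<in> W \<Longrightarrow> b \<in> W \<Longrightarrow> s a = s b \<Longrightarrow> y a = y b"
  shows "finite (y ` W)" "card (y ` W) \<le> card (s ` W)"
proof -
  define h where "h c = y (SOME a. a \<in> W \<and> s a = c)" for c
  have "y a = h (s a)" if "a \<in> W" for a
  proof -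
    have "(SOME b. b \<in> W \<and> s b = s a) \<in> W \<and> s (SOME b. b \<in> W \<and> s b = s a) = s a"
      by (rule someI[of _ a]) (use that in simp)
    then show ?thesis unfolding h_def using assms(2) that by metis
  qed
  then have "y ` W = h ` s ` W" by (auto simp: image_image)
  then show "finite (y ` W)" "card (y ` W) \<le> card (s ` W)" using assms(1) by (auto intro: card_image_le)
qed

lemma ex_maximal_laminar:
  assumes "finite A" "L \<subseteq> A" "laminar L"
  shows "\<exists>M. L \<subseteq> M \<and> maximal_laminar_subset A M"
proof -
  define P where "P M \<longleftrightarrow> L \<subseteq> M \<and> M \<subseteq> A \<and> laminar M" for M
  have "P L" using assms by (simp add: P_def)
  moreover have "card M < Suc (card A)" if "P M" for M using that assms(1) by (simp add: P_def card_mono less_Suc_eq_le)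
  ultimately obtain M where PM: "P M" "\<And>M'. P M' \<Longrightarrow> card M' \<le> card M"
    using ex_has_greatest_nat[of P L card "Suc (card A)"] by blast
  then have M: "L \<subseteq> M" "M \<subseteq> A" "laminar M" by (auto simp: P_def)
  have "\<not> laminar (insert S M)" if "S \<in> A - M" for S
  proof
    assume "laminar (insert S M)"
    then have "card (insert S M) \<le> card M" using M that by (intro PM(2)) (auto simp: P_def)
    moreover have "finite M" using M(2) assms(1) finite_subset by blast
    ultimately show False using that by simp
  qed
  then show ?thesis using M by (auto simp: maximal_laminar_subset_def)
qed

definition bigs :: "'a set set \<Rightarrow> real \<Rightarrow> 'a set set" where
  "bigs L l = {T \<in> L. l < real (card T) \<and> real (card T) \<le> 2 * l}"

definition lev :: "'a set set \<Rightarrow> real \<Rightarrow> 'a set \<Rightarrow> nat" where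
  "lev L l T = card {X \<in> bigs L l. X \<subseteq> T}"

context sgraph
begin

text \<open>A matching of \<open>F\<close> on \<open>T' - T\<close> is determined by its boundary edges at \<open>T\<close> and \<open>T'\<close> whenever at
  most \<open>r\<close> steps of the chain lie between \<open>T\<close> and \<open>T'\<close>. The chain starts at the empty set, which has
  no boundary edge.\<close>

definition det :: "'a set set \<Rightarrow> real \<Rightarrow> ('a set \<Rightarrow> real) set \<Rightarrow> nat \<Rightarrow> bool" where
  "det L l F r \<longleftrightarrow> (\<forall>T T' N1 N2. (T = {} \<or> T \<in> bigs L l) \<longrightarrow> T' \<in> bigs L l \<longrightarrow> T \<subset> T' \<longrightarrow>
     lev L l T' \<le> lev L l T + r \<longrightarrow> N1 \<in> PM F \<longrightarrow> N2 \<in> PM F \<longrightarrow>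
     (T \<noteq> {} \<longrightarrow> bd N1 T = bd N2 T) \<longrightarrow> bd N1 T' = bd N2 T' \<longrightarrow>
     touching N1 (T' - T) = touching N2 (T' - T))"

lemma detD:
  assumes "det L l F r" "T = {} \<or> T \<in> bigs L l" "T' \<in> bigs L l" "T \<subset> T'" "lev L l T' \<le> lev L l T + r"
    "N1 \<in> PM F" "N2 \<in> PM F" "T \<noteq> {} \<Longrightarrow> bd N1 T = bd N2 T" "bd N1 T' = bd N2 T'"
  shows "touching N1 (T' - T) = touching N2 (T' - T)"
  using assms unfolding det_def by blast

section \<open>Chains of big sets\<close>

lemma bigsD: "T \<in> bigs L l \<Longrightarrow> T \<in> L" "T \<in> bigs L l \<Longrightarrow> l < real (card T)" "T \<in> bigs L l \<Longrightarrow> real (card T) \<le> 2 * l"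
  by (auto simp: bigs_def)

text \<open>Two disjoint sets of more than \<open>l\<close> elements do not fit into one of at most
  \<open>2 * l\<close>.\<close>

lemma bigs_nested:
  assumes L: "face_laminar_pair V E F L" and T: "X \<in> bigs L l" "Y \<in> bigs L l" "T \<subseteq> V" "X \<subseteq> T" "Y \<subseteq> T" "real (card T) \<le> 2 * l"
  shows "X \<subseteq> Y \<or> Y \<subseteq> X"
proof (rule ccontr)
  assume "\<not> ?thesis"
  then have "X \<inter> Y = {}" using laminarD[OF flpD(2)[OF L] bigsD(1)[OF T(1)] bigsD(1)[OF T(2)]] by blast
  then have "card (X \<union> Y) = card X + card Y"
    using flpD(7)[OF L bigsD(1)[OF T(1)]] flpD(7)[OF L bigsD(1)[OF T(2)]] by (intro card_Un_disjoint)
  moreover have "card (X \<union> Y) \<le> card T" using T fin(1) by (intro card_mono) (auto intro: finite_subset)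
  ultimately show False using bigsD(2)[OF T(1)] bigsD(2)[OF T(2)] T(6) by linarith
qed

lemma finite_bigs: "face_laminar_pair V E F L \<Longrightarrow> finite (bigs L l)"
  using flpD(8) by (auto simp: bigs_def)

lemma lev_less:
  assumes L: "face_laminar_pair V E F L" and X: "X \<in> bigs L l" "T \<subset> X"
  shows "lev L l T < lev L l X"
  unfolding lev_def using X finite_bigs[OF L, of l] by (intro psubset_card_mono) auto

lemma lev_mono: "face_laminar_pair V E F L \<Longrightarrow> T \<subseteq> X \<Longrightarrow> lev L l T \<le> lev L l X"
  unfolding lev_def using finite_bigs[of F L l] by (intro card_mono) auto

text \<open>The big sets inside \<open>T'\<close> form a chain, so all levels between those of
  \<open>T\<close> and \<open>T'\<close> are attained.\<close>

lemma ex_mid: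
  assumes L: "face_laminar_pair V E F L" and T: "T = {} \<or> T \<in> bigs L l" "T' \<in> bigs L l" "T \<subset> T'"
    and r: "1 \<le> r" "lev L l T + r < lev L l T'"
  shows "\<exists>X\<in>bigs L l. T \<subset> X \<and> X \<subset> T' \<and> lev L l X = lev L l T + r"
proof -
  define C where "C = {X \<in> bigs L l. X \<subseteq> T'}"
  have T'V: "T' \<subseteq> V" using flpD(5)[OF L bigsD(1)[OF T(2)]] .
  have C: "finite C" using finite_bigs[OF L] by (simp add: C_def)
  have nest: "X \<subseteq> Y \<or> Y \<subseteq> X" if "X \<in> C" "Y \<in> C" for X Y
    using that bigs_nested[OF L _ _ T'V _ _ bigsD(3)[OF T(2)]] by (auto simp: C_def)
  have "finite X" if "X \<in> C" for X using that flpD(7)[OF L bigsD(1)] by (auto simp: C_def)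
  moreover have "1 \<le> lev L l T + r" "lev L l T + r \<le> card C" using r by (auto simp: C_def lev_def)
  ultimately obtain X where X: "X \<in> C" "card {Y\<in>C. Y \<subseteq> X} = lev L l T + r"
    using ex_chain_level[OF C nest] by blast
  have "{Y\<in>C. Y \<subseteq> X} = {Y\<in>bigs L l. Y \<subseteq> X}" using X(1) by (auto simp: C_def)
  then have lX: "lev L l X = lev L l T + r" using X(2) by (simp add: lev_def)
  have XB: "X \<in> bigs L l" "X \<subseteq> T'" using X by (auto simp: C_def)
  have "\<not> X \<subseteq> T" using lev_mono[OF L, of X T l] lX r by auto
  moreover have "T \<subseteq> X \<or> X \<subseteq> T"
    using T bigs_nested[OF L _ XB(1) T'V _ XB(2) bigsD(3)[OF T(2)], of T] by auto
  moreover have "X \<noteq> T'" using lX r by auto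
  ultimately show ?thesis using XB lX by blast
qed

text \<open>The members of a laminar family that contain a given vertex form a chain, so a member is
  determined by one of its elements and its cardinality.\<close>

lemma card_laminar_le:
  assumes L: "face_laminar_pair V E F L"
  shows "card L \<le> card V ^ 2"
proof -
  define f where "f S = (SOME v. v \<in> S, card S)" for S :: "'a set"
  have some: "(SOME v. v \<in> S) \<in> S" if "S \<in> L" for S using flpD(6)[OF L that] by (simp add: some_in_eq)
  have "inj_on f L"
  proof (rule inj_onI)
    fix S T assume ST: "S \<in> L" "T \<in> L" "f S = f T"
    then have "S \<inter> T \<noteq> {}" "card S = card T" using some[OF ST(1)] some[OF ST(2)] by (auto simp: f_def)
    then show "S = T" using laminarD[OF flpD(2)[OF L] ST(1,2)] flpD(7)[OF L ST(1)] flpD(7)[OF L ST(2)]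
      by (metis card_subset_eq)
  qed
  moreover have "f ` L \<subseteq> V \<times> {1..card V}"
  proof
    fix z assume "z \<in> f ` L"
    then obtain S where S: "S \<in> L" "z = f S" by blast
    have "card S \<le> card V" "1 \<le> card S"
      using flpD(5,6,7)[OF L S(1)] fin(1) by (auto intro: card_mono simp: Suc_le_eq card_gt_0_iff)
    then show "z \<in> V \<times> {1..card V}" using some[OF S(1)] flpD(5)[OF L S(1)] S(2) by (auto simp: f_def)
  qed
  ultimately have "card L \<le> card (V \<times> {1..card V})" using fin(1) by (intro card_inj_on_le) auto
  then show ?thesis by (simp add: card_cartesian_product power2_eq_square)
qed

section \<open>Doubling the intervals on which matchings are determined\<close>

lemma touching_Un: "touching N (A \<union> B) = touching N A \<union> touching N B"
  by (auto simp: touching_def)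

lemma shared_boundary:
  assumes S: "S \<in> tight F" and N: "N1 \<in> PM F" "N2 \<in> PM F" and eq: "bd N1 S = bd N2 S"
    and g: "g \<in> N1 \<union> N2" "g \<in> cut E S"
  shows "g \<in> N1 \<inter> N2"
  using bd(1,3)[OF S N(1)] bd(1,3)[OF S N(2)] eq g by (metis Int_iff Un_iff)

text \<open>Edges in the cut of \<open>T\<close> or \<open>T'\<close> are common to both matchings;
  any other edge lies on one side of both cuts. This is the condition for exchanging the matchings
  on \<open>T' - T\<close>.\<close>

lemma interval_edges:
  assumes T: "T = {} \<or> T \<in> tight F" "T' \<in> tight F" "T \<subseteq> T'" and N: "N1 \<in> PM F" "N2 \<in> PM F"
    and eq: "T \<noteq> {} \<Longrightarrow> bd N1 T = bd N2 T" "bd N1 T' = bd N2 T'" and g: "g \<in> N1 \<union> N2"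
  shows "g \<in> N1 \<inter> N2 \<or> g \<subseteq> T' - T \<or> g \<inter> (T' - T) = {}"
proof (rule ccontr)
  assume neg: "\<not> ?thesis"
  have gE: "g \<in> E" using g PM_D(3)[OF N(1)] PM_D(3)[OF N(2)] by blast
  have "g \<notin> cut E T'" using shared_boundary[OF T(2) N eq(2) g] neg by blast
  moreover have "g \<notin> cut E T"
  proof
    assume c: "g \<in> cut E T"
    then have "T \<noteq> {}" by (auto simp: cut_def)
    then show False using shared_boundary[OF _ N eq(1) g c] T(1) neg by blast
  qed
  ultimately show False using neg T(3) unfolding mem_cut[OF gE] by blast
qed

text \<open>A middle set splits an interval of length up to \<open>2 * r\<close> into two intervals
  of length at most \<open>r\<close>, on each of which a matching is determined by its boundary
  edges. So two matchings with common outer boundary edges differ on the interval by a vector that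
  depends only on the two outer sets, these edges and the two boundary edges at the middle set. This
  gives at most \<open>4 * n ^ 12\<close> vectors, which a single weight function removes.\<close>

lemma det_double:
  assumes L: "face_laminar_pair V E F L" and F': "pm_face V E F'" "F' \<subseteq> F"
    and n: "32 \<le> card V" and num: "bij_betw num E {1..card E}"
    and r: "1 \<le> r" and det: "det L l F' r"
  shows "\<exists>w\<in>weights (card V) num. det L l (face_Min E F' (\<lambda>e. real_of_int (w e))) (2 * r)"
proof -
  let ?B = "bigs L l"
  have tF: "T \<in> tight F'" if "T \<in> ?B" for T
    using bigsD(1)[OF that] flpD(4)[OF L] face_tight_mono[OF F'(2), of V E] by blast
  define W where "W = {(T, T', N1, N2). (T = {} \<or> T \<in> ?B) \<and> T' \<in> ?B \<and> T \<subset> T' \<and> lev L l T' \<le> lev L l T + 2 * r \<and>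
    N1 \<in> PM F' \<and> N2 \<in> PM F' \<and> (T \<noteq> {} \<longrightarrow> bd N1 T = bd N2 T) \<and> bd N1 T' = bd N2 T' \<and>
    touching N1 (T' - T) \<noteq> touching N2 (T' - T)}"
  define y where "y = (\<lambda>(T :: 'a set, T', N1, N2) g. (of_bool (g \<in> touching N1 (T' - T)) - of_bool (g \<in> touching N2 (T' - T)) :: int))"
  define mid where "mid T T' = (SOME X. X \<in> ?B \<and> T \<subset> X \<and> X \<subset> T' \<and> lev L l X = lev L l T + r)" for T T'
  have mid: "mid T T' \<in> ?B \<and> T \<subset> mid T T' \<and> mid T T' \<subset> T' \<and> lev L l (mid T T') = lev L l T + r"
    if w: "(T, T', N1, N2) \<in> W" for T T' N1 N2
  proof -
    have "\<not> lev L l T' \<le> lev L l T + r" using detD[OF det, of T T' N1 N2] w by (auto simp: W_def)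
    then have "\<exists>X. X \<in> ?B \<and> T \<subset> X \<and> X \<subset> T' \<and> lev L l X = lev L l T + r"
      using ex_mid[OF L, where l = l and T = T and T' = T' and r = r] w r by (auto simp: W_def)
    then show ?thesis unfolding mid_def by (rule someI_ex)
  qed
  define s where "s = (\<lambda>(T, T', N1, N2). (T, T', (if T = {} then {} else bd N1 T), bd N1 T', bd N1 (mid T T'), bd N2 (mid T T')))"
  have determined: "touching N (T' - T) = touching M (T' - T)"
    if w: "(T, T', A, B) \<in> W" and NM: "N \<in> PM F'" "M \<in> PM F'" "T \<noteq> {} \<Longrightarrow> bd N T = bd M T" "bd N T' = bd M T'"
      "bd N (mid T T') = bd M (mid T T')" for T T' A B N M
  proof -
    let ?X = "mid T T'"
    note X = mid[OF w]
    have w': "T = {} \<or> T \<in> ?B" "T' \<in> ?B" "lev L l T' \<le> lev L l T + 2 * r" using w by (auto simp: W_def)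
    have "?X \<noteq> {}" using X by blast
    have "touching N (?X - T) = touching M (?X - T)"
      using X w'(1) NM by (intro detD[OF det]) auto
    moreover have "touching N (T' - ?X) = touching M (T' - ?X)"
      using X w' NM by (intro detD[OF det]) auto
    moreover have "T' - T = (?X - T) \<union> (T' - ?X)" using X by blast
    ultimately show ?thesis by (metis touching_Un)
  qed
  have sub: "s ` W \<subseteq> insert {} ?B \<times> ?B \<times> insert {} E \<times> E \<times> E \<times> E"
  proof
    fix z assume "z \<in> s ` W"
    then obtain T T' N1 N2 where w: "(T, T', N1, N2) \<in> W" "z = s (T, T', N1, N2)" by auto
    have bE: "bd N S \<in> E" if "N \<in> PM F'" "S \<in> ?B" for N S
      using bd(2)[OF tF[OF that(2)] that(1)] by (simp add: cut_def)
    show "z \<in> insert {} ?B \<times> ?B \<times> insert {} E \<times> E \<times> E \<times> E"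
      using w mid[OF w(1)] bE by (auto simp: W_def s_def)
  qed
  have finB: "finite ?B" by (rule finite_bigs[OF L])
  have finp: "finite (insert {} ?B \<times> ?B \<times> insert {} E \<times> E \<times> E \<times> E)" using finB fin(2) by simp
  have sW: "finite (s ` W)" using sub finp by (rule finite_subset)
  have yW: "finite (y ` W)" "card (y ` W) \<le> card (s ` W)"
  proof -
    have ys: "y a = y b" if ab: "a \<in> W" "b \<in> W" "s a = s b" for a b
    proof -
      obtain T T' N1 N2 where a: "a = (T, T', N1, N2)" by (cases a) auto
      obtain M1 M2 where b: "b = (T, T', M1, M2)" using ab(3) a by (cases b) (auto simp: s_def)
      have e: "T \<noteq> {} \<Longrightarrow> bd N1 T = bd M1 T" "bd N1 T' = bd M1 T'" "bd N1 (mid T T') = bd M1 (mid T T')"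
        "bd N2 (mid T T') = bd M2 (mid T T')" using ab(3) by (auto simp: a b s_def split: if_splits)
      have aw: "N1 \<in> PM F'" "N2 \<in> PM F'" "T \<noteq> {} \<Longrightarrow> bd N1 T = bd N2 T" "bd N1 T' = bd N2 T'"
        using ab(1) by (auto simp: a W_def)
      have bw: "M1 \<in> PM F'" "M2 \<in> PM F'" "T \<noteq> {} \<Longrightarrow> bd M1 T = bd M2 T" "bd M1 T' = bd M2 T'"
        using ab(2) by (auto simp: b W_def)
      have "touching N1 (T' - T) = touching M1 (T' - T)"
        using e aw(1) bw(1) by (intro determined[OF ab(1)[unfolded a]]) auto
      moreover have "touching N2 (T' - T) = touching M2 (T' - T)"
        using e aw bw by (intro determined[OF ab(1)[unfolded a]]) auto
      ultimately show ?thesis by (simp add: a b y_def)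
    qed
    show "finite (y ` W)" "card (y ` W) \<le> card (s ` W)"
      by (rule card_image_le_if_determined[OF sW ys]; assumption)+
  qed
  have cE: "card E \<le> card V ^ 2" using card_E by linarith
  have cB: "card ?B \<le> card V ^ 2"
  proof -
    have "card ?B \<le> card L" using flpD(8)[OF L] by (intro card_mono) (auto simp: bigs_def)
    then show ?thesis using card_laminar_le[OF L] by linarith
  qed
  have "card (y ` W) \<le> card (insert {} ?B \<times> ?B \<times> insert {} E \<times> E \<times> E \<times> E)"
    using yW(2) card_mono[OF finp sub] by linarith
  also have "\<dots> = card (insert {} ?B) * (card ?B * (card (insert {} E) * (card E * (card E * card E))))"
    by (simp only: card_cartesian_product)
  also have "\<dots> \<le> (2 * card V ^ 2) * (card V ^ 2 * ((2 * card V ^ 2) * (card V ^ 2 * (card V ^ 2 * card V ^ 2))))"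
  proof -
    have "1 \<le> card V ^ 2" using n by simp
    then have "card (insert {} ?B) \<le> 2 * card V ^ 2" "card (insert {} E) \<le> 2 * card V ^ 2"
      using card_insert_le_m1[of "card ?B + 1" ?B "{}"] card_insert_le_m1[of "card E + 1" E "{}"] cB cE by auto
    then show ?thesis using cB cE by (intro mult_mono) auto
  qed
  also have "\<dots> = 4 * card V ^ 12" by (simp add: power_add[symmetric])
  also have "\<dots> \<le> card V ^ 4 * card V ^ 12"
  proof (rule mult_right_mono)
    have "(4::nat) \<le> 32 ^ 4" by simp
    also have "\<dots> \<le> card V ^ 4" using n by (intro power_mono) auto
    finally show "4 \<le> card V ^ 4" .
  qed simp
  also have "\<dots> = card V ^ 16" by (simp flip: power_add)
  finally have cY: "card (y ` W) \<le> card V ^ 16" .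
  have nz: "\<exists>e\<in>E. f e \<noteq> 0" if "f \<in> y ` W" for f
  proof -
    obtain T T' N1 N2 where w: "(T, T', N1, N2) \<in> W" "f = y (T, T', N1, N2)" using \<open>f \<in> y ` W\<close> by auto
    then obtain g where g: "g \<in> touching N1 (T' - T) \<longleftrightarrow> g \<notin> touching N2 (T' - T)" by (auto simp: W_def)
    then have "g \<in> N1 \<union> N2" by (auto simp: touching_def)
    moreover have "N1 \<subseteq> E" "N2 \<subseteq> E" using w(1) PM_D(3) by (auto simp: W_def)
    ultimately show ?thesis using g w(2) by (intro bexI[of _ g]) (auto simp: y_def)
  qed
  have le: "\<bar>f e\<bar> \<le> 4 * int (card V) ^ 2" if "f \<in> y ` W" for f e
  proof -
    have "\<bar>f e\<bar> \<le> 1" using that by (auto simp: y_def)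
    also have "1 \<le> 4 * int (card V) ^ 2"
      using one_le_power[of "int (card V)" 2] n by linarith
    finally show ?thesis .
  qed
  have "\<exists>w\<in>weights (card V) num. \<forall>f\<in>y ` W.
      (\<lambda>g. real_of_int (f g)) \<notin> face_dir V E (face_Min E F' (\<lambda>e. real_of_int (w e)))"
    by (rule separate[OF F'(1) n num yW(1) cY]) (use nz le in auto)
  then obtain w where w: "w \<in> weights (card V) num"
    "\<And>f. f \<in> y ` W \<Longrightarrow> (\<lambda>g. real_of_int (f g)) \<notin> face_dir V E (face_Min E F' (\<lambda>e. real_of_int (w e)))"
    by blast
  let ?F = "face_Min E F' (\<lambda>e. real_of_int (w e))"
  have V: "V \<noteq> {}" using n by auto
  have Ff: "pm_face V E ?F" by (rule pm_face_Min[OF F'(1) V])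
  have "det L l ?F (2 * r)"
    unfolding det_def
  proof (intro allI impI, rule ccontr)
    fix T T' N1 N2
    assume a: "T = {} \<or> T \<in> ?B" "T' \<in> ?B" "T \<subset> T'" "lev L l T' \<le> lev L l T + 2 * r"
      "N1 \<in> PM ?F" "N2 \<in> PM ?F" "T \<noteq> {} \<longrightarrow> bd N1 T = bd N2 T" "bd N1 T' = bd N2 T'"
      "touching N1 (T' - T) \<noteq> touching N2 (T' - T)"
    have NF: "N1 \<in> PM F'" "N2 \<in> PM F'" using a(5,6) matchings_mono[OF face_Min_subset] by blast+
    have tF2: "S \<in> tight ?F" if "S \<in> ?B" for S
      using tF[OF that] face_tight_mono[OF face_Min_subset, of V E F'] by blast
    define D where "D = T' - T"
    \<comment> \<open>Exchanging on the interval stays in the face, so the recorded difference is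
      \<open>N1\<close> minus \<open>N3\<close>, a direction that \<open>w\<close> was chosen to
      exclude.\<close>
    define N3 where "N3 = swap_on D N1 N2"
    have "N3 \<in> PM ?F" unfolding N3_def
    proof (rule swap_in_face[OF Ff a(5,6)])
      fix g assume "g \<in> N1 \<union> N2"
      then show "g \<in> N1 \<inter> N2 \<or> g \<subseteq> D \<or> g \<inter> D = {}"
        unfolding D_def using a tF2 by (intro interval_edges[of T ?F T' N1 N2 g]) auto
    qed
    then have "(\<lambda>g. indicator N1 g - indicator N3 g :: real) \<in> face_dir V E ?F"
      using a(5) by (intro diff_in_dir PM_D(2) face_polytope[OF Ff])
    moreover have "indicator N1 g - indicator N3 g = real_of_int (y (T, T', N1, N2) g)" for g
      by (auto simp: y_def N3_def swap_on_def touching_def D_def indicator_def)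
    ultimately have "(\<lambda>g. real_of_int (y (T, T', N1, N2) g)) \<in> face_dir V E ?F" by simp
    moreover have "(T, T', N1, N2) \<in> W" using a NF by (simp add: W_def)
    ultimately show False using w(2) by blast
  qed
  then show ?thesis using w(1) by blast
qed

text \<open>No big set lies strictly between \<open>T\<close> and \<open>T'\<close>. Hence
  \<open>T' - T\<close> is a union of nodes, and an edge inside it crosses no member of
  \<open>L\<close> of more than \<open>l\<close> elements: such a member would be a proper subset of
  \<open>T'\<close>, comparable with \<open>T\<close> and not contained in it. So
  \<open>region_agree\<close> applies.\<close>

lemma det_one:
  assumes L: "face_laminar_pair V E F L" and l: "1 \<le> l"
    and contr: "\<And>S. S \<in> L \<Longrightarrow> real (card S) \<le> l \<Longrightarrow> contractible V E F S"
    and F': "pm_face V E F'" "F' \<subseteq> F"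
    and kill: "\<And>xs. circuit (contraction E F L l) xs \<Longrightarrow> real (nwt (contraction E F L l) xs) \<le> 2 * l \<Longrightarrow>
      (\<lambda>g. real_of_int (lift F L l (map snd xs) g)) \<notin> face_dir V E F'"
  shows "det L l F' 1"
  unfolding det_def
proof (intro allI impI)
  let ?B = "bigs L l"
  fix T T' N1 N2
  assume a: "T = {} \<or> T \<in> ?B" "T' \<in> ?B" "T \<subset> T'" "lev L l T' \<le> lev L l T + 1"
    "N1 \<in> PM F'" "N2 \<in> PM F'" "T \<noteq> {} \<longrightarrow> bd N1 T = bd N2 T" "bd N1 T' = bd N2 T'"
  have tF: "T \<in> tight F'" if "T \<in> ?B" for T
    using bigsD(1)[OF that] flpD(4)[OF L] face_tight_mono[OF F'(2), of V E] by blast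
  define D where "D = T' - T"
  define Q0 where "Q0 = {q \<in> contraction_nodes L l. q \<subseteq> D}"
  have T'V: "T' \<subseteq> V" using flpD(5)[OF L bigsD(1)[OF a(2)]] .
  have DQ: "D = \<Union>Q0"
  proof
    show "D \<subseteq> \<Union>Q0"
    proof
      fix v assume v: "v \<in> D"
      then have "v \<in> V" using T'V by (auto simp: D_def)
      then obtain q where q: "q \<in> contraction_nodes L l" "v \<in> q" using node_of[OF L l] by blast
      have "T' \<inter> q = {} \<or> q \<subseteq> T'" by (rule node_big[OF L q(1) bigsD(1,2)[OF a(2)]])
      moreover have "T \<inter> q = {} \<or> q \<subseteq> T" using a(1) node_big[OF L q(1) bigsD(1,2), of T] by auto
      ultimately have "q \<subseteq> D" using v q by (auto simp: D_def)
      then show "v \<in> \<Union>Q0" using q by (auto simp: Q0_def)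
    qed
  qed (auto simp: Q0_def)
  have nomid: False if X: "X \<in> ?B" "T \<subset> X" "X \<subset> T'" for X
    using lev_less[OF L X(1,2)] lev_less[OF L a(2) X(3)] a(4) by linarith
  have "touching N1 D = touching N2 D"
  proof (rule region_agree[OF L l contr F' kill a(5,6) _ DQ])
    show "Q0 \<subseteq> contraction_nodes L l" by (auto simp: Q0_def)
    have "card D \<le> card T'" using T'V fin(1) by (intro card_mono) (auto simp: D_def intro: finite_subset)
    then show "real (card D) \<le> 2 * l" using bigsD(3)[OF a(2)] by linarith
  next
    fix g assume g: "g \<in> (N1 - N2) \<union> (N2 - N1)" "g \<inter> D \<noteq> {}"
    have gE: "g \<in> E" using g PM_D(3)[OF a(5)] PM_D(3)[OF a(6)] by blast
    have gD: "g \<subseteq> D"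
      using g a tF interval_edges[of T F' T' N1 N2 g] unfolding D_def by blast
    have "g \<notin> cut E X" if X: "X \<in> L" "l < real (card X)" for X
    proof
      assume c: "g \<in> cut E X"
      have nc: "g \<inter> X \<noteq> {}" "\<not> g \<subseteq> X" using c mem_cut[OF gE] by auto
      then have "X \<inter> T' \<noteq> {}" "\<not> T' \<subseteq> X" using gD by (auto simp: D_def)
      then have XT': "X \<subset> T'" using laminarD[OF flpD(2)[OF L] X(1) bigsD(1)[OF a(2)]] by blast
      then have "card X \<le> card T'" using T'V fin(1) by (intro card_mono) (auto intro: finite_subset)
      then have XB: "X \<in> ?B" using X bigsD(3)[OF a(2)] by (auto simp: bigs_def)
      have nXT: "\<not> X \<subseteq> T" using nc gD by (auto simp: D_def)
      show False
      proof (cases "T = {}")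
        case True
        then show False using nomid[OF XB _ XT'] flpD(6)[OF L X(1)] by auto
      next
        case False
        then have "X \<subseteq> T \<or> T \<subseteq> X"
          using a bigs_nested[OF L XB _ T'V _ _ bigsD(3)[OF a(2)], of T] XT' by auto
        then show False using nomid[OF XB _ XT'] nXT by blast
      qed
    qed
    then show "g \<subseteq> D \<and> (\<forall>T\<in>L. l < real (card T) \<longrightarrow> g \<notin> cut E T)" using gD by blast
  qed
  then show "touching N1 (T' - T) = touching N2 (T' - T)" by (simp add: D_def)
qed

section \<open>Contractibility in smaller faces\<close>

lemma contractibleI:
  assumes S: "S \<in> tight F"
    and eq: "\<And>N M e. N \<in> PM F \<Longrightarrow> M \<in> PM F \<Longrightarrow> e \<in> N \<Longrightarrow> e \<in> M \<Longrightarrow> e \<in> cut E S \<Longrightarrow> touching N S = touching M S"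
  shows "contractible V E F S"
  unfolding contractible_def
proof (intro conjI ballI S notI)
  fix e assume e: "e \<in> cut E S"
    and "\<exists>M\<in>PM F. \<exists>N\<in>PM F. e \<in> M \<and> e \<in> N \<and> M \<inter> edges_within E S \<noteq> N \<inter> edges_within E S"
  then obtain M N where MN: "M \<in> PM F" "N \<in> PM F" "e \<in> M" "e \<in> N" "M \<inter> edges_within E S \<noteq> N \<inter> edges_within E S" by blast
  have t: "touching M S = touching N S" by (rule eq[OF MN(1-4) e])
  have "K \<inter> edges_within E S = touching K S \<inter> edges_within E S" for K
  proof -
    have "g \<inter> S \<noteq> {}" if "g \<in> edges_within E S" for g
    proof -
      have "g \<subseteq> S" "card g = 2" using that fin(4) by (auto simp: edges_within_def)
      then show ?thesis by (metis Int_absorb2 card.empty zero_neq_numeral)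
    qed
    then show ?thesis by (auto simp: touching_def)
  qed
  then show False using MN(5) t by metis
qed

text \<open>Replacing \<open>N\<close> by \<open>M\<close> inside \<open>S\<close> gives a matching
  of \<open>F'\<close> that still contains the boundary edge of \<open>N\<close> at
  \<open>U\<close>. By contractibility of \<open>U\<close> it agrees with \<open>N\<close> on
  \<open>U\<close>, hence \<open>M\<close> agrees with \<open>N\<close> on \<open>S\<close>.\<close>

lemma contractible_sub:
  assumes U: "contractible V E F U" and F': "pm_face V E F'" "F' \<subseteq> F" and S: "S \<in> tight F'" "S \<subseteq> U"
  shows "contractible V E F' S"
proof (rule contractibleI[OF S(1)])
  fix N M e assume N: "N \<in> PM F'" "M \<in> PM F'" "e \<in> N" "e \<in> M" "e \<in> cut E S"
  have NF: "N \<in> PM F" "M \<in> PM F" using N(1,2) matchings_mono[OF F'(2)] by blast+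
  have Ut: "U \<in> tight F" using U by (simp add: contractible_def)
  have NE: "N \<subseteq> E" "M \<subseteq> E" using PM_D(3) NF by blast+
  have cl: "g \<in> N \<inter> M \<or> g \<subseteq> S \<or> g \<inter> S = {}" if g: "g \<in> N \<union> M" for g
  proof -
    have "bd N S = bd M S" using bd(3)[OF S(1) N(1,3,5)] bd(3)[OF S(1) N(2,4,5)] by simp
    then show ?thesis using shared_boundary[OF S(1) N(1,2) _ g] mem_cut[of g S] g NE by blast
  qed
  define K where "K = swap_on S N M"
  have K: "K \<in> PM F'" unfolding K_def by (rule swap_in_face[OF F'(1) N(1,2) cl])
  then have KF: "K \<in> PM F" using matchings_mono[OF F'(2)] by blast
  define a where "a = bd N U"
  have a: "a \<in> N" "a \<in> cut E U" using bd(1,2)[OF Ut NF(1)] by (simp_all add: a_def)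
  have aE: "a \<in> E" using a NE by blast
  have "a \<in> K"
  proof (cases "a \<inter> S = {}")
    case True
    then show ?thesis using a by (simp add: K_def swap_on_def)
  next
    case False
    have "\<not> a \<subseteq> S" using a(2) mem_cut[OF aE] S(2) by blast
    then have "a \<in> M" using cl[of a] a(1) False by blast
    then show ?thesis using False by (simp add: K_def swap_on_def)
  qed
  from contractible_touching[OF U NF(1) KF a(1) this a(2)] have t: "touching N U = touching K U" .
  have "g \<in> N \<longleftrightarrow> g \<in> M" if g: "g \<inter> S \<noteq> {}" for g
  proof -
    have "g \<inter> U \<noteq> {}" using g S(2) by blast
    then have "g \<in> N \<longleftrightarrow> g \<in> K" using t unfolding touching_def by blast
    also have "\<dots> \<longleftrightarrow> g \<in> M" using g by (auto simp: K_def swap_on_def)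
    finally show ?thesis .
  qed
  then show "touching N S = touching M S" unfolding touching_def by blast
qed

text \<open>The interval from the empty set to \<open>S\<close> has only the boundary edge at
  \<open>S\<close>.\<close>

lemma contractible_if_det:
  assumes L: "face_laminar_pair V E F L" and F': "F' \<subseteq> F" and det: "det L l F' r"
    and S: "S \<in> bigs L l" "lev L l S \<le> r"
  shows "contractible V E F' S"
proof (rule contractibleI)
  show St: "S \<in> tight F'" using bigsD(1)[OF S(1)] flpD(4)[OF L] face_tight_mono[OF F', of V E] by blast
  fix N M e assume N: "N \<in> PM F'" "M \<in> PM F'" "e \<in> N" "e \<in> M" "e \<in> cut E S"
  have "bd N S = bd M S" using bd(3)[OF St N(1,3,5)] bd(3)[OF St N(2,4,5)] by simp
  moreover have "{} \<subset> S" using flpD(6)[OF L bigsD(1)[OF S(1)]] by blast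
  ultimately have "touching N (S - {}) = touching M (S - {})"
    using S N by (intro detD[OF det]) auto
  then show "touching N S = touching M S" by simp
qed

text \<open>The members of the chain have distinct odd cardinalities between 3 and
  \<open>card V\<close>.\<close>

lemma lev_le_half:
  assumes L: "face_laminar_pair V E F L" and l: "1 \<le> l" and S: "S \<in> bigs L l"
  shows "lev L l S \<le> (card V - 1) div 2"
proof -
  have SV: "S \<subseteq> V" by (rule flpD(5)[OF L bigsD(1)[OF S]])
  define C where "C = {X \<in> bigs L l. X \<subseteq> S}"
  have cX: "odd (card X)" "3 \<le> card X" "card X \<le> card V" "finite X" if X: "X \<in> C" for X
  proof -
    have XL: "X \<in> L" "l < real (card X)" using X by (auto simp: C_def bigs_def)
    show o: "odd (card X)" using XL flpD(4)[OF L] by (auto simp: face_tight_def odd_sets_def)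
    have "1 < card X" using XL l by linarith
    then show "3 \<le> card X" using o by presburger
    show "card X \<le> card V" using flpD(5)[OF L XL(1)] fin(1) by (rule card_mono[rotated])
    show "finite X" by (rule flpD(7)[OF L XL(1)])
  qed
  have "inj_on (\<lambda>X. (card X - 1) div 2) C"
  proof (rule inj_onI)
    fix X Y assume XY: "X \<in> C" "Y \<in> C" "(card X - 1) div 2 = (card Y - 1) div 2"
    then have "card X = card Y" using cX[OF XY(1)] cX[OF XY(2)] by presburger
    moreover have "X \<subseteq> Y \<or> Y \<subseteq> X"
      using XY bigs_nested[OF L _ _ SV _ _ bigsD(3)[OF S]] by (auto simp: C_def)
    ultimately show "X = Y" using cX(4)[OF XY(1)] cX(4)[OF XY(2)] by (metis card_subset_eq)
  qed
  moreover have "(\<lambda>X. (card X - 1) div 2) ` C \<subseteq> {1..(card V - 1) div 2}"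
  proof
    fix z assume "z \<in> (\<lambda>X. (card X - 1) div 2) ` C"
    then obtain X where X: "X \<in> C" "z = (card X - 1) div 2" by blast
    have "2 \<le> card X - 1" "card X - 1 \<le> card V - 1" using cX[OF X(1)] by linarith+
    then have "2 div 2 \<le> (card X - 1) div 2" "(card X - 1) div 2 \<le> (card V - 1) div 2" using div_le_mono by blast+
    then show "z \<in> {1..(card V - 1) div 2}" using X(2) by simp
  qed
  ultimately have "card C \<le> card {1..(card V - 1) div 2}" by (intro card_inj_on_le) auto
  then show ?thesis by (simp add: C_def lev_def)
qed

section \<open>Combining the rounds\<close>

lemma foldl_face_Min:
  assumes F: "pm_face V E F" and V: "V \<noteq> {}" and ws: "set ws \<subseteq> weights (card V) num"
  shows "face_Min E F (\<lambda>e. real_of_int (foldl (weight_comp (card V)) w ws e)) =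
    foldl (\<lambda>F w. face_Min E F (\<lambda>e. real_of_int (w e))) (face_Min E F (\<lambda>e. real_of_int (w e))) ws"
  using ws
proof (induction ws rule: rev_induct)
  case (snoc x ws)
  then show ?case using face_Min_comp[OF F V, of x num "foldl (weight_comp (card V)) w ws"] by simp
qed simp

lemma det_iterate:
  assumes L: "face_laminar_pair V E F L" and F1: "pm_face V E F1" "F1 \<subseteq> F"
    and n: "32 \<le> card V" and num: "bij_betw num E {1..card E}" and det: "det L l F1 1"
  shows "\<exists>ws. length ws = k \<and> set ws \<subseteq> weights (card V) num \<and>
    (let F' = foldl (\<lambda>F w. face_Min E F (\<lambda>e. real_of_int (w e))) F1 ws in
      pm_face V E F' \<and> F' \<subseteq> F1 \<and> det L l F' (2 ^ k))"
proof (induction k)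
  case 0
  then show ?case using F1 det by (intro exI[of _ "[]"]) auto
next
  case (Suc k)
  then obtain ws where ws: "length ws = k" "set ws \<subseteq> weights (card V) num"
    and d: "let F' = foldl (\<lambda>F w. face_Min E F (\<lambda>e. real_of_int (w e))) F1 ws in
      pm_face V E F' \<and> F' \<subseteq> F1 \<and> det L l F' (2 ^ k)" by blast
  define F' where "F' = foldl (\<lambda>F w. face_Min E F (\<lambda>e. real_of_int (w e))) F1 ws"
  have F': "pm_face V E F'" "F' \<subseteq> F1" "det L l F' (2 ^ k)" using d by (auto simp: F'_def Let_def)
  have V: "V \<noteq> {}" using n by auto
  have "F' \<subseteq> F" using F'(2) F1(2) by blast
  from det_double[OF L F'(1) this n num _ F'(3)] obtain w where w: "w \<in> weights (card V) num"
    "det L l (face_Min E F' (\<lambda>e. real_of_int (w e))) (2 ^ Suc k)" by auto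
  have "face_Min E F' (\<lambda>e. real_of_int (w e)) \<subseteq> F1" using face_Min_subset F'(2) by blast
  then show ?case using ws w pm_face_Min[OF F'(1) V]
    by (intro exI[of _ "ws @ [w]"]) (auto simp: F'_def[symmetric] Let_def)
qed

text \<open>A circuit of weight at most \<open>l\<close> visits only nodes of at most
  \<open>l\<close> elements, which are nodes of the \<open>l\<close>-contraction as well. If one of
  its edges crossed a member of \<open>L\<close> of cardinality in the range from \<open>l\<close>
  to \<open>2 * l\<close>, this member would contain a visited node, against the maximality of that
  node.\<close>

lemma circuit_coarser:
  assumes L: "face_laminar_pair V E F L" and l: "1 \<le> l" and F': "F' \<subseteq> F"
    and xs: "circuit (contraction E F' L (2 * l)) xs" "real (nwt (contraction E F' L (2 * l)) xs) \<le> l"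
  shows "circuit (contraction E F L l) xs" "nwt (contraction E F L l) xs = nwt (contraction E F' L (2 * l)) xs"
proof -
  let ?H' = "contraction E F' L (2 * l)" and ?H = "contraction E F L l"
  show "nwt ?H xs = nwt ?H' xs" by (simp add: nwt_def con_simps)
  have l2: "1 \<le> 2 * l" using l by simp
  have node: "U \<in> contraction_nodes L l" if U: "U \<in> contraction_nodes L (2 * l)" "real (card U) \<le> l" for U
    using U l by (auto simp: contraction_nodes_def)
  have step: "e \<in> mg_edges ?H \<and> mg_ends ?H e = {U, W}"
    if e: "e \<in> mg_edges ?H'" "mg_ends ?H' e = {U, W}" and UW: "real (card U) \<le> l" "real (card W) \<le> l" for e U W
  proof -
    note ee = edge_ends[OF L l2 e]
    have eE: "e \<in> E" using e(1) supp_E unfolding con_simps by blast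
    have nU: "U \<in> contraction_nodes L l" "W \<in> contraction_nodes L l" using node ee UW by auto
    have tU: "e \<inter> U \<noteq> {}" "e \<inter> W \<noteq> {}" using ee(6,7) mem_cut[OF eE] by auto
    have "e \<notin> cut E T" if T: "T \<in> L" "l < real (card T)" for T
    proof
      assume c: "e \<in> cut E T"
      have big: "T \<inter> U = {} \<or> U \<subseteq> T" "T \<inter> W = {} \<or> W \<subseteq> T"
        using node_big[OF L nU(1) T] node_big[OF L nU(2) T] by auto
      show False
      proof (cases "real (card T) \<le> 2 * l")
        case True
        have "T \<noteq> U" "T \<noteq> W" using UW T by auto
        then have "\<not> U \<subseteq> T" "\<not> W \<subseteq> T" using nodesD(3)[OF ee(1) T(1) True] nodesD(3)[OF ee(2) T(1) True] by auto
        then have "e \<inter> T = {}" using big ee(5) by blast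
        then show False using c mem_cut[OF eE] by blast
      next
        case False
        then show False using c e(1) T unfolding con_simps by auto
      qed
    qed
    moreover have "\<not> e \<subseteq> S" if S: "S \<in> contraction_nodes L l" for S
    proof
      assume eS: "e \<subseteq> S"
      then have "S = U" "S = W" using node_unique[OF L S nU(1)] node_unique[OF L S nU(2)] tU by blast+
      then show False using ee(3) by simp
    qed
    moreover have "e \<in> supp F" using e(1) face_supp_mono[OF F', of E] unfolding con_simps by blast
    ultimately have "e \<in> mg_edges ?H" unfolding con_simps by blast
    then show ?thesis using ends_eq(1)[OF L eE nU ee(3) tU] by blast
  qed
  have ch: "chain ?H ys v" if "chain ?H' ys v" "\<forall>x\<in>set ys. real (card (fst x)) \<le> l" "real (card v) \<le> l" for ys v
    using that
  proof (induction ys)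
    case (Cons y ys)
    have "real (card (hdn ys v)) \<le> l" using Cons.prems by (cases ys) auto
    then show ?case using Cons step[of "snd y" "fst y" "hdn ys v"] node[of "fst y"] by (simp add: con_simps(1))
  qed simp
  have small: "\<forall>x\<in>set xs. real (card (fst x)) \<le> l"
  proof
    fix x assume "x \<in> set xs"
    then have "card (fst x) \<le> nwt ?H' xs"
      unfolding nwt_def con_simps by (intro member_le_sum_list) auto
    then show "real (card (fst x)) \<le> l" using xs(2) by linarith
  qed
  have "xs \<noteq> []" using xs(1) by (simp add: circuit_def)
  then have "real (card (fst (hd xs))) \<le> l" using small by simp
  then show "circuit ?H xs" using xs(1) ch[OF _ small] by (auto simp: circuit_def)
qed

theorem good_pair_double:
  assumes num: "bij_betw num E {1..card E}" and n: "32 \<le> card V"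
    and l: "1 \<le> l" "l \<le> real (card V)" and good: "good_pair V E l F L"
  shows "\<exists>w \<in> weights_pow (card V) num (nat \<lceil>log 2 (real (card V))\<rceil> + 1).
    \<exists>L'. L \<subseteq> L' \<and> good_pair V E (2 * l) (face_Min E F (\<lambda>e. real_of_int (w e))) L'"
proof -
  have V: "V \<noteq> {}" using n by auto
  have l2: "1 \<le> 2 * l" and l0: "0 < l" using l by auto
  have L: "face_laminar_pair V E F L" using good by (simp add: good_pair_def)
  have contr: "contractible V E F S" if "S \<in> L" "real (card S) \<le> l" for S
    using good that by (simp add: good_pair_def)
  have short: "l < real (nwt (contraction E F L l) xs)" if "circuit (contraction E F L l) xs" for xs
    using good that no_alternating_circuit_iff[of "contraction E F L l" l] by (auto simp: good_pair_def)
  have Ff: "pm_face V E F" by (rule flpD(1)[OF L])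

  obtain w1 where w1: "w1 \<in> weights (card V) num" "\<And>xs. circuit (contraction E F L l) xs \<Longrightarrow>
      real (nwt (contraction E F L l) xs) \<le> 2 * l \<Longrightarrow>
      (\<lambda>g. real_of_int (lift F L l (map snd xs) g)) \<notin> face_dir V E (face_Min E F (\<lambda>e. real_of_int (w1 e)))"
    using kill_round[OF L l(1) n num l0 l(2) short] by blast
  define F1 where "F1 = face_Min E F (\<lambda>e. real_of_int (w1 e))"
  have F1: "pm_face V E F1" "F1 \<subseteq> F" unfolding F1_def by (rule pm_face_Min[OF Ff V], rule face_Min_subset)
  have det1: "det L l F1 1" using w1(2) by (intro det_one[OF L l(1) contr F1]) (auto simp: F1_def)

  define c where "c = nat \<lceil>log 2 (real (card V))\<rceil>"
  have c: "1 \<le> c" "card V \<le> 2 ^ c"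
  proof -
    have lp: "0 < log 2 (real (card V))" using n by simp
    then have "0 < \<lceil>log 2 (real (card V))\<rceil>" by simp
    then show "1 \<le> c" unfolding c_def by linarith
    have "log 2 (real (card V)) \<le> real c" unfolding c_def by (rule real_nat_ceiling_ge)
    then have "real (card V) \<le> 2 powr real c" using n by (simp add: log_le_iff)
    then have "real (card V) \<le> real (2 ^ c)" by (simp add: powr_realpow)
    then show "card V \<le> 2 ^ c" by (simp only: of_nat_le_iff)
  qed
  \<comment> \<open>By \<open>lev_le_half\<close> intervals of length \<open>2 ^ (c - 1)\<close>
    exhaust every chain. With one weight function before and one after, this makes the required
    \<open>c + 1\<close>.\<close>
  obtain ws where ws: "length ws = c - 1" "set ws \<subseteq> weights (card V) num"
    and d: "let F' = foldl (\<lambda>F w. face_Min E F (\<lambda>e. real_of_int (w e))) F1 ws in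
      pm_face V E F' \<and> F' \<subseteq> F1 \<and> det L l F' (2 ^ (c - 1))"
    using det_iterate[OF L F1 n num det1] by blast
  define F' where "F' = foldl (\<lambda>F w. face_Min E F (\<lambda>e. real_of_int (w e))) F1 ws"
  have F': "pm_face V E F'" "F' \<subseteq> F1" "det L l F' (2 ^ (c - 1))" using d by (auto simp: F'_def Let_def)
  have F'F: "F' \<subseteq> F" using F'(2) F1(2) by blast
  have L': "face_laminar_pair V E F' L"
    using L F'(1) face_tight_mono[OF F'F, of V E] by (auto simp: face_laminar_pair_def)
  have contr': "contractible V E F' S" if S: "S \<in> L" "real (card S) \<le> 2 * l" for S
  proof (cases "real (card S) \<le> l")
    case True
    have "S \<in> tight F'" using S flpD(4)[OF L'] by blast
    then show ?thesis using contractible_sub[OF contr[OF S(1) True] F'(1) F'F] by blast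
  next
    case False
    then have SB: "S \<in> bigs L l" using S by (simp add: bigs_def)
    have "lev L l S \<le> (card V - 1) div 2" by (rule lev_le_half[OF L l(1) SB])
    also have "\<dots> \<le> 2 ^ c div 2" using c(2) by (intro div_le_mono) linarith
    also have "\<dots> = 2 ^ (c - 1)" using c(1) by (cases c) auto
    finally show ?thesis by (rule contractible_if_det[OF L F'F F'(3) SB])
  qed
  \<comment> \<open>The last round counts circuits of weight up to \<open>2 * l\<close> in the
    coarser contraction, and for this it needs the lower bound \<open>l\<close> there.\<close>
  have short': "l < real (nwt (contraction E F' L (2 * l)) xs)" if xs: "circuit (contraction E F' L (2 * l)) xs" for xs
  proof (rule ccontr)
    assume "\<not> ?thesis"
    then have "real (nwt (contraction E F' L (2 * l)) xs) \<le> l" by simp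
    from circuit_coarser[OF L l(1) F'F xs this] short[of xs] this show False by simp
  qed

  obtain w2 where w2: "w2 \<in> weights (card V) num" "\<And>xs. circuit (contraction E F' L (2 * l)) xs \<Longrightarrow>
      real (nwt (contraction E F' L (2 * l)) xs) \<le> 2 * l \<Longrightarrow>
      (\<lambda>g. real_of_int (lift F' L (2 * l) (map snd xs) g)) \<notin> face_dir V E (face_Min E F' (\<lambda>e. real_of_int (w2 e)))"
    using kill_round[OF L' l2 n num l0 l(2) short'] by blast
  define F2 where "F2 = face_Min E F' (\<lambda>e. real_of_int (w2 e))"
  have F2: "pm_face V E F2" "F2 \<subseteq> F'" unfolding F2_def by (rule pm_face_Min[OF F'(1) V], rule face_Min_subset)
  have Lt: "L \<subseteq> tight F2" using flpD(4)[OF L'] face_tight_mono[OF F2(2), of V E] by blast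
  have "finite (tight F2)" by (rule finite_subset[OF _ finite_odd_sets]) (auto simp: face_tight_def)
  from ex_maximal_laminar[OF this Lt flpD(2)[OF L]] obtain L2 where
    L2: "L \<subseteq> L2" "maximal_laminar_subset (tight F2) L2" by blast
  have L2p: "face_laminar_pair V E F2 L2"
    using L2 F2(1) flpD(3)[OF L] by (auto simp: face_laminar_pair_def maximal_laminar_subset_def)
  have kill2: "\<And>xs. circuit (contraction E F' L (2 * l)) xs \<Longrightarrow>
      real (nwt (contraction E F' L (2 * l)) xs) \<le> 2 * l \<Longrightarrow>
      (\<lambda>g. real_of_int (lift F' L (2 * l) (map snd xs) g)) \<notin> face_dir V E F2" using w2(2) by (simp add: F2_def)
  \<comment> \<open>A set inside an old node inherits contractibility from it. Any other one is a
    union of old nodes; its matchings with a common boundary edge agree by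
    \<open>region_agree\<close>.\<close>
  have contr2: "contractible V E F2 S" if S: "S \<in> L2" "real (card S) \<le> 2 * l" for S
  proof (cases "\<exists>U\<in>contraction_nodes L (2 * l). S \<subseteq> U")
    case True
    then obtain U where U: "U \<in> contraction_nodes L (2 * l)" "S \<subseteq> U" by blast
    have "S \<in> tight F2" using S flpD(4)[OF L2p] by blast
    then show ?thesis using contractible_sub[OF contr'[OF nodesD(1,2)[OF U(1)]] F2 _ U(2)] by blast
  next
    case False
    have St: "S \<in> tight F2" using S flpD(4)[OF L2p] by blast
    define Q0 where "Q0 = {q \<in> contraction_nodes L (2 * l). q \<subseteq> S}"
    have SQ: "S = \<Union>Q0"
    proof
      show "S \<subseteq> \<Union>Q0"
      proof
        fix v assume v: "v \<in> S"
        then have "v \<in> V" using flpD(5)[OF L2p S(1)] by blast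
        then obtain q where q: "q \<in> contraction_nodes L (2 * l)" "v \<in> q" using node_of[OF L' l2] by blast
        have "q \<in> L2" using nodesD(1)[OF q(1)] L2(1) by blast
        then have "q \<subseteq> S" using laminarD[OF flpD(2)[OF L2p] S(1)] q v False by blast
        then show "v \<in> \<Union>Q0" using q by (auto simp: Q0_def)
      qed
    qed (auto simp: Q0_def)
    show ?thesis
    proof (rule contractibleI[OF St])
      fix N M e assume N: "N \<in> PM F2" "M \<in> PM F2" "e \<in> N" "e \<in> M" "e \<in> cut E S"
      have bdeq: "bd N S = bd M S" using bd(3)[OF St N(1,3,5)] bd(3)[OF St N(2,4,5)] by simp
      show "touching N S = touching M S"
      proof (rule region_agree[OF L' l2 contr' F2 kill2 N(1,2) _ SQ S(2)])
        show "Q0 \<subseteq> contraction_nodes L (2 * l)" by (auto simp: Q0_def)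
        fix g assume g: "g \<in> (N - M) \<union> (M - N)" "g \<inter> S \<noteq> {}"
        have gE: "g \<in> E" using g PM_D(3)[OF N(1)] PM_D(3)[OF N(2)] by blast
        have "g \<notin> cut E S" using shared_boundary[OF St N(1,2) bdeq, of g] g by blast
        then have gS: "g \<subseteq> S" using g(2) mem_cut[OF gE] by blast
        have "g \<notin> cut E T" if T: "T \<in> L" "2 * l < real (card T)" for T
        proof -
          have "\<not> T \<subseteq> S"
          proof
            assume "T \<subseteq> S"
            then have "card T \<le> card S" using flpD(7)[OF L2p S(1)] by (rule card_mono[rotated])
            then show False using T S by linarith
          qed
          then have "S \<subseteq> T \<or> S \<inter> T = {}" using laminarD[OF flpD(2)[OF L2p] S(1), of T] T L2(1) by blast
          then show ?thesis using gS mem_cut[OF gE] by blast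
        qed
        then show "g \<subseteq> S \<and> (\<forall>T\<in>L. 2 * l < real (card T) \<longrightarrow> g \<notin> cut E T)" using gS by blast
      qed
    qed
  qed
  have short2: "2 * l < real (nwt (contraction E F2 L2 (2 * l)) xs)" if xs: "circuit (contraction E F2 L2 (2 * l)) xs" for xs
  proof (rule ccontr)
    assume "\<not> ?thesis"
    then have le: "real (nwt (contraction E F2 L2 (2 * l)) xs) \<le> 2 * l" by simp
    \<comment> \<open>The expanded circuit is short and has the same lift. As a lift for
      \<open>L\<close> this vector is not a direction of \<open>F2\<close>, as a lift for
      \<open>L2\<close> it is one.\<close>
    obtain ys where ys: "circuit (contraction E F' L (2 * l)) ys"
      "nwt (contraction E F' L (2 * l)) ys \<le> nwt (contraction E F2 L2 (2 * l)) xs"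
      "\<And>g. lift F' L (2 * l) (map snd ys) g = lift F2 L2 (2 * l) (map snd xs) g"
      using expand_circuit[OF L' l2 contr' L2p L2(1) F2(2) contr2 xs] by blast
    have "real (nwt (contraction E F' L (2 * l)) ys) \<le> 2 * l" using ys(2) le by linarith
    from kill2[OF ys(1) this] show False
      unfolding ys(3) using lift_in_dir[OF L2p l2 L2(2) xs] by (rule notE)
  qed
  have "good_pair V E (2 * l) F2 L2"
    unfolding good_pair_def
  proof (intro conjI)
    show "1 \<le> 2 * l" "2 * l \<le> 2 * real (card V)" using l by auto
    show "\<forall>S\<in>L2. real (card S) \<le> 2 * l \<longrightarrow> contractible V E F2 S" using contr2 by blast
    show "\<nexists>vs es. alternating_circuit (contraction E F2 L2 (2 * l)) vs es \<and>
        real (walk_node_weight (contraction E F2 L2 (2 * l)) vs) \<le> 2 * l"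
      unfolding no_alternating_circuit_iff using short2 by blast
  qed (fact L2p L2(2))+
  moreover define w where "w = foldl (weight_comp (card V)) w1 (ws @ [w2])"
  have "face_Min E F (\<lambda>e. real_of_int (w e)) = F2"
    unfolding w_def using foldl_face_Min[OF Ff V, of "ws @ [w2]" num w1] ws(2) w2(1)
    by (simp add: F2_def F'_def F1_def)
  moreover have "w \<in> weights_pow (card V) num (c + 1)"
    unfolding weights_pow_def w_def using w1(1) ws w2(1) c(1)
    by (intro CollectI exI[of _ w1] exI[of _ "ws @ [w2]"]) auto
  ultimately show ?thesis using L2(1) unfolding c_def by blast
qed

end

theorem theorem4p9:
  "\<exists>n\<^sub>0::nat. \<forall>(V::'a set) (E::'a set set) (num::'a set \<Rightarrow> nat) (l::real)
      (F::('a set \<Rightarrow> real) set) (L::'a set set).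
     simple_graph V E \<longrightarrow> card V \<ge> n\<^sub>0 \<longrightarrow> bij_betw num E {1..card E} \<longrightarrow>
     1 \<le> l \<longrightarrow> l \<le> real (card V) \<longrightarrow> good_pair V E l F L \<longrightarrow>
     (\<exists>w \<in> weights_pow (card V) num (nat \<lceil>log 2 (real (card V))\<rceil> + 1).
        \<exists>L'. L \<subseteq> L' \<and> good_pair V E (2 * l) (face_Min E F (\<lambda>e. real_of_int (w e))) L')"
\<comment> \<open>The square of 32 is the constant 1024 in the count of lifts in
  \<open>kill_round\<close>.\<close>
proof (intro exI[of _ 32] allI impI)
  fix V :: "'a set" and E num l F L
  assume "simple_graph V E" "32 \<le> card V" "bij_betw num E {1..card E}" "1 \<le> l" "l \<le> real (card V)" "good_pair V E l F L"
  then show "\<exists>w \<in> weights_pow (card V) num (nat \<lceil>log 2 (real (card V))\<rceil> + 1).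
        \<exists>L'. L \<subseteq> L' \<and> good_pair V E (2 * l) (face_Min E F (\<lambda>e. real_of_int (w e))) L'"
    by (intro sgraph.good_pair_double) (simp_all add: sgraph_def)
qed

end
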